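(* Let $X=(X_1,\dots,X_n)$ be a random vector with $\mathbb{E}X_i=0$ and $\tau_i^3:=\mathbb{E}|X_i|^3<\infty$ for all $i$, let $\bar\tau=\sup_i\tau_i$, and let $\Sigma=(\sigma_{ij})$ be its covariance matrix. Assume that for each $i\in[n]$ there is a subset $A_i\subset[n]$ such that $X_{A_i^c}$ and $X_i$ are independent, and that for each $i\in[n]$ and $j\in A_i$ there is a subset $B_{ij}\subset[n]$ such that $A_i\subset B_{ij}$ and $X_{B_{ij}^c}$ is independent of $(X_i,X_j)$. Let $Z\sim\mathrm{MVN}_n(0,\Sigma)$. Then, for any three times partially differentiable function $h:\mathbb{R}^n\to\mathbb{R}$, $$|\mathbb{E}h(X)-\mathbb{E}h(Z)|\le\frac13\sum_{i}\sum_{j\in A_i}\sum_{k\in B_{ij}}\bigl(|\sigma_{ij}|\,\mathbb{E}|X_k|+\mathbb{E}|X_iX_jX_k|\bigr)\|h_{ijk}\|_\infty+\frac16\sum_i\sum_{j,k\in A_i}\mathbb{E}|X_iX_jX_k|\,\|h_{ijk}\|_\infty\le\frac56\,\bar\tau^3\,n\,\eta\,|h|_3,$$ where $\eta=\sup_i\sum_{j\in A_i}|B_{ij}|$.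
   Context: $[n]=\{1,\dots,n\}$; for $A\subset[n]$, $A^c=[n]\setminus A$ and $X_A=(X_j)_{j\in A}$; $|B|$ is the cardinality of a set $B$. $\mathrm{MVN}_n(0,\Sigma)$ is the centred Gaussian law on $\mathbb{R}^n$ with covariance matrix $\Sigma$. $h_{ijk}$ denotes the third order partial derivative in coordinates $i,j,k$, $\|\cdot\|_\infty$ is the supremum norm, and $|h|_3=\sup_{1\le i\le j\le k\le n}\|h_{ijk}\|_\infty$ (infinite bounds are vacuous). "Three times partially differentiable" means that all partial derivatives up to order three exist (mixed partial derivatives being independent of the order of differentiation). *)

theory Defs
  imports "HOL-Probability.Probability"
begin

definition partial_diff :: "'n \<Rightarrow> (real ^ 'n \<Rightarrow> real) \<Rightarrow> bool" where
  "partial_diff i f \<longleftrightarrow>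
     (\<forall>x. (\<lambda>t. f (x + t *\<^sub>R axis i 1)) field_differentiable (at 0))"

definition pd :: "'n \<Rightarrow> (real ^ 'n \<Rightarrow> real) \<Rightarrow> real ^ 'n \<Rightarrow> real" where
  "pd i f x = deriv (\<lambda>t. f (x + t *\<^sub>R axis i 1)) 0"

definition pd3 :: "(real ^ 'n \<Rightarrow> real) \<Rightarrow> 'n \<Rightarrow> 'n \<Rightarrow> 'n \<Rightarrow> real ^ 'n \<Rightarrow> real" where
  "pd3 h i j k = pd k (pd j (pd i h))"

text \<open>All partial derivatives up to order three exist everywhere (neither they nor \<open>h\<close> itself
  are assumed to be continuous or bounded). The last two lines generate all permutations of the
  indices.\<close>
definition thrice_partially_diff :: "(real ^ 'n \<Rightarrow> real) \<Rightarrow> bool" where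
  "thrice_partially_diff h \<longleftrightarrow>
     (\<forall>i. partial_diff i h) \<and>
     (\<forall>i j. partial_diff j (pd i h)) \<and>
     (\<forall>i j k. partial_diff k (pd j (pd i h))) \<and>
     (\<forall>i j. pd j (pd i h) = pd i (pd j h)) \<and>
     (\<forall>i j k. pd k (pd j (pd i h)) = pd j (pd k (pd i h)))"

text \<open>Supremum norms take values in \<open>[0, \<infinity>]\<close>, so no boundedness of the derivatives is needed to
  write them down. Products in \<open>[0, \<infinity>]\<close> follow the usual convention \<open>0 \<cdot> \<infinity> = 0\<close>.\<close>
definition supnorm :: "('a \<Rightarrow> real) \<Rightarrow> ennreal" where
  "supnorm f = (SUP x. ennreal \<bar>f x\<bar>)"

text \<open>The linear order on the index type is that of \<open>{1, \<dots>, n}\<close>.\<close>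
definition seminorm3 :: "(real ^ ('n::{finite,linorder}) \<Rightarrow> real) \<Rightarrow> ennreal" where
  "seminorm3 h = (SUP (i, j, k) \<in> {(i, j, k). i \<le> j \<and> j \<le> k}. supnorm (pd3 h i j k))"

definition covariance_matrix :: "'a measure \<Rightarrow> ('a \<Rightarrow> real ^ 'n) \<Rightarrow> real ^ 'n ^ 'n" where
  "covariance_matrix M X = (\<chi> i j. \<integral>\<omega>. (X \<omega> $ i - (\<integral>\<omega>'. X \<omega>' $ i \<partial>M)) *
                                      (X \<omega> $ j - (\<integral>\<omega>'. X \<omega>' $ j \<partial>M)) \<partial>M)"

text \<open>Independence of \<open>X\<^sub>S\<close> and \<open>X\<^sub>T\<close>. The library's \<open>indep_var\<close> needs both variables to have the same
  value type, so the single entry \<open>X\<^sub>i\<close> and the pair \<open>(X\<^sub>i, X\<^sub>j)\<close> are written as the subvectors indexed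
  by \<open>{i}\<close> and \<open>{i, j}\<close>.\<close>
definition indep_subvectors ::
  "'a measure \<Rightarrow> ('a \<Rightarrow> real ^ 'n) \<Rightarrow> 'n set \<Rightarrow> 'n set \<Rightarrow> bool" where
  "indep_subvectors M X S T \<longleftrightarrow>
     prob_space.indep_var M
       (Pi\<^sub>M S (\<lambda>_. borel)) (\<lambda>\<omega>. restrict (\<lambda>l. X \<omega> $ l) S)
       (Pi\<^sub>M T (\<lambda>_. borel)) (\<lambda>\<omega>. restrict (\<lambda>l. X \<omega> $ l) T)"

text \<open>Normal law on the real line with mean \<open>m\<close> and standard deviation \<open>s\<close>; \<open>s = 0\<close> gives the
  point mass.\<close>
definition normal_law :: "real \<Rightarrow> real \<Rightarrow> real measure" where
  "normal_law m s =
     (if s = 0 then return borel m else density lborel (\<lambda>x. ennreal (normal_density m s x)))"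

text \<open>Possibly degenerate Gaussian laws: the covariance matrix may be singular.\<close>
definition gaussian_law :: "(real ^ 'n) measure \<Rightarrow> bool" where
  "gaussian_law P \<longleftrightarrow> prob_space P \<and> sets P = sets borel \<and>
     (\<forall>a. \<exists>m s. 0 \<le> s \<and> distr P borel (\<lambda>x. a \<bullet> x) = normal_law m s)"

definition is_MVN0 :: "(real ^ 'n) measure \<Rightarrow> real ^ 'n ^ 'n \<Rightarrow> bool" where
  "is_MVN0 P S \<longleftrightarrow> gaussian_law P \<and> (\<forall>i. (\<integral>x. x $ i \<partial>P) = 0) \<and>
     covariance_matrix P (\<lambda>x. x) = S"

end

theory Submission
  imports Defs
begin

text \<open>
  Instead of solving a Stein equation, differentiate along the path
  \<open>\<phi> \<theta> = E h (sin \<theta> X + cos \<theta> Z)\<close> with \<open>X\<close> and \<open>Z\<close> independent, which runs from \<open>E h Z\<close> to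
  \<open>E h X\<close>. Gaussian integration by parts rewrites \<open>\<phi>' \<theta>\<close> as \<open>cos \<theta>\<close> times the expectation of
  \<open>\<Sum>\<^sub>i X\<^sub>i h\<^sub>i - sin \<theta> \<Sum>\<^sub>i\<^sub>j \<sigma>\<^sub>i\<^sub>j h\<^sub>i\<^sub>j\<close>. In this sum one switches off \<open>X\<close> on \<open>A\<^sub>i\<close> and then on \<open>B\<^sub>i\<^sub>j\<close>;
  independence removes the terms of order one and two, and the remainder is at most
  \<open>3 sin\<^sup>2 \<theta>\<close> times the bound. The integral of \<open>cos \<theta> sin\<^sup>2 \<theta>\<close> over \<open>[0, \<pi>/2]\<close> is \<open>1/3\<close>.

  A finite bound controls only those \<open>h\<^sub>i\<^sub>j\<^sub>k\<close> whose weight is positive, so nothing is known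
  about the regularity of \<open>h\<close> jointly in all coordinates. All expansions therefore change one coordinate at a
  time. Continuity of \<open>h\<close>, of its gradient and of the relevant \<open>h\<^sub>i\<^sub>j\<close>, as well as integrability of
  \<open>h X\<close>, come from approximating derivatives uniformly by difference quotients of \<open>h\<close>, which
  needs bounds on \<open>h\<^sub>i\<^sub>i\<^sub>i\<close>, \<open>h\<^sub>i\<^sub>i\<^sub>j\<close> and \<open>h\<^sub>i\<^sub>j\<^sub>j\<close> for \<open>j \<in> A\<^sub>i\<close> only.
\<close>

section \<open>Coordinatewise Taylor expansion\<close>

text \<open>Why the few bounds on derivatives are available: if X_i is not almost surely 0, it
  cannot be independent of itself, so i \<in> A_i, its variance is positive, and h_iij with j \<in>
  A_i has positive weight as soon as E|X_j| > 0. For h_ijj with j \<in> A_i, either i \<in> A_j, and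
  symmetry of the derivatives leads back to the first case, or X_i and X_j are independent and E|X_i
  X_j X_j| > 0. A general h_ijk may be unbounded, but then X_i X_j X_k vanishes almost surely and
  \<sigma>_ij E|X_k| = 0. Integrability is the main obstacle. Cubic growth along each axis yields
  only a product of factors (1 + |x_l|)^3, and a product of several |X_l|^3 need not be integrable.
  A dominating function for h X is therefore built from independence, by the same switching off that
  produces the bound. A singular \<Sigma> rules out working with a density on R^n; integration by
  parts happens on lines in the direction of a row of \<Sigma>, where the law is
  one-dimensional.\<close>

definition msk :: "'n set \<Rightarrow> real ^ 'n \<Rightarrow> real ^ 'n" where
  "msk S x = (\<chi> l. if l \<in> S then x $ l else 0)"

lemma msk_nth [simp]: "msk S x $ l = (if l \<in> S then x $ l else 0)"
  by (simp add: msk_def)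

lemma msk_empty [simp]: "msk {} x = 0"
  by (simp add: vec_eq_iff)

lemma msk_UNIV [simp]: "msk UNIV x = x"
  by (simp add: vec_eq_iff)

lemma msk_msk: "msk S (msk R x) = msk (S \<inter> R) x"
  by (simp add: vec_eq_iff)

lemma msk_insert: "j \<notin> J \<Longrightarrow> msk (insert j J) x = msk J x + x $ j *\<^sub>R axis j 1"
  by (auto simp: vec_eq_iff axis_def)

lemma msk_measurable [measurable]: "(msk S :: real ^ 'a \<Rightarrow> real ^ 'a) \<in> borel_measurable borel"
proof -
  have "continuous_on UNIV (msk S :: real ^ 'a \<Rightarrow> real ^ 'a)"
    unfolding msk_def
  proof (intro continuous_on_vec_lambda)
    show "continuous_on UNIV (\<lambda>x::real^'a. if l \<in> S then x $ l else 0)" for l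
      by (cases "l \<in> S") (auto intro!: continuous_intros)
  qed
  then show ?thesis by (rule borel_measurable_continuous_onI)
qed

lemma vec_nth_measurable [measurable]: "(\<lambda>x::real^'n. x $ i) \<in> borel_measurable borel"
  by (intro borel_measurable_continuous_onI continuous_intros)

section \<open>One-variable Taylor estimates\<close>

lemma abs_le_power_Suc:
  fixes v v' :: "real \<Rightarrow> real"
  assumes d: "\<And>t. (v has_real_derivative v' t) (at t)" and "v 0 = 0"
    and b: "\<And>t. \<bar>v' t\<bar> \<le> C * \<bar>t\<bar> ^ m"
  shows "\<bar>v t\<bar> \<le> C * \<bar>t\<bar> ^ Suc m / real (Suc m)"
proof -
  \<comment> \<open>Monotonicity of \<open>w\<close> minus the primitive of its bound replaces
    integration, since \<open>v'\<close> need not be integrable. The four applications are to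
    \<open>v\<close>, its negative and their reflections.\<close>
  have pos: "w t \<le> C * t ^ Suc m / real (Suc m)"
    if "t \<ge> 0" "w 0 = 0" and dw: "\<And>t. (w has_real_derivative w' t) (at t)"
      and bw: "\<And>t. t \<ge> 0 \<Longrightarrow> w' t \<le> C * t ^ m" for t and w w' :: "real \<Rightarrow> real"
  proof -
    have "w t - C * t ^ Suc m / real (Suc m) \<le> w 0 - C * 0 ^ Suc m / real (Suc m)"
    proof (rule DERIV_nonpos_imp_nonincreasing[OF \<open>t \<ge> 0\<close>])
      fix x :: real assume x: "0 \<le> x" "x \<le> t"
      have "((\<lambda>t. w t - C * t ^ Suc m / real (Suc m)) has_real_derivative w' x - C * x ^ m) (at x)"
        by (rule derivative_eq_intros dw refl | simp)+
      then show "\<exists>y. ((\<lambda>t. w t - C * t ^ Suc m / real (Suc m)) has_real_derivative y) (at x) \<and> y \<le> 0"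
        using bw[OF x(1)] by (intro exI[of _ "w' x - C * x ^ m"]) auto
    qed
    then show ?thesis using that by simp
  qed
  have d1: "((\<lambda>t. - v t) has_real_derivative - v' t) (at t)" for t
    by (rule derivative_intros d)+
  have d2: "((\<lambda>t. v (- t)) has_real_derivative - v' (- t)) (at t)" for t
    using DERIV_mirror[of v "v' (-t)" t] d[of "-t"] by simp
  have d3: "((\<lambda>t. - v (- t)) has_real_derivative v' (- t)) (at t)" for t
    using DERIV_minus[OF d2[of t]] by simp
  have b': "- v' t \<le> C * \<bar>t\<bar> ^ m" "v' t \<le> C * \<bar>t\<bar> ^ m" for t
    using b[of t] by auto
  show ?thesis
  proof (cases "t \<ge> 0")
    case True
    have "v t \<le> C * t ^ Suc m / real (Suc m)"
      by (rule pos[OF True \<open>v 0 = 0\<close> d]) (use b' in \<open>metis abs_of_nonneg\<close>)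
    moreover have "- v t \<le> C * t ^ Suc m / real (Suc m)"
      by (rule pos[OF True _ d1]) (use b' \<open>v 0 = 0\<close> in \<open>simp_all, metis abs_of_nonneg\<close>)
    ultimately show ?thesis using True by simp
  next
    case False
    then have t: "- t \<ge> 0" by simp
    have "v (- (- t)) \<le> C * (- t) ^ Suc m / real (Suc m)"
      by (rule pos[OF t, where w="\<lambda>t. v (- t)" and w'="\<lambda>t. - v' (- t)", OF _ d2])
        (use b' \<open>v 0 = 0\<close> in \<open>simp_all, metis abs_minus_cancel abs_of_nonneg\<close>)
    moreover have "- v (- (- t)) \<le> C * (- t) ^ Suc m / real (Suc m)"
      by (rule pos[OF t, where w="\<lambda>t. - v (- t)" and w'="\<lambda>t. v' (- t)", OF _ d3])
        (use b' \<open>v 0 = 0\<close> in \<open>simp_all, metis abs_minus_cancel abs_of_nonneg\<close>)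
    ultimately show ?thesis using False by simp
  qed
qed

lemma taylor1_bound:
  fixes u u' :: "real \<Rightarrow> real"
  assumes d: "\<And>t. (u has_real_derivative u' t) (at t)"
    and b: "\<And>t. \<bar>u' t - u' 0\<bar> \<le> C * \<bar>t\<bar>"
  shows "\<bar>u t - u 0 - t * u' 0\<bar> \<le> C * t\<^sup>2 / 2"
proof -
  have "\<bar>u t - u 0 - t * u' 0\<bar> \<le> C * \<bar>t\<bar> ^ Suc 1 / real (Suc 1)"
  proof (rule abs_le_power_Suc[where v="\<lambda>t. u t - u 0 - t * u' 0"])
    show "((\<lambda>t. u t - u 0 - t * u' 0) has_real_derivative u' t - u' 0) (at t)" for t
      by (rule derivative_eq_intros d refl | simp)+
  qed (use b in auto)
  then show ?thesis by (simp add: power2_eq_square)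
qed

text \<open>Lipschitz behaviour of \<open>u''\<close> at 0 stands in for a third derivative; each
  order integrates the previous estimate once.\<close>

lemma taylor2_bound:
  fixes u u' u'' :: "real \<Rightarrow> real"
  assumes d: "\<And>t. (u has_real_derivative u' t) (at t)"
    and d2: "\<And>t. (u' has_real_derivative u'' t) (at t)"
    and b: "\<And>t. \<bar>u'' t - u'' 0\<bar> \<le> C * \<bar>t\<bar>"
  shows "\<bar>u t - u 0 - t * u' 0 - t\<^sup>2 / 2 * u'' 0\<bar> \<le> C * \<bar>t\<bar> ^ 3 / 6"
proof -
  have "\<bar>u t - u 0 - t * u' 0 - t\<^sup>2 / 2 * u'' 0\<bar> \<le> (C / 2) * \<bar>t\<bar> ^ Suc 2 / real (Suc 2)"
  proof (rule abs_le_power_Suc[where v="\<lambda>t. u t - u 0 - t * u' 0 - t\<^sup>2 / 2 * u'' 0"])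
    show "((\<lambda>t. u t - u 0 - t * u' 0 - t\<^sup>2 / 2 * u'' 0)
        has_real_derivative u' t - u' 0 - t * u'' 0) (at t)" for t
      by (rule derivative_eq_intros d refl | simp)+
  qed (use taylor1_bound[OF d2 b] in auto)
  then show ?thesis by (simp add: numeral_3_eq_3)
qed

text \<open>In the difference of the values at \<open>t\<close> and \<open>-t\<close> the even
  Taylor terms cancel, so \<open>u' 0\<close> is recovered with an error that does not involve
  \<open>u'' 0\<close>.\<close>

lemma central_difference_bound:
  fixes u u' u'' :: "real \<Rightarrow> real"
  assumes d: "\<And>t. (u has_real_derivative u' t) (at t)"
    and d2: "\<And>t. (u' has_real_derivative u'' t) (at t)"
    and b: "\<And>t. \<bar>u'' t - u'' 0\<bar> \<le> C * \<bar>t\<bar>"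
  shows "\<bar>u t - u (- t) - 2 * t * u' 0\<bar> \<le> C * \<bar>t\<bar> ^ 3 / 3"
proof -
  have "\<bar>p - q - 2 * r\<bar> \<le> e / 3"
    if "\<bar>p - w - r - s\<bar> \<le> e / 6" "\<bar>q - w - (- r) - s\<bar> \<le> e / 6" for p q r s e w :: real
    using that by linarith
  from this[of "u t" "u 0" "t * u' 0" "t\<^sup>2 / 2 * u'' 0" "C * \<bar>t\<bar> ^ 3" "u (- t)"]
  show ?thesis
    using taylor2_bound[OF d d2 b, of t] taylor2_bound[OF d d2 b, of "-t"] by (simp add: mult.assoc)
qed

text \<open>The values at -1, 0 and 1 determine the quadratic Taylor polynomial up to an error
  governed by \<open>C\<close>, so no bound on \<open>u'\<close> or \<open>u''\<close> has to be
  assumed.\<close>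

lemma cubic_growth:
  fixes u u' u'' :: "real \<Rightarrow> real"
  assumes d: "\<And>t. (u has_real_derivative u' t) (at t)"
    and d2: "\<And>t. (u' has_real_derivative u'' t) (at t)"
    and b: "\<And>t. \<bar>u'' t - u'' 0\<bar> \<le> C * \<bar>t\<bar>"
    and B: "\<bar>u 0\<bar> \<le> B" "\<bar>u 1\<bar> \<le> B" "\<bar>u (-1)\<bar> \<le> B"
  shows "\<bar>u t\<bar> \<le> (4 * B + 4 * C) * (1 + \<bar>t\<bar>) ^ 3"
proof -
  let ?s = "\<bar>t\<bar>"
  note T = taylor2_bound[OF d d2 b]
  have C: "0 \<le> C" using b[of 1] by simp
  have B0: "0 \<le> B" using B by linarith
  have u': "\<bar>u' 0\<bar> \<le> B + C" and u'': "\<bar>u'' 0\<bar> \<le> 4 * B + 2 * C"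
  proof -
    have "\<bar>u 1 - u 0 - u' 0 - u'' 0 / 2\<bar> \<le> C / 6" "\<bar>u (-1) - u 0 + u' 0 - u'' 0 / 2\<bar> \<le> C / 6"
      using T[of 1] T[of "-1"] by simp_all
    then show "\<bar>u' 0\<bar> \<le> B + C" "\<bar>u'' 0\<bar> \<le> 4 * B + 2 * C" using B C by linarith+
  qed
  have "\<bar>u t\<bar> \<le> \<bar>u 0\<bar> + \<bar>t * u' 0\<bar> + \<bar>t\<^sup>2 / 2 * u'' 0\<bar> + C * ?s ^ 3 / 6"
    using T[of t] by linarith
  also have "\<bar>t * u' 0\<bar> \<le> ?s * (B + C)"
    by (simp add: abs_mult mult_left_mono u')
  also have "\<bar>t\<^sup>2 / 2 * u'' 0\<bar> \<le> ?s ^ 2 / 2 * (4 * B + 2 * C)"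
    by (simp add: abs_mult mult_left_mono u'')
  also have "\<bar>u 0\<bar> + ?s * (B + C) + ?s ^ 2 / 2 * (4 * B + 2 * C) + C * ?s ^ 3 / 6
      \<le> B + ?s * (B + C) + ?s ^ 2 / 2 * (4 * B + 2 * C) + C * ?s ^ 3 / 6"
    using B by simp
  also have "\<dots> \<le> (4 * B + 4 * C) * (1 + ?s) ^ 3"
  proof -
    have "0 \<le> B * ?s" "0 \<le> C * ?s" "0 \<le> B * ?s ^ 2" "0 \<le> C * ?s ^ 2" "0 \<le> B * ?s ^ 3" "0 \<le> C * ?s ^ 3"
      using C B0 by simp_all
    then show ?thesis using C B0
      by (simp add: power3_eq_cube power2_eq_square algebra_simps)
  qed
  finally show ?thesis by simp
qed

section \<open>Changing the coordinates one at a time\<close>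

lemma stepwise_bound:
  fixes F :: "real ^ 'n \<Rightarrow> real"
  assumes step: "\<And>k S. k \<in> J \<Longrightarrow> S \<subseteq> J \<Longrightarrow> k \<notin> S \<Longrightarrow>
    \<bar>F (b + msk S y + y $ k *\<^sub>R axis k 1) - F (b + msk S y)\<bar> \<le> c k * \<bar>y $ k\<bar>"
  shows "\<bar>F (b + msk J y) - F b\<bar> \<le> (\<Sum>k\<in>J. c k * \<bar>y $ k\<bar>)"
proof -
  have "finite J" by simp
  then show ?thesis using step
  proof (induction J)
    case (insert j J)
    have "\<bar>F (b + msk J y + y $ j *\<^sub>R axis j 1) - F (b + msk J y)\<bar> \<le> c j * \<bar>y $ j\<bar>"
      using insert.prems[of j J] insert.hyps by auto
    moreover have "\<bar>F (b + msk J y) - F b\<bar> \<le> (\<Sum>k\<in>J. c k * \<bar>y $ k\<bar>)"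
      using insert.IH insert.prems by auto
    ultimately show ?case using insert.hyps by (simp add: msk_insert add.assoc)
  qed simp
qed

text \<open>Coordinates with \<open>y $ k = 0\<close> are never moved, so no Lipschitz constant is
  asked for there. This is how directions without a bound drop out.\<close>

lemma stepwise_lipschitz:
  fixes F :: "real ^ 'n \<Rightarrow> real"
  assumes lip: "\<And>k x t. k \<in> J \<Longrightarrow> y $ k \<noteq> 0 \<Longrightarrow> \<bar>F (x + t *\<^sub>R axis k 1) - F x\<bar> \<le> c k * \<bar>t\<bar>"
  shows "\<bar>F (b + msk J y) - F b\<bar> \<le> (\<Sum>k\<in>J. c k * \<bar>y $ k\<bar>)"
proof (rule stepwise_bound)
  fix k S assume "k \<in> J"
  then show "\<bar>F (b + msk S y + y $ k *\<^sub>R axis k 1) - F (b + msk S y)\<bar> \<le> c k * \<bar>y $ k\<bar>"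
    using lip[of k] by (cases "y $ k = 0") auto
qed

text \<open>Adding \<open>j\<close> to \<open>J\<close> costs half of \<open>c j j * |y_j|^2\<close>
  for the step itself and the whole of \<open>c j k * |y_j y_k|\<close> for moving the base point of
  \<open>F' j\<close>. By symmetry of \<open>c\<close> this is exactly half of the diagonal term and
  the two mirrored off-diagonal terms by which the double sum grows.\<close>

lemma stepwise_taylor:
  fixes F :: "real ^ 'n \<Rightarrow> real" and F' :: "'n \<Rightarrow> real ^ 'n \<Rightarrow> real"
  assumes d: "\<And>j x t. j \<in> J \<Longrightarrow>
      ((\<lambda>t. F (x + t *\<^sub>R axis j 1)) has_real_derivative F' j (x + t *\<^sub>R axis j 1)) (at t)"
    and lip: "\<And>j k x t. j \<in> J \<Longrightarrow> k \<in> J \<Longrightarrow> y $ j * y $ k \<noteq> 0 \<Longrightarrow>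
      \<bar>F' j (x + t *\<^sub>R axis k 1) - F' j x\<bar> \<le> c j k * \<bar>t\<bar>"
    and sym: "\<And>j k. c j k = c k j"
  shows "\<bar>F (b + msk J y) - F b - (\<Sum>j\<in>J. y $ j * F' j b)\<bar>
       \<le> (\<Sum>j\<in>J. \<Sum>k\<in>J. c j k * \<bar>y $ j * y $ k\<bar>) / 2"
proof -
  have "finite J" by simp
  then show ?thesis using d lip
  proof (induction J)
    case (insert j J)
    let ?b = "b + msk J y" and ?e = "axis j 1 :: real ^ 'n"
    have 1: "\<bar>F (?b + y $ j *\<^sub>R ?e) - F ?b - y $ j * F' j ?b\<bar> \<le> c j j * \<bar>y $ j * y $ j\<bar> / 2"
    proof (cases "y $ j = 0")
      case False
      have "\<bar>F (?b + y $ j *\<^sub>R ?e) - F (?b + 0 *\<^sub>R ?e) - y $ j * F' j (?b + 0 *\<^sub>R ?e)\<bar> \<le> c j j * (y $ j)\<^sup>2 / 2"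
        by (rule taylor1_bound[where u="\<lambda>t. F (?b + t *\<^sub>R ?e)"])
          (use insert.prems(1)[of j] insert.prems(2)[of j j] False in auto)
      then show ?thesis by (simp add: power2_eq_square)
    qed simp
    have 2: "\<bar>y $ j\<bar> * \<bar>F' j ?b - F' j b\<bar> \<le> (\<Sum>k\<in>J. c j k * \<bar>y $ j * y $ k\<bar>)"
    proof (cases "y $ j = 0")
      case False
      have "\<bar>F' j ?b - F' j b\<bar> \<le> (\<Sum>k\<in>J. c j k * \<bar>y $ k\<bar>)"
        by (rule stepwise_lipschitz) (use insert.prems(2) False in auto)
      from mult_left_mono[OF this abs_ge_zero[of "y $ j"]] show ?thesis
        by (simp add: sum_distrib_left abs_mult mult_ac)
    qed simp
    have 3: "\<bar>F ?b - F b - (\<Sum>j\<in>J. y $ j * F' j b)\<bar> \<le> (\<Sum>j\<in>J. \<Sum>k\<in>J. c j k * \<bar>y $ j * y $ k\<bar>) / 2"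
      using insert by simp
    have eq: "F (b + msk (insert j J) y) - F b - (\<Sum>j\<in>insert j J. y $ j * F' j b)
        = (F (?b + y $ j *\<^sub>R ?e) - F ?b - y $ j * F' j ?b) + y $ j * (F' j ?b - F' j b)
          + (F ?b - F b - (\<Sum>j\<in>J. y $ j * F' j b))"
      using insert.hyps by (simp add: msk_insert add.assoc algebra_simps)
    have 4: "(\<Sum>i\<in>insert j J. \<Sum>k\<in>insert j J. c i k * \<bar>y $ i * y $ k\<bar>)
        = c j j * \<bar>y $ j * y $ j\<bar> + 2 * (\<Sum>k\<in>J. c j k * \<bar>y $ j * y $ k\<bar>)
          + (\<Sum>j\<in>J. \<Sum>k\<in>J. c j k * \<bar>y $ j * y $ k\<bar>)"
    proof -
      have "(\<Sum>i\<in>J. c i j * \<bar>y $ i * y $ j\<bar>) = (\<Sum>k\<in>J. c j k * \<bar>y $ j * y $ k\<bar>)"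
        by (rule sum.cong[OF refl], subst sym, subst mult.commute[of "y $ j"], rule refl)
      then show ?thesis using insert.hyps by (simp add: sum.distrib)
    qed
    have 2: "\<bar>y $ j * (F' j ?b - F' j b)\<bar> \<le> (\<Sum>k\<in>J. c j k * \<bar>y $ j * y $ k\<bar>)"
      using 2 by (simp add: abs_mult)
    have "\<bar>x + y + z\<bar> \<le> (p + 2 * q + r) / 2"
      if "\<bar>x\<bar> \<le> p / 2" "\<bar>y\<bar> \<le> q" "\<bar>z\<bar> \<le> r / 2" for x y z p q r :: real
      using that abs_triangle_ineq[of "x + y" z] abs_triangle_ineq[of x y] by argo
    from this[OF 1 2 3] show ?case unfolding eq 4 .
  qed simp
qed

text \<open>A chain rule from continuous partial derivatives in the moving directions alone.
  Freezing one coordinate at its value at \<open>t0\<close> leaves a curve with fewer moving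
  coordinates; the difference is a mean value term.\<close>

lemma has_derivative_along_curve:
  fixes F :: "real ^ 'n \<Rightarrow> real" and F' :: "'n \<Rightarrow> real ^ 'n \<Rightarrow> real" and \<gamma> :: "real \<Rightarrow> real ^ 'n"
  assumes d: "\<And>j x t. j \<in> J \<Longrightarrow>
      ((\<lambda>t. F (x + t *\<^sub>R axis j 1)) has_real_derivative F' j (x + t *\<^sub>R axis j 1)) (at t)"
    and c: "\<And>j. j \<in> J \<Longrightarrow> continuous_on UNIV (F' j)"
    and \<gamma>: "\<And>j. j \<in> J \<Longrightarrow> ((\<lambda>t. \<gamma> t $ j) has_real_derivative \<gamma>' j) (at t0)"
    and const: "\<And>j t. j \<notin> J \<Longrightarrow> \<gamma> t $ j = \<gamma> t0 $ j"
  shows "((\<lambda>t. F (\<gamma> t)) has_real_derivative (\<Sum>j\<in>J. \<gamma>' j * F' j (\<gamma> t0))) (at t0)"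
proof -
  have "finite J" by simp
  then show ?thesis using d c \<gamma> const
  proof (induction J arbitrary: \<gamma>)
    case empty
    have "\<gamma> t = \<gamma> t0" for t by (intro vec_eq_iff[THEN iffD2] allI empty(4)) blast
    then have "(\<lambda>t. F (\<gamma> t)) = (\<lambda>t. F (\<gamma> t0))" by (intro ext arg_cong[where f=F])
    then show ?case by (simp only: sum.empty DERIV_const)
  next
    case (insert j J)
    let ?e = "axis j 1 :: real ^ 'n"
    define \<beta> where "\<beta> t = \<gamma> t + (\<gamma> t0 $ j - \<gamma> t $ j) *\<^sub>R ?e" for t
    have \<beta>0: "\<beta> t0 = \<gamma> t0" by (simp add: \<beta>_def)
    have \<beta>j: "\<beta> t $ k = (if k = j then \<gamma> t0 $ j else \<gamma> t $ k)" for t k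
      by (auto simp: \<beta>_def axis_def)
    have \<beta>d: "((\<lambda>t. F (\<beta> t)) has_real_derivative (\<Sum>j\<in>J. \<gamma>' j * F' j (\<beta> t0))) (at t0)"
    proof (rule insert.IH)
      show "((\<lambda>t. \<beta> t $ k) has_real_derivative \<gamma>' k) (at t0)" if "k \<in> J" for k
        using insert.prems(3)[of k] insert.hyps that unfolding \<beta>j by (cases "k = j") auto
      show "\<beta> t $ k = \<beta> t0 $ k" if "k \<notin> J" for k t
        using insert.prems(4)[of k t] that unfolding \<beta>j by (cases "k = j") simp_all
    qed (use insert.prems(1,2) in auto)
    have \<gamma>d: "((\<lambda>t. \<gamma> t $ j) has_real_derivative \<gamma>' j) (at t0)"
      using insert.prems(3) by simp
    have cont_nth: "((\<lambda>t. \<gamma> t $ k) \<longlongrightarrow> \<gamma> t0 $ k) (at t0)" for k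
    proof (cases "k \<in> insert j J")
      case True
      then have "isCont (\<lambda>t. \<gamma> t $ k) t0" using insert.prems(3) DERIV_isCont by blast
      then show ?thesis by (simp add: isCont_def)
    next
      case False
      then have "(\<lambda>t. \<gamma> t $ k) = (\<lambda>t. \<gamma> t0 $ k)" by (intro ext insert.prems(4))
      then show ?thesis by (simp only: tendsto_const)
    qed
    have \<gamma>c: "(\<gamma> \<longlongrightarrow> \<gamma> t0) (at t0)"
      by (rule vec_tendstoI) (rule cont_nth)
    \<comment> \<open>Mean value theorem on the axis segment between \<open>\<gamma> t\<close> and
      \<open>\<beta> t\<close>. The intermediate points tend to \<open>\<gamma> t0\<close>, where
      continuity of \<open>F' j\<close> gives the limit of the difference quotient.\<close>
    have "\<exists>\<xi>. \<bar>\<xi>\<bar> \<le> \<bar>\<gamma> t $ j - \<gamma> t0 $ j\<bar> \<and>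
        F (\<gamma> t) - F (\<beta> t) = (\<gamma> t $ j - \<gamma> t0 $ j) * F' j (\<gamma> t + \<xi> *\<^sub>R ?e)" for t
    proof (cases "\<gamma> t $ j = \<gamma> t0 $ j")
      case True
      then show ?thesis unfolding \<beta>_def by (intro exI[of _ 0]) simp
    next
      case False
      define r where "r = \<gamma> t0 $ j - \<gamma> t $ j"
      have dF: "((\<lambda>t'. F (\<gamma> t + t' *\<^sub>R ?e)) has_real_derivative F' j (\<gamma> t + t' *\<^sub>R ?e)) (at t')" for t'
        using insert.prems(1) by simp
      have "\<exists>\<xi>. \<bar>\<xi>\<bar> \<le> \<bar>r\<bar> \<and> F (\<gamma> t + r *\<^sub>R ?e) - F (\<gamma> t) = r * F' j (\<gamma> t + \<xi> *\<^sub>R ?e)"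
      proof (cases "r > 0")
        case True
        from MVT2[OF this dF] obtain z where "0 < z" "z < r"
          "F (\<gamma> t + r *\<^sub>R ?e) - F (\<gamma> t + 0 *\<^sub>R ?e) = (r - 0) * F' j (\<gamma> t + z *\<^sub>R ?e)" by blast
        then show ?thesis by (intro exI[of _ z]) auto
      next
        case False
        then have "r < 0" using \<open>\<gamma> t $ j \<noteq> \<gamma> t0 $ j\<close> by (simp add: r_def)
        from MVT2[OF this dF] obtain z where "r < z" "z < 0"
          "F (\<gamma> t + 0 *\<^sub>R ?e) - F (\<gamma> t + r *\<^sub>R ?e) = (0 - r) * F' j (\<gamma> t + z *\<^sub>R ?e)" by blast
        then show ?thesis by (intro exI[of _ z]) auto
      qed
      then obtain \<xi> where "\<bar>\<xi>\<bar> \<le> \<bar>r\<bar>" "F (\<gamma> t + r *\<^sub>R ?e) - F (\<gamma> t) = r * F' j (\<gamma> t + \<xi> *\<^sub>R ?e)"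
        by blast
      then have "\<bar>\<xi>\<bar> \<le> \<bar>\<gamma> t $ j - \<gamma> t0 $ j\<bar> \<and>
          F (\<gamma> t) - F (\<beta> t) = (\<gamma> t $ j - \<gamma> t0 $ j) * F' j (\<gamma> t + \<xi> *\<^sub>R ?e)"
        unfolding \<beta>_def r_def by (simp add: algebra_simps)
      then show ?thesis ..
    qed
    then have "\<forall>t. \<exists>\<xi>. \<bar>\<xi>\<bar> \<le> \<bar>\<gamma> t $ j - \<gamma> t0 $ j\<bar> \<and>
        F (\<gamma> t) - F (\<beta> t) = (\<gamma> t $ j - \<gamma> t0 $ j) * F' j (\<gamma> t + \<xi> *\<^sub>R ?e)" ..
    from choice[OF this] obtain \<xi> where \<xi>: "\<And>t. \<bar>\<xi> t\<bar> \<le> \<bar>\<gamma> t $ j - \<gamma> t0 $ j\<bar>"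
      and F\<xi>: "\<And>t. F (\<gamma> t) - F (\<beta> t) = (\<gamma> t $ j - \<gamma> t0 $ j) * F' j (\<gamma> t + \<xi> t *\<^sub>R ?e)"
      by blast
    have "((\<lambda>t. \<gamma> t $ j - \<gamma> t0 $ j) \<longlongrightarrow> 0) (at t0)"
      using cont_nth[of j] by (simp add: LIM_zero)
    then have "(\<xi> \<longlongrightarrow> 0) (at t0)"
      by (rule metric_tendsto_imp_tendsto) (simp add: \<xi>)
    then have "((\<lambda>t. \<gamma> t + \<xi> t *\<^sub>R ?e) \<longlongrightarrow> \<gamma> t0 + 0 *\<^sub>R ?e) (at t0)"
      by (intro tendsto_intros \<gamma>c)
    then have lim: "((\<lambda>t. F' j (\<gamma> t + \<xi> t *\<^sub>R ?e)) \<longlongrightarrow> F' j (\<gamma> t0)) (at t0)"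
      using insert.prems(2)[of j] by (simp add: continuous_on_tendsto_compose[of UNIV "F' j"])
    have "((\<lambda>t. (\<gamma> t $ j - \<gamma> t0 $ j) / (t - t0)) \<longlongrightarrow> \<gamma>' j) (at t0)"
      using \<gamma>d by (simp add: has_field_derivative_iff)
    from tendsto_mult[OF this lim]
    have "((\<lambda>t. F (\<gamma> t) - F (\<beta> t)) has_real_derivative \<gamma>' j * F' j (\<gamma> t0)) (at t0)"
      unfolding has_field_derivative_iff by (simp add: F\<xi> \<beta>0)
    from DERIV_add[OF this \<beta>d]
    have "((\<lambda>t. F (\<gamma> t)) has_real_derivative \<gamma>' j * F' j (\<gamma> t0) + (\<Sum>j\<in>J. \<gamma>' j * F' j (\<gamma> t0))) (at t0)"
      by (simp add: \<beta>0)
    then show ?case using insert.hyps by simp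
  qed
qed

section \<open>Functions with Lipschitz second derivatives along the axes\<close>

lemma continuous_on_uniform_approx:
  fixes l :: "'a::metric_space \<Rightarrow> real" and f :: "real \<Rightarrow> 'a \<Rightarrow> real"
  assumes c: "\<And>t. continuous_on UNIV (f t)"
    and b: "\<And>t x. 0 < t \<Longrightarrow> t \<le> 1 \<Longrightarrow> \<bar>f t x - l x\<bar> \<le> C * t"
  shows "continuous_on UNIV l"
proof (rule uniform_limit_theorem)
  show "\<forall>\<^sub>F n in sequentially. continuous_on UNIV (f (1 / real (Suc n)))"
    by (simp add: c)
  show "uniform_limit UNIV (\<lambda>n. f (1 / real (Suc n))) l sequentially"
  proof (rule uniform_limitI)
    fix e :: real assume "e > 0"
    have "(\<lambda>n. C * (1 / real (Suc n))) \<longlonglongrightarrow> C * 0"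
      by (intro tendsto_intros LIMSEQ_Suc lim_1_over_n)
    then have "\<forall>\<^sub>F n in sequentially. C * (1 / real (Suc n)) < e"
      using \<open>e > 0\<close> by (intro order_tendstoD(2)) auto
    then show "\<forall>\<^sub>F n in sequentially. \<forall>x\<in>UNIV. dist (f (1 / real (Suc n)) x) (l x) < e"
    proof eventually_elim
      case (elim n)
      have "\<bar>f (1 / real (Suc n)) x - l x\<bar> \<le> C * (1 / real (Suc n))" for x
        by (rule b) auto
      then show ?case using elim by (auto simp: dist_real_def intro: le_less_trans)
    qed
  qed
qed simp

text \<open>Cubic growth along each axis multiplies up when the coordinates are released one after
  the other. In this product form a unit shift along an axis costs only the factor 2^3, and every
  Gaussian vector integrates it.\<close>

definition Q :: "real ^ 'n \<Rightarrow> real" where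
  "Q x = (\<Prod>l\<in>UNIV. (1 + \<bar>x $ l\<bar>) ^ 3)"

lemma Q_ge_1: "1 \<le> Q x"
  unfolding Q_def by (intro prod_ge_1) (simp add: one_le_power)

lemma Q_nonneg: "0 \<le> Q x"
  using Q_ge_1[of x] by linarith

lemma Q_mono: "(\<And>l. \<bar>x $ l\<bar> \<le> \<bar>y $ l\<bar>) \<Longrightarrow> Q x \<le> Q y"
  unfolding Q_def by (intro prod_mono) (auto intro!: power_mono)

lemma Q_shift:
  assumes "\<bar>t\<bar> \<le> 1"
  shows "Q (x + t *\<^sub>R axis i 1) \<le> 8 * Q x"
proof -
  have split: "Q y = (1 + \<bar>y $ i\<bar>) ^ 3 * (\<Prod>l\<in>UNIV - {i}. (1 + \<bar>y $ l\<bar>) ^ 3)" for y :: "real ^ 'a"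
    unfolding Q_def by (rule prod.remove) auto
  have eq: "(\<Prod>l\<in>UNIV - {i}. (1 + \<bar>(x + t *\<^sub>R axis i 1) $ l\<bar>) ^ 3)
      = (\<Prod>l\<in>UNIV - {i}. (1 + \<bar>x $ l\<bar>) ^ 3)"
    by (intro prod.cong) (auto simp: axis_def)
  have "(1 + \<bar>(x + t *\<^sub>R axis i 1) $ i\<bar>) ^ 3 \<le> (2 * (1 + \<bar>x $ i\<bar>)) ^ 3"
    using assms by (intro power_mono) (auto simp: axis_def)
  then have "(1 + \<bar>(x + t *\<^sub>R axis i 1) $ i\<bar>) ^ 3 \<le> 8 * (1 + \<bar>x $ i\<bar>) ^ 3"
    by (simp only: power_mult_distrib) simp
  then show ?thesis
    unfolding split[of x] split[of "x + t *\<^sub>R axis i 1"] eq mult.assoc[symmetric]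
    by (intro mult_right_mono prod_nonneg) auto
qed

text \<open>\<open>ok i j k\<close> marks the third derivatives that have a bound, and
  \<open>c\<close> holds the bounds. They enter only as Lipschitz constants of \<open>g2 i j\<close>
  along the axis \<open>k\<close>, which is the form that coordinatewise expansion uses.\<close>

locale cubic_fun =
  fixes g :: "real ^ 'n \<Rightarrow> real" and g1 :: "'n \<Rightarrow> real ^ 'n \<Rightarrow> real"
    and g2 :: "'n \<Rightarrow> 'n \<Rightarrow> real ^ 'n \<Rightarrow> real"
    and c :: "'n \<Rightarrow> 'n \<Rightarrow> 'n \<Rightarrow> real" and ok :: "'n \<Rightarrow> 'n \<Rightarrow> 'n \<Rightarrow> bool"
  assumes d1: "\<And>i x t. ((\<lambda>t. g (x + t *\<^sub>R axis i 1)) has_real_derivative g1 i (x + t *\<^sub>R axis i 1)) (at t)"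
    and d2: "\<And>i j x t. ((\<lambda>t. g1 i (x + t *\<^sub>R axis j 1)) has_real_derivative g2 i j (x + t *\<^sub>R axis j 1)) (at t)"
    and lip: "\<And>i j k x t. ok i j k \<Longrightarrow> \<bar>g2 i j (x + t *\<^sub>R axis k 1) - g2 i j x\<bar> \<le> c i j k * \<bar>t\<bar>"
    and c_nonneg: "\<And>i j k. 0 \<le> c i j k"
    and c_sym: "\<And>i j k. c i j k = c i k j"
    and ok_diag: "\<And>i. ok i i i"
begin

lemma cubic_growth_coord:
  assumes "\<bar>g x\<bar> \<le> B" "\<bar>g (x + axis i 1)\<bar> \<le> B" "\<bar>g (x - axis i 1)\<bar> \<le> B"
  shows "\<bar>g (x + t *\<^sub>R axis i 1)\<bar> \<le> (4 * B + 4 * c i i i) * (1 + \<bar>t\<bar>) ^ 3"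
  by (rule cubic_growth[where u="\<lambda>t. g (x + t *\<^sub>R axis i 1)", OF d1 d2])
    (use assms lip[OF ok_diag, of i x] in auto)

lemma central_difference_g1:
  "\<bar>g (x + t *\<^sub>R axis i 1) - g (x - t *\<^sub>R axis i 1) - 2 * t * g1 i x\<bar> \<le> c i i i * \<bar>t\<bar> ^ 3 / 3"
proof -
  have "\<bar>g (x + t *\<^sub>R axis i 1) - g (x + (- t) *\<^sub>R axis i 1) - 2 * t * g1 i (x + 0 *\<^sub>R axis i 1)\<bar>
      \<le> c i i i * \<bar>t\<bar> ^ 3 / 3"
    by (rule central_difference_bound[where u="\<lambda>t. g (x + t *\<^sub>R axis i 1)", OF d1 d2])
      (use lip[OF ok_diag, of i x] in simp)
  then show ?thesis by simp
qed

definition mixed_difference :: "real \<Rightarrow> 'n \<Rightarrow> 'n \<Rightarrow> real ^ 'n \<Rightarrow> real" where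
  "mixed_difference t i j x = g (x + t *\<^sub>R axis i 1 + t *\<^sub>R axis j 1) - g (x + t *\<^sub>R axis i 1)
     - g (x + t *\<^sub>R axis j 1) + g x"

text \<open>Two applications of the mean value theorem turn the mixed difference into
  \<open>t\<close> squared times \<open>g2 i j\<close> at a nearby point. Moving back to
  \<open>x\<close> goes along the axes \<open>i\<close> and \<open>j\<close> only, hence the two
  \<open>ok\<close> conditions.\<close>

lemma mixed_difference_g2:
  assumes ok: "ok i j i" "ok i j j" and "0 < t"
  shows "\<bar>mixed_difference t i j x - t\<^sup>2 * g2 i j x\<bar> \<le> (c i j i + c i j j) * t ^ 3"
proof -
  let ?i = "axis i 1 :: real ^ 'n" and ?j = "axis j 1 :: real ^ 'n"
  have "((\<lambda>s. g ((x + t *\<^sub>R ?j) + s *\<^sub>R ?i) - g (x + s *\<^sub>R ?i)) has_real_derivative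
      g1 i ((x + t *\<^sub>R ?j) + s *\<^sub>R ?i) - g1 i (x + s *\<^sub>R ?i)) (at s)" for s
    by (intro derivative_intros d1)
  from MVT2[OF \<open>0 < t\<close> this] obtain s where s: "0 < s" "s < t" and
    e1: "(g ((x + t *\<^sub>R ?j) + t *\<^sub>R ?i) - g (x + t *\<^sub>R ?i)) - (g ((x + t *\<^sub>R ?j) + 0 *\<^sub>R ?i) - g (x + 0 *\<^sub>R ?i))
      = (t - 0) * (g1 i ((x + t *\<^sub>R ?j) + s *\<^sub>R ?i) - g1 i (x + s *\<^sub>R ?i))" by blast
  from MVT2[OF \<open>0 < t\<close> d2[of i "x + s *\<^sub>R ?i" j]] obtain r where r: "0 < r" "r < t" and
    e2: "g1 i (x + s *\<^sub>R ?i + t *\<^sub>R ?j) - g1 i (x + s *\<^sub>R ?i + 0 *\<^sub>R ?j)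
      = (t - 0) * g2 i j (x + s *\<^sub>R ?i + r *\<^sub>R ?j)" by blast
  have "mixed_difference t i j x = t * (g1 i (x + s *\<^sub>R ?i + t *\<^sub>R ?j) - g1 i (x + s *\<^sub>R ?i))"
    using e1 unfolding mixed_difference_def by (simp add: ac_simps)
  then have dd: "mixed_difference t i j x = t\<^sup>2 * g2 i j (x + s *\<^sub>R ?i + r *\<^sub>R ?j)"
    using e2 by (simp add: power2_eq_square)
  have "\<bar>g2 i j (x + s *\<^sub>R ?i + r *\<^sub>R ?j) - g2 i j (x + s *\<^sub>R ?i)\<bar> \<le> c i j j * t"
    using lip[OF ok(2), of "x + s *\<^sub>R ?i" r] r mult_left_mono[OF _ c_nonneg, of "\<bar>r\<bar>" t i j j] by simp
  moreover have "\<bar>g2 i j (x + s *\<^sub>R ?i) - g2 i j x\<bar> \<le> c i j i * t"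
    using lip[OF ok(1), of x s] s mult_left_mono[OF _ c_nonneg, of "\<bar>s\<bar>" t i j i] by simp
  ultimately have "\<bar>g2 i j (x + s *\<^sub>R ?i + r *\<^sub>R ?j) - g2 i j x\<bar> \<le> (c i j i + c i j j) * t"
    by (simp add: distrib_right)
  then have "t\<^sup>2 * \<bar>g2 i j (x + s *\<^sub>R ?i + r *\<^sub>R ?j) - g2 i j x\<bar> \<le> t\<^sup>2 * ((c i j i + c i j j) * t)"
    by (intro mult_left_mono) auto
  then show ?thesis
    unfolding dd by (simp add: right_diff_distrib[symmetric] abs_mult power3_eq_cube power2_eq_square mult_ac)
qed

text \<open>Induction on the set of unrestricted coordinates. The others are kept in {-1, 0, 1}, the
  nodes of the cubic estimate, so that the base case needs only finitely many values of
  \<open>g\<close>; at this stage \<open>g\<close> is not yet known to be locally bounded.\<close>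

lemma polynomial_growth: "\<exists>K\<ge>0. \<forall>x. \<bar>g x\<bar> \<le> K * Q x"
proof -
  have "\<exists>K\<ge>0. \<forall>x. (\<forall>l. l \<notin> J \<longrightarrow> x $ l \<in> {-1, 0, 1}) \<longrightarrow> \<bar>g x\<bar> \<le> K * (\<Prod>l\<in>J. (1 + \<bar>x $ l\<bar>) ^ 3)"
    if "finite J" for J
    using that
  proof (induction J)
    case empty
    have "{x :: real ^ 'n. \<forall>l. x $ l \<in> {-1, 0, 1}} \<subseteq> vec_lambda ` (PiE UNIV (\<lambda>_. {-1, 0, 1}))"
    proof
      fix x :: "real ^ 'n" assume "x \<in> {x. \<forall>l. x $ l \<in> {-1, 0, 1}}"
      then have "($) x \<in> PiE UNIV (\<lambda>_. {-1, 0, 1})" by auto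
      then show "x \<in> vec_lambda ` (PiE UNIV (\<lambda>_. {-1, 0, 1}))"
        by (rule image_eqI[rotated]) simp
    qed
    then have fin: "finite {x :: real ^ 'n. \<forall>l. x $ l \<in> {-1, 0, 1}}"
      by (rule finite_subset) (intro finite_imageI finite_PiE, auto)
    show ?case
    proof (intro exI[of _ "\<Sum>x | \<forall>l. x $ l \<in> {-1, 0, 1}. \<bar>g x\<bar>"] conjI allI impI)
      fix x :: "real ^ 'n" assume "\<forall>l. l \<notin> {} \<longrightarrow> x $ l \<in> {-1, 0, 1}"
      then have "\<bar>g x\<bar> \<le> (\<Sum>x | \<forall>l. x $ l \<in> {-1, 0, 1}. \<bar>g x\<bar>)"
        by (intro member_le_sum[where f="\<lambda>x. \<bar>g x\<bar>"] fin) auto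
      then show "\<bar>g x\<bar> \<le> (\<Sum>x | \<forall>l. x $ l \<in> {-1, 0, 1}. \<bar>g x\<bar>) * (\<Prod>l\<in>{}. (1 + \<bar>x $ l\<bar>) ^ 3)"
        by simp
    qed (auto intro: sum_nonneg)
  next
    case (insert j J)
    then obtain K where K: "K \<ge> 0"
      "\<And>x. (\<And>l. l \<notin> J \<Longrightarrow> x $ l \<in> {-1, 0, 1}) \<Longrightarrow> \<bar>g x\<bar> \<le> K * (\<Prod>l\<in>J. (1 + \<bar>x $ l\<bar>) ^ 3)"
      by blast
    show ?case
    proof (intro exI[of _ "4 * K + 4 * c j j j"] conjI allI impI)
      fix x :: "real ^ 'n" assume x: "\<forall>l. l \<notin> insert j J \<longrightarrow> x $ l \<in> {-1, 0, 1}"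
      let ?P = "\<Prod>l\<in>J. (1 + \<bar>x $ l\<bar>) ^ 3"
      define x0 where "x0 = x - x $ j *\<^sub>R axis j 1"
      have B: "\<bar>g (x0 + s *\<^sub>R axis j 1)\<bar> \<le> K * ?P" if "s \<in> {-1, 0, 1}" for s
      proof -
        have "\<bar>g (x0 + s *\<^sub>R axis j 1)\<bar> \<le> K * (\<Prod>l\<in>J. (1 + \<bar>(x0 + s *\<^sub>R axis j 1) $ l\<bar>) ^ 3)"
        proof (rule K(2))
          fix l assume "l \<notin> J"
          then show "(x0 + s *\<^sub>R axis j 1) $ l \<in> {-1, 0, 1}"
            using x that by (cases "l = j") (auto simp: x0_def axis_def)
        qed
        also have "(\<Prod>l\<in>J. (1 + \<bar>(x0 + s *\<^sub>R axis j 1) $ l\<bar>) ^ 3) = ?P"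
          using insert.hyps by (intro prod.cong) (auto simp: x0_def axis_def)
        finally show ?thesis .
      qed
      have "\<bar>g (x0 + x $ j *\<^sub>R axis j 1)\<bar> \<le> (4 * (K * ?P) + 4 * c j j j) * (1 + \<bar>x $ j\<bar>) ^ 3"
        by (rule cubic_growth_coord) (use B[of 0] B[of 1] B[of "-1"] in simp_all)
      also have "\<dots> \<le> ((4 * K + 4 * c j j j) * ?P) * (1 + \<bar>x $ j\<bar>) ^ 3"
      proof (rule mult_right_mono)
        have "1 \<le> ?P" by (intro prod_ge_1) (simp add: one_le_power)
        then have "c j j j * 1 \<le> c j j j * ?P" by (intro mult_left_mono c_nonneg)
        then show "4 * (K * ?P) + 4 * c j j j \<le> (4 * K + 4 * c j j j) * ?P"
          by (simp add: distrib_right)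
      qed simp
      finally show "\<bar>g x\<bar> \<le> (4 * K + 4 * c j j j) * (\<Prod>l\<in>insert j J. (1 + \<bar>x $ l\<bar>) ^ 3)"
        using insert.hyps by (simp add: x0_def mult_ac)
    qed (use K c_nonneg in simp)
  qed
  from this[of UNIV] show ?thesis by (simp add: Q_def)
qed

text \<open>Derivatives are controlled by finitely many values of \<open>g\<close>, here and in
  \<open>g2_le_g\<close>, so every growth or domination bound for \<open>g\<close> carries over to
  them.\<close>

lemma g1_le_g:
  "\<bar>g1 i x\<bar> \<le> \<bar>g (x + 1 *\<^sub>R axis i 1)\<bar> + \<bar>g (x + (-1) *\<^sub>R axis i 1)\<bar> + c i i i"
  using central_difference_g1[of x 1 i] c_nonneg[of i i i] by simp argo

lemma g2_le_g:
  assumes "ok i j i" "ok i j j"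
  shows "\<bar>g2 i j x\<bar> \<le> \<bar>g (x + 1 *\<^sub>R axis i 1 + 1 *\<^sub>R axis j 1)\<bar> + \<bar>g (x + 1 *\<^sub>R axis i 1)\<bar>
      + \<bar>g (x + 1 *\<^sub>R axis j 1)\<bar> + \<bar>g x\<bar> + (c i j i + c i j j)"
  using mixed_difference_g2[OF assms, of 1 x] by (simp add: mixed_difference_def)

text \<open>The growth bound makes every \<open>g1 k\<close> bounded on the unit box around
  \<open>x\<close>, and walking along the axes inside the box gives a local Lipschitz
  estimate.\<close>

lemma continuous_g: "continuous_on UNIV g"
proof -
  obtain K where K: "K \<ge> 0" "\<And>x. \<bar>g x\<bar> \<le> K * Q x" using polynomial_growth by blast
  have g1: "\<bar>g1 i x\<bar> \<le> (16 * K + c i i i) * Q x" for i x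
  proof -
    have "\<bar>g1 i x\<bar> \<le> K * (8 * Q x) + K * (8 * Q x) + c i i i * Q x"
    proof -
      have "\<bar>g (x + s *\<^sub>R axis i 1)\<bar> \<le> K * (8 * Q x)" if "\<bar>s\<bar> \<le> 1" for s
        using K(2)[of "x + s *\<^sub>R axis i 1"] mult_left_mono[OF Q_shift[OF that, of x i] K(1)] by linarith
      from this[of 1] this[of "-1"] g1_le_g[of i x] mult_left_mono[OF Q_ge_1[of x] c_nonneg[of i i i]]
      show ?thesis by simp
    qed
    then show ?thesis by (simp add: algebra_simps)
  qed
  have "isCont g x" for x
  proof -
    \<comment> \<open>\<open>Q\<close> increases with the absolute values of the coordinates, so its
      value at the outer corner bounds it on the whole box.\<close>
    define L where "L k = (16 * K + c k k k) * Q (\<chi> l. \<bar>x $ l\<bar> + 1)" for k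
    have b: "\<bar>g (x + y) - g x\<bar> \<le> (\<Sum>k\<in>UNIV. L k * \<bar>y $ k\<bar>)" if y: "norm y \<le> 1" for y
    proof -
      have yl: "\<bar>y $ l\<bar> \<le> 1" for l using component_le_norm_cart[of y l] y by linarith
      have "\<bar>g (x + msk UNIV y) - g x\<bar> \<le> (\<Sum>k\<in>UNIV. L k * \<bar>y $ k\<bar>)"
      proof (rule stepwise_bound)
        fix k and S :: "'n set" assume "k \<notin> S"
        let ?z = "x + msk S y" and ?e = "axis k 1 :: real ^ 'n"
        have le: "\<bar>g1 k (?z + s *\<^sub>R ?e)\<bar> \<le> L k" if "\<bar>s\<bar> \<le> \<bar>y $ k\<bar>" for s
        proof -
          have "\<bar>(?z + s *\<^sub>R ?e) $ l\<bar> \<le> \<bar>x $ l\<bar> + 1" for l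
            using yl[of l] that \<open>k \<notin> S\<close> abs_triangle_ineq[of "x $ l" "y $ l"] abs_triangle_ineq[of "x $ l" s]
            by (auto simp: axis_def)
          then have "Q (?z + s *\<^sub>R ?e) \<le> Q (\<chi> l. \<bar>x $ l\<bar> + 1)"
            by (intro Q_mono) (simp del: vector_add_component)
          from mult_left_mono[OF this, of "16 * K + c k k k"] K(1) c_nonneg[of k k k] g1[of k "?z + s *\<^sub>R ?e"]
          show ?thesis unfolding L_def by linarith
        qed
        have "norm (g (?z + y $ k *\<^sub>R ?e) - g (?z + 0 *\<^sub>R ?e)) \<le> L k * norm (y $ k - 0)"
        proof (rule field_differentiable_bound[where S="{- \<bar>y $ k\<bar>..\<bar>y $ k\<bar>}"
              and f="\<lambda>s. g (?z + s *\<^sub>R ?e)" and f'="\<lambda>s. g1 k (?z + s *\<^sub>R ?e)"])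
          show "((\<lambda>s. g (?z + s *\<^sub>R ?e)) has_real_derivative g1 k (?z + s *\<^sub>R ?e))
              (at s within {- \<bar>y $ k\<bar>..\<bar>y $ k\<bar>})" for s
            by (rule has_field_derivative_at_within[OF d1])
        qed (use le in auto)
        then show "\<bar>g (?z + y $ k *\<^sub>R ?e) - g ?z\<bar> \<le> L k * \<bar>y $ k\<bar>" by simp
      qed
      then show ?thesis by simp
    qed
    have "((\<lambda>y. g (x + y) - g x) \<longlongrightarrow> 0) (at 0)"
    proof (rule Lim_null_comparison)
      show "\<forall>\<^sub>F y in at 0. norm (g (x + y) - g x) \<le> (\<Sum>k\<in>UNIV. L k * \<bar>y $ k\<bar>)"
        unfolding eventually_at using b by (intro exI[of _ 1]) auto
      have "((\<lambda>y::real^'n. \<Sum>k\<in>UNIV. L k * \<bar>y $ k\<bar>) \<longlongrightarrow> (\<Sum>k\<in>UNIV. L k * \<bar>(0::real^'n) $ k\<bar>)) (at 0)"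
        by (intro tendsto_intros)
      then show "((\<lambda>y::real^'n. \<Sum>k\<in>UNIV. L k * \<bar>y $ k\<bar>) \<longlongrightarrow> 0) (at 0)" by simp
    qed
    then show ?thesis unfolding isCont_iff by (rule LIM_zero_cancel)
  qed
  then show ?thesis by (simp add: continuous_at_imp_continuous_on)
qed

lemma continuous_g_shift: "continuous_on UNIV (\<lambda>x. g (x + a))"
  by (rule continuous_on_compose2[OF continuous_g]) (auto intro!: continuous_intros)

text \<open>Central rather than one-sided differences: a one-sided error contains
  \<open>g2 i i\<close>, which need not be bounded uniformly in \<open>x\<close>.\<close>

lemma continuous_g1: "continuous_on UNIV (g1 i)"
proof (rule continuous_on_uniform_approx)
  show "continuous_on UNIV (\<lambda>x. (g (x + t *\<^sub>R axis i 1) - g (x + (- t *\<^sub>R axis i 1))) / (2 * t))" for t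
    unfolding divide_inverse by (intro continuous_intros continuous_g_shift)
  show "\<bar>(g (x + t *\<^sub>R axis i 1) - g (x + (- t *\<^sub>R axis i 1))) / (2 * t) - g1 i x\<bar> \<le> c i i i * t"
    if t: "0 < t" "t \<le> 1" for t x
  proof -
    let ?D = "g (x + t *\<^sub>R axis i 1) - g (x + (- t *\<^sub>R axis i 1))"
    have "\<bar>?D / (2 * t) - g1 i x\<bar> = \<bar>?D - 2 * t * g1 i x\<bar> / (2 * t)"
      using t by (simp add: field_simps abs_divide[symmetric])
    also have "\<dots> \<le> (c i i i * \<bar>t\<bar> ^ 3 / 3) / (2 * t)"
      using central_difference_g1[of x t i] t by (intro divide_right_mono) auto
    also have "\<dots> = c i i i * t * (t / 6)" using t by (simp add: power3_eq_cube)
    also have "\<dots> \<le> c i i i * t * 1" using t c_nonneg by (intro mult_left_mono) auto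
    finally show ?thesis by simp
  qed
qed

lemma continuous_g2:
  assumes "ok i j i" "ok i j j"
  shows "continuous_on UNIV (g2 i j)"
proof (rule continuous_on_uniform_approx)
  show "continuous_on UNIV (\<lambda>x. mixed_difference t i j x / t\<^sup>2)" for t
    unfolding divide_inverse mixed_difference_def add.assoc
    by (intro continuous_intros continuous_g_shift continuous_g)
  show "\<bar>mixed_difference t i j x / t\<^sup>2 - g2 i j x\<bar> \<le> (c i j i + c i j j) * t" if t: "0 < t" "t \<le> 1" for t x
  proof -
    have "\<bar>mixed_difference t i j x / t\<^sup>2 - g2 i j x\<bar> = \<bar>mixed_difference t i j x - t\<^sup>2 * g2 i j x\<bar> / t\<^sup>2"
      using t by (simp add: field_simps abs_divide[symmetric])
    also have "\<dots> \<le> ((c i j i + c i j j) * t ^ 3) / t\<^sup>2"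
      using mixed_difference_g2[OF assms t(1), of x] by (intro divide_right_mono) auto
    also have "\<dots> = (c i j i + c i j j) * t" using t by (simp add: power3_eq_cube power2_eq_square)
    finally show ?thesis .
  qed
qed

end

section \<open>Uniqueness of laws on \<open>\<real>\<^sup>n\<close>\<close>

text \<open>Domination of the difference quotients by \<open>w\<close> comes from the mean value
  theorem. The almost everywhere form matters because the later bounds hold only almost
  surely.\<close>

lemma has_real_derivative_integral:
  fixes F F' :: "real \<Rightarrow> 'a \<Rightarrow> real"
  assumes int: "\<And>t. integrable M (F t)"
    and d: "AE \<omega> in M. \<forall>t. ((\<lambda>t. F t \<omega>) has_real_derivative F' t \<omega>) (at t)"
    and b: "AE \<omega> in M. \<forall>t. \<bar>F' t \<omega>\<bar> \<le> w \<omega>"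
    and w: "integrable M w" and m: "F' t0 \<in> borel_measurable M"
  shows "((\<lambda>t. \<integral>\<omega>. F t \<omega> \<partial>M) has_real_derivative (\<integral>\<omega>. F' t0 \<omega> \<partial>M)) (at t0)"
  unfolding has_field_derivative_iff tendsto_at_iff_sequentially
proof (intro allI impI)
  fix T :: "nat \<Rightarrow> real" assume T: "\<forall>i. T i \<in> UNIV - {t0}" "T \<longlonglongrightarrow> t0"
  have "(\<lambda>n. \<integral>\<omega>. (F (T n) \<omega> - F t0 \<omega>) / (T n - t0) \<partial>M) \<longlonglongrightarrow> (\<integral>\<omega>. F' t0 \<omega> \<partial>M)"
  proof (rule integral_dominated_convergence[where w=w])
    show "(\<lambda>\<omega>. (F (T n) \<omega> - F t0 \<omega>) / (T n - t0)) \<in> borel_measurable M" for n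
      using int by (intro borel_measurable_divide borel_measurable_diff) auto
    show "AE \<omega> in M. (\<lambda>n. (F (T n) \<omega> - F t0 \<omega>) / (T n - t0)) \<longlonglongrightarrow> F' t0 \<omega>"
      using d
    proof eventually_elim
      case (elim \<omega>)
      then have "((\<lambda>t. (F t \<omega> - F t0 \<omega>) / (t - t0)) \<longlongrightarrow> F' t0 \<omega>) (at t0)"
        unfolding has_field_derivative_iff by blast
      then show ?case
        unfolding tendsto_at_iff_sequentially using T by (auto simp: o_def)
    qed
    show "AE \<omega> in M. norm ((F (T n) \<omega> - F t0 \<omega>) / (T n - t0)) \<le> w \<omega>" for n
      using d b
    proof eventually_elim
      case (elim \<omega>)
      have "norm (F (T n) \<omega> - F t0 \<omega>) \<le> w \<omega> * norm (T n - t0)"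
        by (rule field_differentiable_bound[where S=UNIV and f'="\<lambda>t. F' t \<omega>"]) (use elim in auto)
      moreover have "T n \<noteq> t0" using T by auto
      ultimately show ?case by (simp add: norm_divide divide_le_eq)
    qed
  qed (use m w in auto)
  also have "(\<lambda>n. \<integral>\<omega>. (F (T n) \<omega> - F t0 \<omega>) / (T n - t0) \<partial>M)
      = (\<lambda>t. ((\<integral>\<omega>. F t \<omega> \<partial>M) - (\<integral>\<omega>. F t0 \<omega> \<partial>M)) / (t - t0)) \<circ> T"
    using int by (auto simp: o_def)
  finally show "((\<lambda>t. ((\<integral>\<omega>. F t \<omega> \<partial>M) - (\<integral>\<omega>. F t0 \<omega> \<partial>M)) / (t - t0)) \<circ> T)
      \<longlonglongrightarrow> (\<integral>\<omega>. F' t0 \<omega> \<partial>M)" .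
qed

text \<open>Discretising one coordinate at a time exhibits the function as an iterated pointwise limit of
  functions that are piecewise constant in the coordinates already treated.\<close>

lemma borel_measurable_separately_continuous:
  fixes F :: "real ^ 'n \<Rightarrow> real"
  assumes c: "\<And>x i. continuous_on UNIV (\<lambda>t. F (x + t *\<^sub>R axis i 1))"
  shows "F \<in> borel_measurable borel"
proof -
  have "(\<lambda>x. F (msk J x + msk (- J) r)) \<in> borel_measurable borel" if "finite J" for J r
    using that
  proof (induction J arbitrary: r)
    case (insert j J)
    define u where "u s = msk (- {j}) r + s *\<^sub>R axis j 1" for s
    define d where "d m x = real_of_int \<lfloor>real (Suc m) * x $ j\<rfloor> / real (Suc m)" for m and x :: "real ^ 'n"
    have eq: "msk J x + msk (- J) (u s) = msk J x + msk (- insert j J) r + s *\<^sub>R axis j 1" for x s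
      using insert.hyps by (auto simp: vec_eq_iff u_def axis_def)
    have meas: "(\<lambda>x. F (msk J x + msk (- J) (u (d m x)))) \<in> borel_measurable borel" for m
      unfolding d_def
    proof (rule measurable_compose_countable[where
          f="\<lambda>k x. F (msk J x + msk (- J) (u (real_of_int k / real (Suc m))))"])
      show "(\<lambda>x::real^'n. \<lfloor>real (Suc m) * x $ j\<rfloor>) \<in> borel \<rightarrow>\<^sub>M count_space UNIV"
        by measurable
    qed (rule insert.IH)
    have "(\<lambda>m. F (msk J x + msk (- J) (u (d m x)))) \<longlonglongrightarrow> F (msk (insert j J) x + msk (- insert j J) r)" for x
    proof -
      have dist: "\<bar>d m x - x $ j\<bar> \<le> 1 / real (Suc m)" for m
      proof -
        let ?y = "real (Suc m) * x $ j"
        have "\<bar>d m x - x $ j\<bar> = \<bar>real_of_int \<lfloor>?y\<rfloor> - ?y\<bar> / real (Suc m)"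
        proof -
          have "d m x - x $ j = (real_of_int \<lfloor>?y\<rfloor> - ?y) / real (Suc m)"
            unfolding d_def by (simp add: diff_divide_distrib del: of_nat_Suc)
          then show ?thesis by (metis abs_divide abs_of_nat)
        qed
        also have "\<dots> \<le> 1 / real (Suc m)"
          by (intro divide_right_mono) linarith+
        finally show ?thesis .
      qed
      have "(\<lambda>m. d m x - x $ j) \<longlonglongrightarrow> 0"
      proof (rule Lim_null_comparison)
        show "\<forall>\<^sub>F m in sequentially. norm (d m x - x $ j) \<le> 1 / real (Suc m)"
          by (intro always_eventually allI) (simp only: real_norm_def dist)
      qed (intro LIMSEQ_Suc lim_1_over_n)
      then have "(\<lambda>m. d m x) \<longlonglongrightarrow> x $ j" by (rule LIM_zero_cancel)
      then have "(\<lambda>m. F (msk J x + msk (- insert j J) r + d m x *\<^sub>R axis j 1))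
          \<longlonglongrightarrow> F (msk J x + msk (- insert j J) r + x $ j *\<^sub>R axis j 1)"
        by (rule continuous_on_tendsto_compose[OF c]) auto
      then show ?thesis unfolding eq msk_insert[OF insert.hyps(2)] by (simp add: ac_simps)
    qed
    from borel_measurable_LIMSEQ_real[OF this meas] show ?case .
  qed simp
  from this[of UNIV] show ?thesis by simp
qed

text \<open>Normalising \<open>W\<close> to a probability density turns the two trigonometric
  integrals into the characteristic function of \<open>Y\<close> under that density, so the
  one-dimensional uniqueness theorem applies. For total mass 0 there is nothing to normalise, but
  both sides vanish.\<close>

lemma weighted_Levy_uniqueness:
  fixes P Q :: "'a measure" and W Y :: "'a \<Rightarrow> real"
  assumes P: "prob_space P" and Q: "prob_space Q"
    and [measurable]: "W \<in> borel_measurable P" "Y \<in> borel_measurable P"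
      "W \<in> borel_measurable Q" "Y \<in> borel_measurable Q"
    and W: "\<And>x. 0 \<le> W x" "\<And>x. W x \<le> b"
    and cos: "\<And>t. (\<integral>x. W x * cos (t * Y x) \<partial>P) = (\<integral>x. W x * cos (t * Y x) \<partial>Q)"
    and sin: "\<And>t. (\<integral>x. W x * sin (t * Y x) \<partial>P) = (\<integral>x. W x * sin (t * Y x) \<partial>Q)"
    and [measurable]: "C \<in> sets borel"
  shows "(\<integral>x. W x * indicator C (Y x) \<partial>P) = (\<integral>x. W x * indicator C (Y x) \<partial>Q)"
proof -
  interpret P: prob_space P by fact
  interpret Q: prob_space Q by fact
  have b: "0 \<le> b" using W(1) W(2) order_trans by blast
  have bound: "norm (W x * v) \<le> b" if "\<bar>v\<bar> \<le> 1" for v :: real and x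
    using mult_mono[OF W(2)[of x] that b] W(1)[of x] by (simp add: abs_mult)
  have intP: "integrable P (\<lambda>x. W x * f x)" if "f \<in> borel_measurable P" "\<And>x. \<bar>f x\<bar> \<le> 1" for f
    using that by (intro P.integrable_const_bound[where B=b] AE_I2 bound) auto
  have intQ: "integrable Q (\<lambda>x. W x * f x)" if "f \<in> borel_measurable Q" "\<And>x. \<bar>f x\<bar> \<le> 1" for f
    using that by (intro Q.integrable_const_bound[where B=b] AE_I2 bound) auto
  define m where "m = (\<integral>x. W x \<partial>P)"
  \<comment> \<open>At \<open>t = 0\<close> the cosine hypothesis equates the masses, so one
    constant \<open>m\<close> normalises both measures.\<close>
  have mQ: "m = (\<integral>x. W x \<partial>Q)" using cos[of 0] by (simp add: m_def)
  have m0: "0 \<le> m" unfolding m_def by (intro integral_nonneg_AE) (simp add: W)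
  show ?thesis
  proof (cases "m = 0")
    case True
    have "AE x in P. W x = 0"
      using True intP[of "\<lambda>_. 1"] W unfolding m_def
      by (subst integral_nonneg_eq_0_iff_AE[symmetric]) auto
    moreover have "AE x in Q. W x = 0"
      using True intQ[of "\<lambda>_. 1"] W unfolding mQ
      by (subst integral_nonneg_eq_0_iff_AE[symmetric]) auto
    ultimately have "AE x in P. W x * indicator C (Y x) = 0" "AE x in Q. W x * indicator C (Y x) = 0"
      by (auto elim: eventually_mono)
    from this[THEN integral_eq_zero_AE] show ?thesis by simp
  next
    case False
    with m0 have m: "0 < m" by simp
    have key: "real_distribution (distr (density R (\<lambda>x. ennreal (W x / m))) borel Y) \<and>
       (\<forall>t. char (distr (density R (\<lambda>x. ennreal (W x / m))) borel Y) t
         = Complex ((\<integral>x. W x * cos (t * Y x) \<partial>R) / m) ((\<integral>x. W x * sin (t * Y x) \<partial>R) / m)) \<and>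
       measure (distr (density R (\<lambda>x. ennreal (W x / m))) borel Y) C = (\<integral>x. W x * indicator C (Y x) \<partial>R) / m"
      if R: "prob_space R" and [measurable]: "W \<in> borel_measurable R" "Y \<in> borel_measurable R"
        and mR: "m = (\<integral>x. W x \<partial>R)"
        and intR: "\<And>f. f \<in> borel_measurable R \<Longrightarrow> (\<And>x. \<bar>f x\<bar> \<le> 1) \<Longrightarrow> integrable R (\<lambda>x. W x * f x)"
      for R :: "'a measure"
    proof (intro conjI allI)
      let ?D = "density R (\<lambda>x. ennreal (W x / m))"
      have "(\<integral>\<^sup>+x. ennreal (W x / m) \<partial>R) = ennreal (\<integral>x. W x / m \<partial>R)"
        using intR[of "\<lambda>_. 1"] W m by (intro nn_integral_eq_integral) auto
      also have "\<dots> = 1" using mR m by simp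
      finally have D: "prob_space ?D"
        by (intro prob_spaceI) (simp add: emeasure_density nn_integral_indicator_finite cong: nn_integral_cong)
      then interpret D: prob_space ?D .
      show "real_distribution (distr ?D borel Y)"
        by (intro real_distribution.intro real_distribution_axioms.intro D.prob_space_distr) auto
      show "char (distr ?D borel Y) t
         = Complex ((\<integral>x. W x * cos (t * Y x) \<partial>R) / m) ((\<integral>x. W x * sin (t * Y x) \<partial>R) / m)" for t
      proof -
        have eq: "(W x / m) *\<^sub>R iexp (t * Y x) = complex_of_real (W x * cos (t * Y x) / m)
            + \<i> * complex_of_real (W x * sin (t * Y x) / m)" for x
          by (auto simp: complex_eq_iff exp_eq_polar cis.ctr)
        have "char (distr ?D borel Y) t = (CLINT x|?D. iexp (t * Y x))"
          unfolding char_def by (subst integral_distr) auto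
        also have "\<dots> = (CLINT x|R. (W x / m) *\<^sub>R iexp (t * Y x))"
          using W m by (subst integral_density) auto
        also have "\<dots> = complex_of_real (\<integral>x. W x * cos (t * Y x) / m \<partial>R)
            + \<i> * complex_of_real (\<integral>x. W x * sin (t * Y x) / m \<partial>R)"
          unfolding eq
        proof (subst Bochner_Integration.integral_add)
          have i1: "integrable R (\<lambda>x. W x * cos (t * Y x) / m)"
            using intR[of "\<lambda>x. cos (t * Y x)"] by simp
          have i2: "integrable R (\<lambda>x. W x * sin (t * Y x) / m)"
            using intR[of "\<lambda>x. sin (t * Y x)"] by simp
          show "integrable R (\<lambda>x. complex_of_real (W x * cos (t * Y x) / m))"
            by (rule integrable_of_real[OF i1])
          show "integrable R (\<lambda>x. \<i> * complex_of_real (W x * sin (t * Y x) / m))"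
            by (intro integrable_mult_right integrable_of_real[OF i2])
          show "(CLINT x|R. complex_of_real (W x * cos (t * Y x) / m))
              + (CLINT x|R. \<i> * complex_of_real (W x * sin (t * Y x) / m))
            = complex_of_real (\<integral>x. W x * cos (t * Y x) / m \<partial>R)
            + \<i> * complex_of_real (\<integral>x. W x * sin (t * Y x) / m \<partial>R)"
            by (simp only: integral_complex_of_real integral_mult_right_zero)
        qed
        finally show ?thesis by (simp add: complex_eq_iff)
      qed
      have "measure (distr ?D borel Y) C = (\<integral>x. indicator C x \<partial>(distr ?D borel Y))"
        by simp
      also have "\<dots> = (\<integral>x. (indicator C (Y x) :: real) \<partial>?D)"
        by (subst integral_distr) auto
      also have "\<dots> = (\<integral>x. (W x / m) *\<^sub>R indicator C (Y x) \<partial>R)"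
        using W m by (subst integral_density) auto
      finally show "measure (distr ?D borel Y) C = (\<integral>x. W x * indicator C (Y x) \<partial>R) / m"
        by simp
    qed
    have KP: "real_distribution (distr (density P (\<lambda>x. ennreal (W x / m))) borel Y)"
      "char (distr (density P (\<lambda>x. ennreal (W x / m))) borel Y) t
         = Complex ((\<integral>x. W x * cos (t * Y x) \<partial>P) / m) ((\<integral>x. W x * sin (t * Y x) \<partial>P) / m)"
      "measure (distr (density P (\<lambda>x. ennreal (W x / m))) borel Y) C = (\<integral>x. W x * indicator C (Y x) \<partial>P) / m" for t
      using key[OF P assms(3,4) m_def intP] by blast+
    have KQ: "real_distribution (distr (density Q (\<lambda>x. ennreal (W x / m))) borel Y)"
      "char (distr (density Q (\<lambda>x. ennreal (W x / m))) borel Y) t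
         = Complex ((\<integral>x. W x * cos (t * Y x) \<partial>Q) / m) ((\<integral>x. W x * sin (t * Y x) \<partial>Q) / m)"
      "measure (distr (density Q (\<lambda>x. ennreal (W x / m))) borel Y) C = (\<integral>x. W x * indicator C (Y x) \<partial>Q) / m" for t
      using key[OF Q assms(5,6) mQ intQ] by blast+
    have "distr (density P (\<lambda>x. ennreal (W x / m))) borel Y = distr (density Q (\<lambda>x. ennreal (W x / m))) borel Y"
      by (rule Levy_uniqueness[OF KP(1) KQ(1)]) (simp only: fun_eq_iff KP(2) KQ(2) cos sin simp_thms)
    then have "(\<integral>x. W x * indicator C (Y x) \<partial>P) / m = (\<integral>x. W x * indicator C (Y x) \<partial>Q) / m"
      unfolding KP(3)[symmetric] KQ(3)[symmetric] by (rule arg_cong)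
    then show ?thesis using m by simp
  qed
qed

text \<open>Coordinates are turned one by one from trigonometric factors into indicator factors; the
  nonnegative weights \<open>1 + cos (a \<bullet> x)\<close> and \<open>1 + sin (a \<bullet> x)\<close> reduce each step to the line.\<close>

lemma vec_measure_eqI_char:
  fixes P Q :: "(real ^ 'n) measure"
  assumes P: "prob_space P" and Q: "prob_space Q"
    and [measurable_cong, simp]: "sets P = sets borel" "sets Q = sets borel"
    and cos: "\<And>a. (\<integral>x. cos (a \<bullet> x) \<partial>P) = (\<integral>x. cos (a \<bullet> x) \<partial>Q)"
    and sin: "\<And>a. (\<integral>x. sin (a \<bullet> x) \<partial>P) = (\<integral>x. sin (a \<bullet> x) \<partial>Q)"
  shows "P = Q"
proof -
  interpret P: prob_space P by fact
  interpret Q: prob_space Q by fact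
  have joint: "\<forall>a. (\<integral>x. cos (a \<bullet> x) * (\<Prod>l\<in>J. indicator (C l) (x $ l)) \<partial>P) = (\<integral>x. cos (a \<bullet> x) * (\<Prod>l\<in>J. indicator (C l) (x $ l)) \<partial>Q)
     \<and> (\<integral>x. sin (a \<bullet> x) * (\<Prod>l\<in>J. indicator (C l) (x $ l)) \<partial>P) = (\<integral>x. sin (a \<bullet> x) * (\<Prod>l\<in>J. indicator (C l) (x $ l)) \<partial>Q)"
    if C[measurable]: "\<And>l. C l \<in> sets borel" and "finite J" for C :: "'n \<Rightarrow> real set" and J
    using \<open>finite J\<close>
  proof (induction J)
    case empty
    then show ?case using cos sin by simp
  next
    case (insert j J)
    define w where "w x = (\<Prod>l\<in>J. indicator (C l) (x $ l) :: real)" for x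
    have [measurable]: "w \<in> borel_measurable borel" unfolding w_def by measurable
    have w: "0 \<le> w x" "w x \<le> 1" for x
      unfolding w_def by (auto intro!: prod_nonneg prod_le_1)
    have wa: "\<bar>w x\<bar> \<le> 1" for x using w[of x] by simp
    note IH = insert.IH[folded w_def]
    have IHc: "(\<integral>x. cos (a \<bullet> x) * w x \<partial>P) = (\<integral>x. cos (a \<bullet> x) * w x \<partial>Q)"
      and IHs: "(\<integral>x. sin (a \<bullet> x) * w x \<partial>P) = (\<integral>x. sin (a \<bullet> x) * w x \<partial>Q)" for a
      using IH by auto
    have iP: "integrable P (\<lambda>x. f x * w x)" and iQ: "integrable Q (\<lambda>x. f x * w x)"
      if "f \<in> borel_measurable borel" "\<And>x. \<bar>f x\<bar> \<le> 1" for f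
    proof -
      have "norm (f x * w x) \<le> 1" for x
        using mult_mono[OF that(2)[of x] wa[of x]] by (simp add: abs_mult)
      then show "integrable P (\<lambda>x. f x * w x)" "integrable Q (\<lambda>x. f x * w x)"
        using that(1) by (auto intro!: P.integrable_const_bound[where B=1] Q.integrable_const_bound[where B=1])
    qed
    define same where "same f \<longleftrightarrow> integrable P f \<and> integrable Q f \<and> (\<integral>x. f x \<partial>P) = (\<integral>x. f x \<partial>Q)"
      for f :: "real ^ 'n \<Rightarrow> real"
    have same_add: "same (\<lambda>x. f x + h x)" if "same f" "same h" for f h using that by (simp add: same_def)
    have same_diff: "same (\<lambda>x. f x - h x)" if "same f" "same h" for f h using that by (simp add: same_def)
    have same_half: "same (\<lambda>x. f x / 2)" if "same f" for f using that by (simp add: same_def)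
    have sc: "same (\<lambda>x. cos (a \<bullet> x) * w x)" and ss: "same (\<lambda>x. sin (a \<bullet> x) * w x)" for a
      unfolding same_def using IHc IHs by (auto intro!: iP iQ)
    define e where "e t = (t *\<^sub>R axis j 1 :: real ^ 'n)" for t
    have ej: "e t \<bullet> x = t * x $ j" for t x by (simp add: e_def inner_axis')
    \<comment> \<open>The product-to-sum formulas keep all four kinds of products within the
      integrals of the induction hypothesis, with frequency vectors \<open>a - e t\<close> and
      \<open>a + e t\<close>.\<close>
    have cc: "same (\<lambda>x. cos (a \<bullet> x) * w x * cos (t * x $ j))" for a t
    proof -
      have "(\<lambda>x. cos (a \<bullet> x) * w x * cos (t * x $ j))
          = (\<lambda>x. (cos ((a - e t) \<bullet> x) * w x + cos ((a + e t) \<bullet> x) * w x) / 2)"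
        unfolding inner_add_left inner_diff_left ej cos_add cos_diff by (rule ext) (simp add: algebra_simps)
      then show ?thesis using sc same_add same_half by simp
    qed
    have cs: "same (\<lambda>x. cos (a \<bullet> x) * w x * sin (t * x $ j))" for a t
    proof -
      have "(\<lambda>x. cos (a \<bullet> x) * w x * sin (t * x $ j))
          = (\<lambda>x. (sin ((a + e t) \<bullet> x) * w x - sin ((a - e t) \<bullet> x) * w x) / 2)"
        unfolding inner_add_left inner_diff_left ej sin_add sin_diff by (rule ext) (simp add: algebra_simps)
      then show ?thesis using ss same_diff same_half by simp
    qed
    have sc': "same (\<lambda>x. sin (a \<bullet> x) * w x * cos (t * x $ j))" for a t
    proof -
      have "(\<lambda>x. sin (a \<bullet> x) * w x * cos (t * x $ j))
          = (\<lambda>x. (sin ((a + e t) \<bullet> x) * w x + sin ((a - e t) \<bullet> x) * w x) / 2)"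
        unfolding inner_add_left inner_diff_left ej sin_add sin_diff by (rule ext) (simp add: algebra_simps)
      then show ?thesis using ss same_add same_half by simp
    qed
    have ss': "same (\<lambda>x. sin (a \<bullet> x) * w x * sin (t * x $ j))" for a t
    proof -
      have "(\<lambda>x. sin (a \<bullet> x) * w x * sin (t * x $ j))
          = (\<lambda>x. (cos ((a - e t) \<bullet> x) * w x - cos ((a + e t) \<bullet> x) * w x) / 2)"
        unfolding inner_add_left inner_diff_left ej cos_add cos_diff by (rule ext) (simp add: algebra_simps)
      then show ?thesis using sc same_diff same_half by simp
    qed
    have wc: "same (\<lambda>x. w x * cos (t * x $ j))" and ws: "same (\<lambda>x. w x * sin (t * x $ j))" for t
      using cc[of 0 t] cs[of 0 t] by simp_all
    let ?I = "\<lambda>x. indicator (C j) (x $ j) :: real"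
    \<comment> \<open>The weight must be nonnegative, hence \<open>1 + f\<close> with
      \<open>f\<close> a sine or cosine; the contribution of the constant 1 is subtracted again in
      \<open>fin\<close>.\<close>
    have step: "(\<integral>x. (1 + f x) * w x * ?I x \<partial>P) = (\<integral>x. (1 + f x) * w x * ?I x \<partial>Q)"
      if [measurable]: "f \<in> borel_measurable borel" and f: "\<And>x. -1 \<le> f x" "\<And>x. f x \<le> 1"
        and fc: "\<And>t. same (\<lambda>x. f x * w x * cos (t * x $ j))" and fs: "\<And>t. same (\<lambda>x. f x * w x * sin (t * x $ j))"
      for f
    proof (rule weighted_Levy_uniqueness[OF P Q, where b=2])
      show "(\<integral>x. (1 + f x) * w x * cos (t * x $ j) \<partial>P) = (\<integral>x. (1 + f x) * w x * cos (t * x $ j) \<partial>Q)" for t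
        using same_add[OF wc[of t] fc[of t]] by (simp add: same_def algebra_simps)
      show "(\<integral>x. (1 + f x) * w x * sin (t * x $ j) \<partial>P) = (\<integral>x. (1 + f x) * w x * sin (t * x $ j) \<partial>Q)" for t
        using same_add[OF ws[of t] fs[of t]] by (simp add: same_def algebra_simps)
      show "0 \<le> (1 + f x) * w x" for x using f[of x] w[of x] by simp
      show "(1 + f x) * w x \<le> 2" for x using mult_mono[of "1 + f x" 2 "w x" 1] f[of x] w[of x] by simp
      show "C j \<in> sets borel" by fact
    qed measurable
    have base: "(\<integral>x. w x * ?I x \<partial>P) = (\<integral>x. w x * ?I x \<partial>Q)"
      using step[of "\<lambda>_. 0"] by (simp add: same_def)
    have fin: "(\<integral>x. f x * (\<Prod>l\<in>insert j J. indicator (C l) (x $ l)) \<partial>P)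
       = (\<integral>x. f x * (\<Prod>l\<in>insert j J. indicator (C l) (x $ l)) \<partial>Q)"
      if [measurable]: "f \<in> borel_measurable borel" and f: "\<And>x. -1 \<le> f x" "\<And>x. f x \<le> 1"
        and fc: "\<And>t. same (\<lambda>x. f x * w x * cos (t * x $ j))" and fs: "\<And>t. same (\<lambda>x. f x * w x * sin (t * x $ j))"
      for f
    proof -
      have eq: "f x * (\<Prod>l\<in>insert j J. indicator (C l) (x $ l)) = (1 + f x) * w x * ?I x - w x * ?I x" for x
        using insert.hyps by (simp add: w_def algebra_simps)
      have fa: "\<bar>(1 + f x) * ?I x / 2\<bar> \<le> 1" for x
        using f[of x] by (auto simp: indicator_def)
      have "integrable P (\<lambda>x. 2 * ((1 + f x) * ?I x / 2 * w x))" "integrable Q (\<lambda>x. 2 * ((1 + f x) * ?I x / 2 * w x))"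
        using fa by (auto intro!: integrable_mult_right iP iQ simp del: times_divide_eq_left)
      then have i1: "integrable P (\<lambda>x. (1 + f x) * w x * ?I x)" "integrable Q (\<lambda>x. (1 + f x) * w x * ?I x)"
        by (simp_all add: mult_ac)
      have i2: "integrable P (\<lambda>x. w x * ?I x)" "integrable Q (\<lambda>x. w x * ?I x)"
        using iP[of ?I] iQ[of ?I] by (simp_all add: mult_ac indicator_def)
      show ?thesis unfolding eq using i1 i2 base step[OF that] by simp
    qed
    show ?case
      by (intro allI conjI fin) (auto simp: cc cs sc' ss')
  qed
  show ?thesis
  proof (rule measure_eqI_generator_eq[where E="range (\<lambda>a. {..a})" and \<Omega>=UNIV and A="\<lambda>n. {..(\<chi> i. real n)}"])
    show "Int_stable (range (\<lambda>a::real^'n. {..a}))"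
    proof (rule Int_stableI)
      fix A B assume "A \<in> range (\<lambda>a::real^'n. {..a})" "B \<in> range (\<lambda>a::real^'n. {..a})"
      then obtain a b where "A = {..a}" "B = {..b}" by auto
      then have "A \<inter> B = {..(\<chi> i. min (a $ i) (b $ i))}" by (auto simp: less_eq_vec_def)
      then show "A \<inter> B \<in> range (\<lambda>a. {..a})" by auto
    qed
    show "sets P = sigma_sets UNIV (range (\<lambda>a. {..a}))" "sets Q = sigma_sets UNIV (range (\<lambda>a. {..a}))"
      by (simp_all add: borel_eq_atMost)
    show "emeasure P A = emeasure Q A" if A: "A \<in> range (\<lambda>a. {..a})" for A
    proof -
      obtain a where A: "A = {..a}" using A by auto
      \<comment> \<open>Half-lines make the product the indicator of a lower orthant, and such sets
        form an intersection-stable generator. Frequency 0 turns the cosine factor into 1.\<close>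
      have ind: "(\<Prod>l\<in>UNIV. indicator {..a $ l} (x $ l)) = (indicator A x :: real)" for x
      proof (cases "x \<le> a")
        case True
        then have "x $ l \<le> a $ l" for l by (simp add: less_eq_vec_def)
        then show ?thesis using True by (simp add: A)
      next
        case False
        then obtain l where "\<not> x $ l \<le> a $ l" unfolding less_eq_vec_def by blast
        then have "(\<Prod>l\<in>UNIV. indicator {..a $ l} (x $ l)) = (0::real)"
          by (intro prod_zero bexI[of _ l]) auto
        then show ?thesis using False by (simp add: A)
      qed
      have Am: "A \<in> sets P" "A \<in> sets Q" by (simp_all add: A)
      have "(\<integral>x. indicator A x \<partial>P) = (\<integral>x. (indicator A x :: real) \<partial>Q)"
        using joint[of "\<lambda>l. {..a $ l}" UNIV] by (auto simp: ind dest!: spec[of _ 0])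
      then have "measure P A = measure Q A" using Am by (simp add: sets.Int_space_eq2)
      then show ?thesis by (simp add: P.emeasure_eq_measure Q.emeasure_eq_measure)
    qed
    show "(\<Union>n. {..\<chi> i. real n}) = (UNIV :: (real ^ 'n) set)"
    proof (rule UNIV_eq_I[symmetric])
      fix x :: "real ^ 'n"
      obtain n where n: "norm x \<le> real n" using real_arch_simple by blast
      have "x $ i \<le> real n" for i using component_le_norm_cart[of x i] n by linarith
      then show "x \<in> (\<Union>n. {..\<chi> i. real n})" by (auto simp: less_eq_vec_def)
    qed
    show "emeasure P {..\<chi> i. real n} \<noteq> \<infinity>" for n by (simp add: P.emeasure_finite)
    show "range (\<lambda>n. {..\<chi> i. real n}) \<subseteq> range (\<lambda>a::real^'n. {..a})" by blast
  qed simp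
qed

section \<open>Gaussian integration by parts\<close>

text \<open>The sum is compared with its largest term. The summand 1 on the right covers empty
  \<open>I\<close> with \<open>k = 0\<close>.\<close>

lemma sum_pow_le:
  fixes f :: "'a \<Rightarrow> real"
  assumes "finite I" "\<And>i. i \<in> I \<Longrightarrow> 0 \<le> f i"
  shows "(\<Sum>i\<in>I. f i) ^ k \<le> (1 + real (card I)) ^ k * (1 + (\<Sum>i\<in>I. f i ^ k))"
proof (cases "I = {}")
  case False
  let ?m = "Max (f ` I)"
  obtain j where j: "j \<in> I" "?m = f j"
  proof -
    have "Max (f ` I) \<in> f ` I" using assms False by (intro Max_in) auto
    then show thesis using that by blast
  qed
  have "(\<Sum>i\<in>I. f i) \<le> real (card I) * f j"
    using assms by (intro sum_bounded_above) (simp add: j(2)[symmetric])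
  also have "\<dots> \<le> (1 + real (card I)) * f j"
    using assms j by (intro mult_right_mono) auto
  finally have "(\<Sum>i\<in>I. f i) ^ k \<le> ((1 + real (card I)) * f j) ^ k"
    using assms by (intro power_mono sum_nonneg)
  also have "\<dots> = (1 + real (card I)) ^ k * f j ^ k" by (rule power_mult_distrib)
  also have "f j ^ k \<le> (\<Sum>i\<in>I. f i ^ k)"
    using assms j by (intro member_le_sum[where f="\<lambda>i. f i ^ k"]) auto
  also have "(\<Sum>i\<in>I. f i ^ k) \<le> 1 + (\<Sum>i\<in>I. f i ^ k)" by simp
  finally show ?thesis by (simp add: mult_left_mono)
qed (simp add: power_0_left)

lemma integrable_product_pair:
  fixes f :: "'a \<Rightarrow> real" and g :: "'b \<Rightarrow> real"
  assumes "prob_space P" "prob_space R" and f: "integrable P f" and g: "integrable R g"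
  shows "integrable (P \<Otimes>\<^sub>M R) (\<lambda>z. f (fst z) * g (snd z))"
    and "(\<integral>z. f (fst z) * g (snd z) \<partial>(P \<Otimes>\<^sub>M R)) = (\<integral>x. f x \<partial>P) * (\<integral>y. g y \<partial>R)"
proof -
  interpret P: prob_space P by fact
  interpret R: prob_space R by fact
  interpret PR: pair_prob_space P R ..
  have [measurable]: "f \<in> borel_measurable P" "g \<in> borel_measurable R" using f g by auto
  show int: "integrable (P \<Otimes>\<^sub>M R) (\<lambda>z. f (fst z) * g (snd z))"
  proof (rule PR.Fubini_integrable)
    show "integrable P (\<lambda>x. \<integral>y. norm (f (fst (x, y)) * g (snd (x, y))) \<partial>R)"
      using f by (simp add: abs_mult)
    show "AE x in P. integrable R (\<lambda>y. f (fst (x, y)) * g (snd (x, y)))"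
      using g by simp
  qed measurable
  have "(\<integral>z. f (fst z) * g (snd z) \<partial>(P \<Otimes>\<^sub>M R)) = (\<integral>x. \<integral>y. f x * g y \<partial>R \<partial>P)"
    using PR.integral_fst[of "\<lambda>x y. f x * g y"] int by (simp add: case_prod_beta')
  then show "(\<integral>z. f (fst z) * g (snd z) \<partial>(P \<Otimes>\<^sub>M R)) = (\<integral>x. f x \<partial>P) * (\<integral>y. g y \<partial>R)"
    by simp
qed

section \<open>The normal law on the line, point masses included\<close>

lemma prob_space_std_normal: "prob_space std_normal_distribution"
  by (intro prob_space_normal_density) simp

text \<open>Writing every normal law as an affine image of the standard one removes the case
  distinction for point masses from the computation of moments and characteristic functions.\<close>

lemma normal_law_eq_distr:
  assumes "0 \<le> s"
  shows "normal_law m s = distr std_normal_distribution borel (\<lambda>x. m + s * x)"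
proof (cases "s = 0")
  case True
  interpret prob_space std_normal_distribution by (rule prob_space_std_normal)
  have "distr std_normal_distribution borel (\<lambda>x. m) = return borel m"
    by (rule distr_const) simp
  then show ?thesis using True by (simp add: normal_law_def)
next
  case False
  interpret prob_space std_normal_distribution by (rule prob_space_std_normal)
  have "distributed std_normal_distribution lborel (\<lambda>x. x) std_normal_density"
    unfolding distributed_def by (subst distr_id2) auto
  from normal_density_affine[OF this, of s m] False assms
  have "distributed std_normal_distribution lborel (\<lambda>x. m + s * x) (normal_density m s)"
    by simp
  then have "distr std_normal_distribution lborel (\<lambda>x. m + s * x) = density lborel (normal_density m s)"
    by (rule distributed_distr_eq_density)
  then show ?thesis using False unfolding normal_law_def by (simp cong: distr_cong)
qed

lemma sets_normal_law [simp, measurable_cong]: "sets (normal_law m s) = sets borel"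
  by (simp add: normal_law_def)

lemma prob_space_normal_law: "0 \<le> s \<Longrightarrow> prob_space (normal_law m s)"
  by (simp add: normal_law_eq_distr prob_space.prob_space_distr[OF prob_space_std_normal])

lemma integrable_std_normal_power: "integrable std_normal_distribution (\<lambda>x. x ^ k)"
  using integrable_std_normal_moment[of k] by (subst integrable_density) auto

lemma integrable_normal_law_power:
  assumes "0 \<le> s"
  shows "integrable (normal_law 0 s) (\<lambda>x. \<bar>x\<bar> ^ k)"
proof -
  have "integrable std_normal_distribution (\<lambda>x. \<bar>s * x\<bar> ^ k)"
  proof -
    have "integrable std_normal_distribution (\<lambda>x. \<bar>s\<bar> ^ k * \<bar>x ^ k\<bar>)"
      by (intro integrable_mult_right integrable_abs integrable_std_normal_power)
    then show ?thesis by (simp add: abs_mult power_mult_distrib power_abs)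
  qed
  then show ?thesis
    unfolding normal_law_eq_distr[OF assms] by (subst integrable_distr_eq) auto
qed

lemma normal_law_moments:
  assumes "0 \<le> s"
  shows "integrable (normal_law m s) (\<lambda>x. x)" and "(\<integral>x. x \<partial>normal_law m s) = m"
    and "(\<integral>x. x\<^sup>2 \<partial>normal_law 0 s) = s\<^sup>2"
proof -
  interpret prob_space std_normal_distribution by (rule prob_space_std_normal)
  have i: "integrable std_normal_distribution (\<lambda>x. x)"
    using integrable_std_normal_power[of 1] by simp
  have i': "integrable std_normal_distribution (\<lambda>x. m + s * x)"
    by (intro Bochner_Integration.integrable_add integrable_mult_right i integrable_const)
  then show "integrable (normal_law m s) (\<lambda>x. x)"
    unfolding normal_law_eq_distr[OF assms] by (subst integrable_distr_eq) simp_all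
  have 0: "(\<integral>x. x \<partial>std_normal_distribution) = 0"
    using integral_std_normal_moment_odd[of 0] by (subst integral_density) simp_all
  have "(\<integral>x. m + s * x \<partial>std_normal_distribution)
      = (\<integral>x. m \<partial>std_normal_distribution) + (\<integral>x. s * x \<partial>std_normal_distribution)"
    by (intro Bochner_Integration.integral_add integrable_mult_right i integrable_const)
  also have "\<dots> = m" by (simp only: integral_mult_right_zero 0) (use prob_space in simp)
  finally have "(\<integral>x. m + s * x \<partial>std_normal_distribution) = m" .
  then show "(\<integral>x. x \<partial>normal_law m s) = m"
    unfolding normal_law_eq_distr[OF assms] by (subst integral_distr) simp_all
  have "(\<integral>x. x\<^sup>2 \<partial>std_normal_distribution) = 1"
    using integral_std_normal_moment_even[of 1] by (subst integral_density) simp_all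
  then have "(\<integral>x. (0 + s * x)\<^sup>2 \<partial>std_normal_distribution) = s\<^sup>2"
    by (simp only: add_0 power_mult_distrib integral_mult_right_zero mult_1_right)
  then show "(\<integral>x. x\<^sup>2 \<partial>normal_law 0 s) = s\<^sup>2"
    unfolding normal_law_eq_distr[OF assms] by (subst integral_distr) simp_all
qed

lemma normal_law_trig:
  assumes "0 \<le> s"
  shows "(\<integral>x. cos x \<partial>normal_law 0 s) = exp (- (s\<^sup>2) / 2)" and "(\<integral>x. sin x \<partial>normal_law 0 s) = 0"
proof -
  interpret prob_space std_normal_distribution by (rule prob_space_std_normal)
  have i: "complex_integrable std_normal_distribution (\<lambda>x. iexp (s * x))"
    by (rule integrable_iexp) auto
  have c: "(CLINT x|std_normal_distribution. iexp (s * x)) = complex_of_real (exp (- (s\<^sup>2) / 2))"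
    using fun_cong[OF char_std_normal_distribution, of s] by (simp add: char_def)
  have "(\<integral>x. cos (s * x) \<partial>std_normal_distribution) = Re (CLINT x|std_normal_distribution. iexp (s * x))"
    by (subst integral_Re[OF i, symmetric]) (simp add: Re_exp)
  then show "(\<integral>x. cos x \<partial>normal_law 0 s) = exp (- (s\<^sup>2) / 2)"
    unfolding normal_law_eq_distr[OF assms] c by (subst integral_distr) auto
  have "(\<integral>x. sin (s * x) \<partial>std_normal_distribution) = Im (CLINT x|std_normal_distribution. iexp (s * x))"
    by (subst integral_Im[OF i, symmetric]) (simp add: Im_exp)
  then show "(\<integral>x. sin x \<partial>normal_law 0 s) = 0"
    unfolding normal_law_eq_distr[OF assms] c by (subst integral_distr) auto
qed

lemma power_normal_density_tendsto_0:
  assumes "0 < s"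
  shows "((\<lambda>x. (1 + \<bar>x\<bar>) ^ m * normal_density 0 s x) \<longlongrightarrow> 0) at_top"
proof (rule Lim_null_comparison)
  define D where "D = exp (1 + s\<^sup>2 / 2) / sqrt (2 * pi * s\<^sup>2)"
  show "\<forall>\<^sub>F x in at_top. norm ((1 + \<bar>x\<bar>) ^ m * normal_density 0 s x) \<le> D * ((1 + x) ^ m / exp (1 + x))"
    using eventually_ge_at_top[of 0]
  proof eventually_elim
    case (elim x)
    \<comment> \<open>Completing the square bounds the Gaussian exponent by a linear function of
      slope -1. \<open>D\<close> collects the constants; the 1 in its exponent pays for writing
      \<open>exp (1 + x)\<close>.\<close>
    have "0 \<le> (x - s\<^sup>2)\<^sup>2" by simp
    then have "0 \<le> (x - s\<^sup>2)\<^sup>2 / (2 * s\<^sup>2)" by simp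
    also have "(x - s\<^sup>2)\<^sup>2 / (2 * s\<^sup>2) = x\<^sup>2 / (2 * s\<^sup>2) - x + s\<^sup>2 / 2"
      using assms by (simp add: power2_diff field_simps power2_eq_square)
    finally have "- (x\<^sup>2 / (2 * s\<^sup>2)) \<le> (1 + s\<^sup>2 / 2) - (1 + x)" by simp
    then have "exp (- (x\<^sup>2 / (2 * s\<^sup>2))) \<le> exp (1 + s\<^sup>2 / 2) / exp (1 + x)"
      by (simp add: exp_diff[symmetric])
    then have "exp (- (x\<^sup>2 / (2 * s\<^sup>2))) / sqrt (2 * pi * s\<^sup>2)
        \<le> exp (1 + s\<^sup>2 / 2) / exp (1 + x) / sqrt (2 * pi * s\<^sup>2)"
      by (intro divide_right_mono) auto
    then have "normal_density 0 s x \<le> D / exp (1 + x)"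
      by (simp add: normal_density_def D_def mult.commute)
    then have "(1 + x) ^ m * normal_density 0 s x \<le> (1 + x) ^ m * (D / exp (1 + x))"
      using elim by (intro mult_left_mono) auto
    then show ?case using elim by (simp add: mult_ac)
  qed
  have "((\<lambda>x::real. (1 + x) ^ m / exp (1 + x)) \<longlongrightarrow> 0) at_top"
    by (rule filterlim_compose[OF tendsto_power_div_exp_0 filterlim_tendsto_add_at_top[OF tendsto_const filterlim_ident]])
  from tendsto_mult_right_zero[OF this, of D]
  show "((\<lambda>x. D * ((1 + x) ^ m / exp (1 + x))) \<longlongrightarrow> 0) at_top" .
qed

text \<open>The density n satisfies s^2 n'(x) = - x n(x), so the difference of the two integrands is
  the derivative of - s^2 q n, which vanishes at both ends by the growth bound.\<close>

lemma normal_law_integration_by_parts: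
  fixes q q' :: "real \<Rightarrow> real"
  assumes s: "0 < s" and d: "\<And>x. (q has_real_derivative q' x) (at x)"
    and c: "continuous_on UNIV q'"
    and b: "\<And>x. \<bar>q x\<bar> \<le> K * (1 + \<bar>x\<bar>) ^ m" "\<And>x. \<bar>q' x\<bar> \<le> K * (1 + \<bar>x\<bar>) ^ m"
  shows "(\<integral>x. x * q x \<partial>normal_law 0 s) = s\<^sup>2 * (\<integral>x. q' x \<partial>normal_law 0 s)"
proof -
  let ?n = "normal_density 0 s"
  have cq: "continuous_on UNIV q"
    using d by (meson DERIV_isCont continuous_at_imp_continuous_on)
  have [measurable]: "q \<in> borel_measurable borel" "q' \<in> borel_measurable borel"
    using c cq by (auto intro: borel_measurable_continuous_onI)
  have K: "0 \<le> K" using order_trans[OF abs_ge_zero b(1)[of 0]] by simp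
  interpret N: prob_space "normal_law 0 s" using s by (intro prob_space_normal_law) simp
  have pow: "integrable (normal_law 0 s) (\<lambda>x. K * (2 ^ k * (1 + \<bar>x\<bar> ^ k)))" for k
    using s by (intro integrable_mult_right Bochner_Integration.integrable_add integrable_normal_law_power N.integrable_const) simp
  have pb: "(1 + \<bar>x\<bar>) ^ k \<le> 2 ^ k * (1 + \<bar>x\<bar> ^ k)" for x :: real and k
  proof -
    have "(1 + \<bar>x\<bar>) ^ k \<le> (2 * max 1 \<bar>x\<bar>) ^ k" by (intro power_mono) auto
    also have "\<dots> = 2 ^ k * (max 1 \<bar>x\<bar>) ^ k" by (rule power_mult_distrib)
    also have "(max 1 \<bar>x\<bar>) ^ k \<le> 1 + \<bar>x\<bar> ^ k" by (auto simp: max_def)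
    finally show ?thesis by simp
  qed
  have i1: "integrable (normal_law 0 s) (\<lambda>x. x * q x)"
  proof (rule Bochner_Integration.integrable_bound[OF pow[of "Suc m"]])
    show "AE x in normal_law 0 s. norm (x * q x) \<le> norm (K * (2 ^ Suc m * (1 + \<bar>x\<bar> ^ Suc m)))"
    proof (rule AE_I2)
      fix x
      have "\<bar>x\<bar> * \<bar>q x\<bar> \<le> (1 + \<bar>x\<bar>) * (K * (1 + \<bar>x\<bar>) ^ m)" by (intro mult_mono b) auto
      also have "\<dots> = K * (1 + \<bar>x\<bar>) ^ Suc m" by simp
      also have "\<dots> \<le> K * (2 ^ Suc m * (1 + \<bar>x\<bar> ^ Suc m))" by (intro mult_left_mono pb K)
      finally show "norm (x * q x) \<le> norm (K * (2 ^ Suc m * (1 + \<bar>x\<bar> ^ Suc m)))"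
        using K by (simp add: abs_mult)
    qed
  qed measurable
  have i2: "integrable (normal_law 0 s) q'"
  proof (rule Bochner_Integration.integrable_bound[OF pow[of m]])
    show "AE x in normal_law 0 s. norm (q' x) \<le> norm (K * (2 ^ m * (1 + \<bar>x\<bar> ^ m)))"
    proof (rule AE_I2)
      fix x
      have "\<bar>q' x\<bar> \<le> K * (2 ^ m * (1 + \<bar>x\<bar> ^ m))"
        using b(2)[of x] mult_left_mono[OF pb K, of x m] by linarith
      then show "norm (q' x) \<le> norm (K * (2 ^ m * (1 + \<bar>x\<bar> ^ m)))" by simp
    qed
  qed measurable
  have N: "normal_law 0 s = density lborel (\<lambda>x. ennreal (?n x))"
    using s by (simp add: normal_law_def)
  have int: "integrable (normal_law 0 s) f \<longleftrightarrow> integrable lborel (\<lambda>x. ?n x * f x)"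
    and eq: "(\<integral>x. f x \<partial>normal_law 0 s) = (\<integral>x. ?n x * f x \<partial>lborel)"
    if [measurable]: "f \<in> borel_measurable borel" for f :: "real \<Rightarrow> real"
    unfolding N by (simp_all add: integrable_density integral_density)
  define f where "f x = ?n x * (x * q x) - s\<^sup>2 * (?n x * q' x)" for x
  have fi: "integrable lborel f"
    unfolding f_def using i1 i2 by (simp add: int)
  have dn: "(?n has_real_derivative - (x / s\<^sup>2) * ?n x) (at x)" for x
    unfolding normal_density_def using s
    by (auto intro!: derivative_eq_intros simp: field_simps power2_eq_square)
  have dF: "((\<lambda>x. - (s\<^sup>2) * (q x * ?n x)) has_real_derivative f x) (at x)" for x
    unfolding f_def using s
    by (auto intro!: derivative_eq_intros d dn simp: algebra_simps)
  have lim: "((\<lambda>x. - (s\<^sup>2) * (q x * ?n x)) \<longlongrightarrow> 0) at_top"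
    "((\<lambda>x. - (s\<^sup>2) * (q x * ?n x)) \<longlongrightarrow> 0) at_bot"
  proof -
    have t: "((\<lambda>x. s\<^sup>2 * K * ((1 + \<bar>x\<bar>) ^ m * ?n x)) \<longlongrightarrow> 0) at_top"
      by (rule tendsto_mult_right_zero[OF power_normal_density_tendsto_0[OF s]])
    have e: "norm (- (s\<^sup>2) * (q x * ?n x)) \<le> s\<^sup>2 * K * ((1 + \<bar>x\<bar>) ^ m * ?n x)" for x
      using mult_right_mono[OF b(1), of "?n x" x] mult_left_mono[of "\<bar>q x\<bar> * ?n x" "K * (1 + \<bar>x\<bar>) ^ m * ?n x" "s\<^sup>2"]
      by (simp add: abs_mult mult_ac)
    show "((\<lambda>x. - (s\<^sup>2) * (q x * ?n x)) \<longlongrightarrow> 0) at_top"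
      by (rule Lim_null_comparison[OF always_eventually[OF allI[OF e]] t])
    have "((\<lambda>x. s\<^sup>2 * K * ((1 + \<bar>x\<bar>) ^ m * ?n x)) \<longlongrightarrow> 0) at_bot"
      using t unfolding filterlim_at_bot_mirror by (simp add: normal_density_def)
    then show "((\<lambda>x. - (s\<^sup>2) * (q x * ?n x)) \<longlongrightarrow> 0) at_bot"
      by (rule Lim_null_comparison[OF always_eventually[OF allI[OF e]]])
  qed
  have cn: "continuous_on UNIV ?n"
    using dn by (meson DERIV_isCont continuous_at_imp_continuous_on)
  have "continuous_on UNIV f"
    unfolding f_def by (intro continuous_intros cn cq c)
  then have cf: "isCont f x" for x by (simp add: continuous_on_eq_continuous_at)
  have "(LBINT x=-\<infinity>..\<infinity>. f x) = 0 - 0"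
  proof (rule interval_integral_FTC_integrable)
    show "((\<lambda>x. - (s\<^sup>2) * (q x * ?n x)) has_vector_derivative f x) (at x)" for x
      using dF by (simp add: has_real_derivative_iff_has_vector_derivative)
    show "set_integrable lborel (einterval (- \<infinity>) \<infinity>) f"
      using fi by (simp add: set_integrable_def)
    show "(((\<lambda>x. - (s\<^sup>2) * (q x * ?n x)) \<circ> real_of_ereal) \<longlongrightarrow> 0) (at_right (- \<infinity>))"
      using lim(2) by (simp only: ereal_tendsto_simps)
    show "(((\<lambda>x. - (s\<^sup>2) * (q x * ?n x)) \<circ> real_of_ereal) \<longlongrightarrow> 0) (at_left \<infinity>)"
      using lim(1) by (simp only: ereal_tendsto_simps)
  qed (use cf in auto)
  then have "(\<integral>x. f x \<partial>lborel) = 0"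
    by (simp add: interval_lebesgue_integral_def set_lebesgue_integral_def)
  then have "(\<integral>x. ?n x * (x * q x) \<partial>lborel) = s\<^sup>2 * (\<integral>x. ?n x * q' x \<partial>lborel)"
    unfolding f_def using i1 i2 by (simp add: int)
  then show ?thesis by (simp add: eq)
qed

section \<open>Gaussian vectors with a possibly singular covariance matrix\<close>

lemma Q_le_norm: "Q (x :: real ^ 'n) \<le> (1 + norm x) ^ (3 * CARD('n))"
proof -
  have "Q x \<le> (\<Prod>l\<in>(UNIV::'n set). (1 + norm x) ^ 3)"
    unfolding Q_def by (intro prod_mono conjI power_mono add_left_mono component_le_norm_cart) auto
  then show ?thesis by (simp add: power_mult)
qed

locale centred_gaussian =
  fixes P :: "(real ^ 'n) measure" and S :: "real ^ 'n ^ 'n"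
  assumes mvn: "is_MVN0 P S"
begin

lemma prob: "prob_space P" and sets_P [simp, measurable_cong]: "sets P = sets borel"
  and marginal: "\<And>a. \<exists>m s. 0 \<le> s \<and> distr P borel (\<lambda>x. a \<bullet> x) = normal_law m s"
  and mean: "\<And>i. (\<integral>x. x $ i \<partial>P) = 0" and cov: "covariance_matrix P (\<lambda>x. x) = S"
  using mvn unfolding is_MVN0_def gaussian_law_def by auto

sublocale prob_space P by (rule prob)

lemma space_P [simp]: "space P = UNIV"
  using sets_eq_imp_space_eq[OF sets_P] by simp

lemma inner_eq_sum: "(a::real^'n) \<bullet> x = (\<Sum>i\<in>UNIV. a $ i * x $ i)"
  by (simp add: inner_vec_def)

lemma nth_eq_inner: "(x::real^'n) $ i = axis i 1 \<bullet> x"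
  by (simp add: inner_axis')

lemma integrable_nth: "integrable P (\<lambda>x. x $ i)"
proof -
  obtain m s where s: "0 \<le> s" "distr P borel (\<lambda>x. axis i 1 \<bullet> x) = normal_law m s"
    using marginal by blast
  have "integrable (distr P borel (\<lambda>x. axis i 1 \<bullet> x)) (\<lambda>x. x)"
    unfolding s(2) by (rule normal_law_moments[OF s(1)])
  then show ?thesis by (subst (asm) integrable_distr_eq) (simp_all add: nth_eq_inner)
qed

lemma centred_marginal: "\<exists>s\<ge>0. distr P borel (\<lambda>x. a \<bullet> x) = normal_law 0 s"
proof -
  obtain m s where s: "0 \<le> s" "distr P borel (\<lambda>x. a \<bullet> x) = normal_law m s"
    using marginal by blast
  have "m = (\<integral>x. x \<partial>distr P borel (\<lambda>x. a \<bullet> x))"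
    unfolding s(2) by (rule normal_law_moments(2)[OF s(1), symmetric])
  also have "\<dots> = (\<integral>x. (\<Sum>i\<in>UNIV. a $ i * x $ i) \<partial>P)"
    by (subst integral_distr) (simp_all flip: inner_eq_sum)
  also have "\<dots> = 0"
    by (subst Bochner_Integration.integral_sum) (simp_all add: integrable_nth mean)
  finally show ?thesis using s by blast
qed

lemma integrable_inner_power: "integrable P (\<lambda>x. \<bar>a \<bullet> x\<bar> ^ k)"
proof -
  obtain s where s: "0 \<le> s" "distr P borel (\<lambda>x. a \<bullet> x) = normal_law 0 s"
    using centred_marginal by blast
  have "integrable (distr P borel (\<lambda>x. a \<bullet> x)) (\<lambda>x. \<bar>x\<bar> ^ k)"
    unfolding s(2) by (rule integrable_normal_law_power[OF s(1)])
  then show ?thesis by (subst (asm) integrable_distr_eq) simp_all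
qed

lemma integrable_norm_power: "integrable P (\<lambda>x. (1 + norm x) ^ k)"
proof (rule Bochner_Integration.integrable_bound)
  let ?f = "\<lambda>x::real^'n. (2 + real CARD('n)) ^ k * (2 + (\<Sum>i\<in>UNIV. \<bar>axis i 1 \<bullet> x\<bar> ^ k))"
  show "integrable P ?f"
    by (intro integrable_mult_right Bochner_Integration.integrable_add Bochner_Integration.integrable_sum
        integrable_inner_power integrable_const)
  show "AE x in P. norm ((1 + norm x) ^ k) \<le> norm (?f x)"
  proof (rule AE_I2)
    fix x :: "real ^ 'n"
    \<comment> \<open>\<open>None\<close> carries the constant 1, so that 1 plus the l1-norm is a
      single sum over \<open>CARD('n) + 1\<close> indices; this is the origin of both constants 2 in
      \<open>?f\<close>.\<close>
    define f where "f w = (case w of None \<Rightarrow> 1 | Some i \<Rightarrow> \<bar>x $ i\<bar>)" for w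
    have sum_opt: "(\<Sum>w\<in>UNIV. h w) = h None + (\<Sum>i\<in>UNIV. h (Some i))" for h :: "'n option \<Rightarrow> real"
      by (simp add: UNIV_option_conv sum.reindex)
    have "(1 + norm x) ^ k \<le> (\<Sum>w\<in>UNIV. f w) ^ k"
      by (intro power_mono) (simp_all add: sum_opt f_def norm_le_l1_cart)
    also have "\<dots> \<le> (1 + real (card (UNIV :: 'n option set))) ^ k * (1 + (\<Sum>w\<in>UNIV. f w ^ k))"
      by (rule sum_pow_le) (auto simp: f_def split: option.split)
    also have "\<dots> = ?f x"
      by (simp add: sum_opt f_def inner_axis' card_UNIV_option add.assoc[symmetric])
    finally have "(1 + norm x) ^ k \<le> ?f x" .
    then show "norm ((1 + norm x) ^ k) \<le> norm (?f x)" by simp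
  qed
qed measurable

lemma integrable_poly_bound:
  assumes "f \<in> borel_measurable borel" and b: "\<And>x. \<bar>f x\<bar> \<le> K * (1 + norm x) ^ k"
  shows "integrable P f"
proof (rule Bochner_Integration.integrable_bound)
  show "integrable P (\<lambda>x. K * (1 + norm x) ^ k)"
    by (intro integrable_mult_right integrable_norm_power)
  show "AE x in P. norm (f x) \<le> norm (K * (1 + norm x) ^ k)"
    using order_trans[OF b abs_ge_self] by (intro AE_I2) simp
qed (use assms in measurable)

lemma integrable_nth_mult: "integrable P (\<lambda>x. x $ i * x $ j)"
proof (rule integrable_poly_bound[where K=1 and k=2])
  fix x :: "real ^ 'n"
  have "\<bar>x $ i\<bar> * \<bar>x $ j\<bar> \<le> (1 + norm x) * (1 + norm x)"
    using component_le_norm_cart[of x i] component_le_norm_cart[of x j] by (intro mult_mono) auto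
  then show "\<bar>x $ i * x $ j\<bar> \<le> 1 * (1 + norm x) ^ 2" by (simp add: abs_mult power2_eq_square)
qed measurable

lemma cov_nth: "(\<integral>x. x $ i * x $ j \<partial>P) = S $ i $ j"
  using cov unfolding covariance_matrix_def by (auto simp: mean)

lemma cov_sym: "S $ i $ j = S $ j $ i"
  unfolding cov_nth[symmetric] by (simp add: mult.commute)

definition var :: "real ^ 'n \<Rightarrow> real" where
  "var a = (\<integral>x. (a \<bullet> x)\<^sup>2 \<partial>P)"

lemma integrable_inner_mult: "integrable P (\<lambda>x. (a \<bullet> x) * (b \<bullet> x))"
  unfolding inner_eq_sum sum_product
proof (intro Bochner_Integration.integrable_sum)
  fix i j
  have "(\<lambda>x::real^'n. a $ i * x $ i * (b $ j * x $ j)) = (\<lambda>x. (a $ i * b $ j) * (x $ i * x $ j))"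
    by (simp add: mult_ac)
  then show "integrable P (\<lambda>x. a $ i * x $ i * (b $ j * x $ j))"
    using integrable_nth_mult by simp
qed

lemma cov_inner_nth: "(\<integral>x. (a \<bullet> x) * x $ i \<partial>P) = (\<Sum>j\<in>UNIV. a $ j * S $ i $ j)"
  unfolding inner_eq_sum sum_distrib_right mult.assoc
  by (subst Bochner_Integration.integral_sum) (simp_all add: integrable_nth_mult cov_nth cov_sym[of i])

lemma trig_inner:
  shows "(\<integral>x. cos (a \<bullet> x) \<partial>P) = exp (- var a / 2)" and "(\<integral>x. sin (a \<bullet> x) \<partial>P) = 0"
proof -
  obtain s where s: "0 \<le> s" "distr P borel (\<lambda>x. a \<bullet> x) = normal_law 0 s"
    using centred_marginal by blast
  have v: "var a = s\<^sup>2"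
    unfolding var_def normal_law_moments(3)[OF s(1), symmetric] s(2)[symmetric]
    by (subst integral_distr) simp_all
  have "(\<integral>x. cos (a \<bullet> x) \<partial>P) = (\<integral>x. cos x \<partial>distr P borel (\<lambda>x. a \<bullet> x))"
    by (subst integral_distr) simp_all
  then show "(\<integral>x. cos (a \<bullet> x) \<partial>P) = exp (- var a / 2)"
    unfolding s(2) v normal_law_trig(1)[OF s(1)] .
  have "(\<integral>x. sin (a \<bullet> x) \<partial>P) = (\<integral>x. sin x \<partial>distr P borel (\<lambda>x. a \<bullet> x))"
    by (subst integral_distr) simp_all
  then show "(\<integral>x. sin (a \<bullet> x) \<partial>P) = 0"
    unfolding s(2) normal_law_trig(2)[OF s(1)] .
qed

text \<open>The regression of a Gaussian vector on its \<open>i\<close>-th coordinate leaves a residual independent of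
  that coordinate. Hence resampling the coordinate from an independent copy preserves the law.\<close>

lemma distr_resample:
  assumes pos: "0 < S $ i $ i"
  defines "v \<equiv> (\<chi> j. S $ i $ j / S $ i $ i)"
  shows "distr (P \<Otimes>\<^sub>M P) borel (\<lambda>z. fst z + (snd z $ i - fst z $ i) *\<^sub>R v) = P"
proof (rule vec_measure_eqI_char)
  let ?r = "\<lambda>z. fst z + (snd z $ i - fst z $ i) *\<^sub>R v"
  interpret PP: pair_prob_space P P ..
  have r [measurable]: "?r \<in> P \<Otimes>\<^sub>M P \<rightarrow>\<^sub>M borel" by measurable
  show "prob_space (distr (P \<Otimes>\<^sub>M P) borel ?r)" by (rule PP.prob_space_distr[OF r])
  show "prob_space P" by (rule prob)
  have split: "a \<bullet> ?r z = (a - (a \<bullet> v) *\<^sub>R axis i 1) \<bullet> fst z + ((a \<bullet> v) *\<^sub>R axis i 1) \<bullet> snd z" for a z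
    by (simp add: inner_add_right inner_diff_left inner_axis' algebra_simps)
  have trig_int: "integrable P (\<lambda>x. cos (a \<bullet> x))" "integrable P (\<lambda>x. sin (a \<bullet> x))" for a
    by (auto intro!: integrable_const_bound[where B=1])
  note prod = integrable_product_pair[OF prob prob]
  show "(\<integral>x. cos (a \<bullet> x) \<partial>distr (P \<Otimes>\<^sub>M P) borel ?r) = (\<integral>x. cos (a \<bullet> x) \<partial>P)" for a
  proof -
    let ?a = "a - (a \<bullet> v) *\<^sub>R axis i 1" and ?b = "(a \<bullet> v) *\<^sub>R axis i 1 :: real ^ 'n"
    \<comment> \<open>\<open>v\<close> is the regression vector: the covariance of
      \<open>a \<bullet> x\<close> with \<open>x $ i\<close> is
      \<open>(a \<bullet> v) * S $ i $ i\<close>, so the cross term offsets the two squares. A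
      centred normal characteristic function depends on the variance only.\<close>
    have var: "var ?a + var ?b = var a"
    proof -
      let ?c = "a \<bullet> v"
      have cS: "(\<integral>x. (a \<bullet> x) * x $ i \<partial>P) = ?c * S $ i $ i"
        unfolding cov_inner_nth using pos by (simp add: inner_eq_sum sum_distrib_right v_def)
      have ii: "(\<integral>x. x $ i * x $ i \<partial>P) = S $ i $ i" by (rule cov_nth)
      have i1: "integrable P (\<lambda>x. (a \<bullet> x) * x $ i)"
        using integrable_inner_mult[of a "axis i 1"] by (simp add: inner_axis')
      have "var ?a + var ?b = (\<integral>x. (?a \<bullet> x)\<^sup>2 + (?b \<bullet> x)\<^sup>2 \<partial>P)"
        unfolding var_def using integrable_inner_mult[of ?a ?a] integrable_inner_mult[of ?b ?b]
        by (simp add: power2_eq_square)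
      also have "\<dots> = (\<integral>x. (a \<bullet> x)\<^sup>2 + ((-2 * ?c) * ((a \<bullet> x) * x $ i) + 2 * ?c\<^sup>2 * (x $ i * x $ i)) \<partial>P)"
        by (intro Bochner_Integration.integral_cong refl)
          (simp add: inner_diff_left inner_axis' power2_eq_square algebra_simps)
      also have "\<dots> = var a + ((-2 * ?c) * (?c * S $ i $ i) + 2 * ?c\<^sup>2 * S $ i $ i)"
        unfolding var_def
        using integrable_inner_mult[of a a] i1 integrable_nth_mult[of i i]
        by (simp add: power2_eq_square cS ii)
      also have "\<dots> = var a" by (simp add: power2_eq_square)
      finally show ?thesis .
    qed
    have "(\<integral>x. cos (a \<bullet> x) \<partial>distr (P \<Otimes>\<^sub>M P) borel ?r)
        = (\<integral>z. cos (?a \<bullet> fst z) * cos (?b \<bullet> snd z) - sin (?a \<bullet> fst z) * sin (?b \<bullet> snd z) \<partial>(P \<Otimes>\<^sub>M P))"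
      by (subst integral_distr[OF r]) (simp_all only: split cos_add borel_measurable_cos, measurable)
    also have "\<dots> = exp (- var ?a / 2) * exp (- var ?b / 2) - 0 * 0"
      by (simp only: Bochner_Integration.integral_diff[OF prod(1)[OF trig_int(1) trig_int(1)]
            prod(1)[OF trig_int(2) trig_int(2)]]
          prod(2)[OF trig_int(1) trig_int(1)] prod(2)[OF trig_int(2) trig_int(2)] trig_inner)
    also have "\<dots> = exp (- var a / 2)"
      unfolding var[symmetric] by (simp add: exp_add[symmetric] add_divide_distrib)
    finally show ?thesis by (simp only: trig_inner)
  qed
  show "(\<integral>x. sin (a \<bullet> x) \<partial>distr (P \<Otimes>\<^sub>M P) borel ?r) = (\<integral>x. sin (a \<bullet> x) \<partial>P)" for a
  proof -
    let ?a = "a - (a \<bullet> v) *\<^sub>R axis i 1" and ?b = "(a \<bullet> v) *\<^sub>R axis i 1 :: real ^ 'n"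
    have "(\<integral>x. sin (a \<bullet> x) \<partial>distr (P \<Otimes>\<^sub>M P) borel ?r)
        = (\<integral>z. sin (?a \<bullet> fst z) * cos (?b \<bullet> snd z) + cos (?a \<bullet> fst z) * sin (?b \<bullet> snd z) \<partial>(P \<Otimes>\<^sub>M P))"
      by (subst integral_distr[OF r]) (simp_all only: split sin_add borel_measurable_sin, measurable)
    also have "\<dots> = 0"
      by (simp only: Bochner_Integration.integral_add[OF prod(1)[OF trig_int(2) trig_int(1)]
            prod(1)[OF trig_int(1) trig_int(2)]]
          prod(2)[OF trig_int(2) trig_int(1)] prod(2)[OF trig_int(1) trig_int(2)] trig_inner
          mult_zero_left mult_zero_right add_0)
    finally show ?thesis by (simp only: trig_inner)
  qed
qed simp_all

lemma var_zero:
  assumes "S $ i $ i = 0"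
  shows "AE x in P. x $ i = 0"
proof -
  have "(\<integral>x. x $ i * x $ i \<partial>P) = 0" using assms by (simp add: cov_nth)
  then have "AE x in P. x $ i * x $ i = 0"
    by (subst (asm) integral_nonneg_eq_0_iff_AE) (auto simp: integrable_nth_mult)
  then show ?thesis by simp
qed

text \<open>After resampling coordinate \<open>i\<close>, the vector runs, for fixed
  \<open>x\<close>, along a line in direction \<open>v\<close> with a normal parameter, where the
  one-dimensional formula applies. The slopes S_ij / S_ii of \<open>v\<close> times the variance
  S_ii of the parameter give the coefficients S_ij, and only directions with S_ij \<noteq> 0 are
  moved at all. If S_ii = 0, both sides vanish.\<close>

lemma integration_by_parts:
  fixes p :: "real ^ 'n \<Rightarrow> real" and p' :: "'n \<Rightarrow> real ^ 'n \<Rightarrow> real"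
  assumes cp: "continuous_on UNIV p" and b: "\<And>x. \<bar>p x\<bar> \<le> K * (1 + norm x) ^ m"
    and d: "\<And>j x t. S $ i $ j \<noteq> 0 \<Longrightarrow>
      ((\<lambda>t. p (x + t *\<^sub>R axis j 1)) has_real_derivative p' j (x + t *\<^sub>R axis j 1)) (at t)"
    and cp': "\<And>j. S $ i $ j \<noteq> 0 \<Longrightarrow> continuous_on UNIV (p' j)"
    and b': "\<And>j x. S $ i $ j \<noteq> 0 \<Longrightarrow> \<bar>p' j x\<bar> \<le> K * (1 + norm x) ^ m"
  shows "(\<integral>x. x $ i * p x \<partial>P) = (\<Sum>j | S $ i $ j \<noteq> 0. S $ i $ j * (\<integral>x. p' j x \<partial>P))"
proof (cases "S $ i $ i = 0")
  case True
  have "S $ i $ j = 0" for j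
    unfolding cov_nth[symmetric]
    by (rule integral_eq_zero_AE) (use var_zero[OF True] in \<open>auto elim: eventually_mono\<close>)
  moreover have "(\<integral>x. x $ i * p x \<partial>P) = 0"
    by (rule integral_eq_zero_AE) (use var_zero[OF True] in \<open>auto elim: eventually_mono\<close>)
  ultimately show ?thesis by simp
next
  case False
  have "0 \<le> S $ i $ i"
    unfolding cov_nth[symmetric] by (intro integral_nonneg_AE) auto
  with False have pos: "0 < S $ i $ i" by simp
  define v where "v = (\<chi> j. S $ i $ j / S $ i $ i)"
  define J where "J = {j. S $ i $ j \<noteq> 0}"
  have [measurable]: "p \<in> borel_measurable borel" using cp by (rule borel_measurable_continuous_onI)
  have [measurable]: "p' j \<in> borel_measurable borel" if "j \<in> J" for j
    using cp'[of j] that by (auto simp: J_def intro: borel_measurable_continuous_onI)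
  have K: "0 \<le> K" using order_trans[OF abs_ge_zero b[of 0]] by simp
  let ?r = "\<lambda>z. fst z + (snd z $ i - fst z $ i) *\<^sub>R v"
  interpret PP: pair_prob_space P P ..
  have r [measurable]: "?r \<in> P \<Otimes>\<^sub>M P \<rightarrow>\<^sub>M borel" by measurable
  note D = distr_resample[OF pos, folded v_def]
  have resample: "integrable (P \<Otimes>\<^sub>M P) (\<lambda>z. f (?r z))" "(\<integral>x. f x \<partial>P) = (\<integral>x. \<integral>y. f (?r (x, y)) \<partial>P \<partial>P)"
    if f: "integrable P f" for f :: "real ^ 'n \<Rightarrow> real"
  proof -
    have [measurable]: "f \<in> borel_measurable borel" using f by auto
    have "integrable (distr (P \<Otimes>\<^sub>M P) borel ?r) f" unfolding D by (rule f)
    then show i: "integrable (P \<Otimes>\<^sub>M P) (\<lambda>z. f (?r z))"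
      by (subst (asm) integrable_distr_eq[OF r]) simp_all
    have "(\<integral>x. f x \<partial>P) = (\<integral>x. f x \<partial>distr (P \<Otimes>\<^sub>M P) borel ?r)" unfolding D ..
    also have "\<dots> = (\<integral>z. f (?r z) \<partial>(P \<Otimes>\<^sub>M P))" by (rule integral_distr[OF r]) simp
    also have "\<dots> = (\<integral>x. \<integral>y. f (?r (x, y)) \<partial>P \<partial>P)"
      using PP.integral_fst'[OF i] by simp
    finally show "(\<integral>x. f x \<partial>P) = (\<integral>x. \<integral>y. f (?r (x, y)) \<partial>P \<partial>P)" .
  qed
  have vi: "v $ i = 1" using pos by (simp add: v_def)
  have ri: "?r (x, y) $ i = y $ i" for x y by (simp add: vi)
  have int1: "integrable P (\<lambda>x. x $ i * p x)"
  proof (rule integrable_poly_bound[where K=K and k="Suc m"])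
    fix x
    have "\<bar>x $ i\<bar> * \<bar>p x\<bar> \<le> (1 + norm x) * (K * (1 + norm x) ^ m)"
      using component_le_norm_cart[of x i] by (intro mult_mono b) auto
    then show "\<bar>x $ i * p x\<bar> \<le> K * (1 + norm x) ^ Suc m" by (simp add: abs_mult mult_ac)
  qed measurable
  have int2: "integrable P (p' j)" if "j \<in> J" for j
    using that b' by (intro integrable_poly_bound[where K=K and k=m]) (auto simp: J_def)
  obtain s where s: "0 \<le> s" "distr P borel (\<lambda>x. axis i 1 \<bullet> x) = normal_law 0 s"
    using centred_marginal by blast
  have law: "distr P borel (\<lambda>x. x $ i) = normal_law 0 s" using s(2) by (simp add: inner_axis')
  have s2: "s\<^sup>2 = S $ i $ i"
    unfolding normal_law_moments(3)[OF s(1), symmetric] law[symmetric] cov_nth[symmetric]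
    by (subst integral_distr) (simp_all add: power2_eq_square)
  with pos s(1) have "0 < s" by (cases "s = 0") auto
  have inner: "(\<integral>y. y $ i * p (?r (x, y)) \<partial>P) = (\<integral>y. (\<Sum>j\<in>J. S $ i $ j * p' j (?r (x, y))) \<partial>P)" for x
  proof -
    define w where "w = x - x $ i *\<^sub>R v"
    have rw: "?r (x, y) = w + y $ i *\<^sub>R v" for y by (simp add: w_def algebra_simps)
    define q' where "q' t = (\<Sum>j\<in>J. v $ j * p' j (w + t *\<^sub>R v))" for t
    have lin_cont: "continuous_on UNIV (\<lambda>t. w + t *\<^sub>R v)" by (intro continuous_intros)
    have bnd: "(1 + norm (w + t *\<^sub>R v)) ^ m \<le> (1 + norm w + norm v) ^ m * (1 + \<bar>t\<bar>) ^ m" for t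
    proof -
      have "1 + norm (w + t *\<^sub>R v) \<le> 1 + norm w + \<bar>t\<bar> * norm v"
        using norm_triangle_ineq[of w "t *\<^sub>R v"] by simp
      also have "\<dots> \<le> (1 + norm w + norm v) * (1 + \<bar>t\<bar>)" by (simp add: algebra_simps)
      finally show ?thesis unfolding power_mult_distrib[symmetric] by (intro power_mono) auto
    qed
    let ?K = "(1 + (\<Sum>j\<in>J. \<bar>v $ j\<bar>)) * (K * (1 + norm w + norm v) ^ m)"
    have "(\<integral>t. t * p (w + t *\<^sub>R v) \<partial>normal_law 0 s) = s\<^sup>2 * (\<integral>t. q' t \<partial>normal_law 0 s)"
    proof (rule normal_law_integration_by_parts[where K="?K" and m=m, OF \<open>0 < s\<close>])
      fix t
      have "((\<lambda>t. p (w + t *\<^sub>R v)) has_real_derivative (\<Sum>j\<in>J. v $ j * p' j (w + t *\<^sub>R v))) (at t)"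
      proof (rule has_derivative_along_curve)
        show "((\<lambda>t. (w + t *\<^sub>R v) $ j) has_real_derivative v $ j) (at t)" for j
          by (auto intro!: derivative_eq_intros)
        show "(w + t' *\<^sub>R v) $ j = (w + t *\<^sub>R v) $ j" if "j \<notin> J" for j t'
          using that by (simp add: J_def v_def)
      qed (use d cp' in \<open>auto simp: J_def\<close>)
      then show "((\<lambda>t. p (w + t *\<^sub>R v)) has_real_derivative q' t) (at t)" by (simp only: q'_def)
      have B: "K * (1 + norm (w + t *\<^sub>R v)) ^ m \<le> K * (1 + norm w + norm v) ^ m * (1 + \<bar>t\<bar>) ^ m"
        using mult_left_mono[OF bnd K] by (simp only: mult.assoc)
      have nn: "0 \<le> K * (1 + norm w + norm v) ^ m * (1 + \<bar>t\<bar>) ^ m" using K by simp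
      have "\<bar>p (w + t *\<^sub>R v)\<bar> \<le> 1 * (K * (1 + norm w + norm v) ^ m * (1 + \<bar>t\<bar>) ^ m)"
        using b[of "w + t *\<^sub>R v"] B by simp
      also have "\<dots> \<le> (1 + (\<Sum>j\<in>J. \<bar>v $ j\<bar>)) * (K * (1 + norm w + norm v) ^ m * (1 + \<bar>t\<bar>) ^ m)"
        by (intro mult_right_mono nn) (simp add: sum_nonneg)
      finally show "\<bar>p (w + t *\<^sub>R v)\<bar> \<le> ?K * (1 + \<bar>t\<bar>) ^ m" by (simp only: mult.assoc)
      have "\<bar>q' t\<bar> \<le> (\<Sum>j\<in>J. \<bar>v $ j * p' j (w + t *\<^sub>R v)\<bar>)" unfolding q'_def by (rule sum_abs)
      also have "\<dots> \<le> (\<Sum>j\<in>J. \<bar>v $ j\<bar> * (K * (1 + norm w + norm v) ^ m * (1 + \<bar>t\<bar>) ^ m))"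
        unfolding abs_mult using order_trans[OF b' B] by (intro sum_mono mult_left_mono) (auto simp: J_def)
      also have "\<dots> = (\<Sum>j\<in>J. \<bar>v $ j\<bar>) * (K * (1 + norm w + norm v) ^ m * (1 + \<bar>t\<bar>) ^ m)"
        by (rule sum_distrib_right[symmetric])
      also have "\<dots> \<le> (1 + (\<Sum>j\<in>J. \<bar>v $ j\<bar>)) * (K * (1 + norm w + norm v) ^ m * (1 + \<bar>t\<bar>) ^ m)"
        by (intro mult_right_mono nn) simp
      finally show "\<bar>q' t\<bar> \<le> ?K * (1 + \<bar>t\<bar>) ^ m" by (simp only: mult.assoc)
    next
      show "continuous_on UNIV q'"
        unfolding q'_def
        by (intro continuous_intros continuous_on_compose2[OF cp' lin_cont]) (auto simp: J_def)
    qed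
    moreover have "(\<integral>t. f t \<partial>normal_law 0 s) = (\<integral>y. f (y $ i) \<partial>P)" if "f \<in> borel_measurable borel" for f :: "real \<Rightarrow> real"
      unfolding law[symmetric] using that by (subst integral_distr) simp_all
    moreover have "q' \<in> borel_measurable borel" unfolding q'_def by measurable
    ultimately have "(\<integral>y. y $ i * p (w + y $ i *\<^sub>R v) \<partial>P) = s\<^sup>2 * (\<integral>y. q' (y $ i) \<partial>P)"
      by simp
    also have "\<dots> = (\<integral>y. s\<^sup>2 * q' (y $ i) \<partial>P)" by simp
    also have "\<dots> = (\<integral>y. (\<Sum>j\<in>J. S $ i $ j * p' j (w + y $ i *\<^sub>R v)) \<partial>P)"
      unfolding q'_def s2 v_def using pos by (simp add: sum_distrib_left)
    finally show ?thesis unfolding rw .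
  qed
  have "(\<integral>x. x $ i * p x \<partial>P) = (\<integral>x. \<integral>y. y $ i * p (?r (x, y)) \<partial>P \<partial>P)"
    using resample(2)[OF int1] unfolding ri .
  also have "\<dots> = (\<integral>x. \<integral>y. (\<Sum>j\<in>J. S $ i $ j * p' j (?r (x, y))) \<partial>P \<partial>P)"
    unfolding inner ..
  also have "\<dots> = (\<integral>x. (\<Sum>j\<in>J. S $ i $ j * p' j x) \<partial>P)"
    by (rule resample(2)[symmetric]) (intro Bochner_Integration.integrable_sum integrable_mult_right int2)
  also have "\<dots> = (\<Sum>j\<in>J. S $ i $ j * (\<integral>x. p' j x \<partial>P))"
    by (subst Bochner_Integration.integral_sum) (simp_all add: int2)
  finally show ?thesis unfolding J_def .
qed

end

section \<open>Local dependence\<close>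

text \<open>Extending a subvector by 0 moves it into the fixed space of all vectors, so that
  independence can be applied to functions of masked vectors without product spaces indexed by
  \<open>S\<close>.\<close>

lemma indep_subvectors_msk:
  fixes X :: "'a \<Rightarrow> real ^ 'n" and F H :: "real ^ 'n \<Rightarrow> real"
  assumes M: "prob_space M" and ind: "indep_subvectors M X S T"
    and [measurable]: "F \<in> borel_measurable borel" "H \<in> borel_measurable borel"
  shows "prob_space.indep_var M borel (\<lambda>\<omega>. F (msk S (X \<omega>))) borel (\<lambda>\<omega>. H (msk T (X \<omega>)))"
proof -
  interpret prob_space M by fact
  define e where "e R r = (\<chi> l. if l \<in> R then r l else 0)" for R :: "'n set" and r :: "'n \<Rightarrow> real"
  have [measurable]: "e R \<in> borel_measurable (Pi\<^sub>M R (\<lambda>_. borel))" for R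
  proof (subst borel_measurable_euclidean_space)
    show "\<forall>b\<in>Basis. (\<lambda>x. e R x \<bullet> b) \<in> borel_measurable (Pi\<^sub>M R (\<lambda>_. borel))"
    proof
      fix b :: "real ^ 'n" assume "b \<in> Basis"
      then obtain l where b: "b = axis l 1" by (auto simp: Basis_vec_def)
      have "e R r \<bullet> b = (if l \<in> R then r l else 0)" for r by (simp add: b inner_axis e_def)
      then show "(\<lambda>x. e R x \<bullet> b) \<in> borel_measurable (Pi\<^sub>M R (\<lambda>_. borel))"
        by (cases "l \<in> R") simp_all
    qed
  qed
  have "e R (restrict (\<lambda>l. X \<omega> $ l) R) = msk R (X \<omega>)" for R \<omega>
    by (simp add: e_def vec_eq_iff)
  then show ?thesis
    using indep_var_compose[OF ind[unfolded indep_subvectors_def],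
        of "\<lambda>r. F (e S r)" borel "\<lambda>r. H (e T r)" borel]
    by (simp add: o_def)
qed

lemma abs_prod3_le_mean_cubes:
  fixes a b d :: real
  shows "\<bar>a * b * d\<bar> \<le> (\<bar>a\<bar> ^ 3 + \<bar>b\<bar> ^ 3 + \<bar>d\<bar> ^ 3) / 3"
proof -
  have "x * y * z \<le> (x ^ 3 + y ^ 3 + z ^ 3) / 3" if "0 \<le> x" "0 \<le> y" "0 \<le> z" for x y z :: real
  proof -
    have "0 \<le> (x + y + z) * ((x - y)\<^sup>2 + (y - z)\<^sup>2 + (z - x)\<^sup>2)"
      using that by (intro mult_nonneg_nonneg add_nonneg_nonneg) auto
    also have "\<dots> = 2 * (x ^ 3 + y ^ 3 + z ^ 3 - 3 * (x * y * z))"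
      by (simp add: power2_eq_square power3_eq_cube algebra_simps)
    finally show ?thesis by simp
  qed
  from this[of "\<bar>a\<bar>" "\<bar>b\<bar>" "\<bar>d\<bar>"] show ?thesis by (simp add: abs_mult)
qed

text \<open>The inequality of arithmetic and geometric means takes the place of Hoelder's
  inequality; it is enough because the three moments are compared with one common bound
  \<open>a\<close>.\<close>

lemma (in prob_space)
  fixes f g h :: "'a \<Rightarrow> real"
  assumes [measurable]: "f \<in> borel_measurable M" "g \<in> borel_measurable M" "h \<in> borel_measurable M"
    and int: "integrable M (\<lambda>\<omega>. \<bar>f \<omega>\<bar> ^ 3)" "integrable M (\<lambda>\<omega>. \<bar>g \<omega>\<bar> ^ 3)" "integrable M (\<lambda>\<omega>. \<bar>h \<omega>\<bar> ^ 3)"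
  shows integrable_prod3: "integrable M (\<lambda>\<omega>. f \<omega> * g \<omega> * h \<omega>)"
    and expectation_prod3_le: "expectation (\<lambda>\<omega>. \<bar>f \<omega>\<bar> ^ 3) \<le> a \<Longrightarrow> expectation (\<lambda>\<omega>. \<bar>g \<omega>\<bar> ^ 3) \<le> a \<Longrightarrow>
      expectation (\<lambda>\<omega>. \<bar>h \<omega>\<bar> ^ 3) \<le> a \<Longrightarrow> expectation (\<lambda>\<omega>. \<bar>f \<omega> * g \<omega> * h \<omega>\<bar>) \<le> a"
proof -
  let ?m = "\<lambda>\<omega>. (\<bar>f \<omega>\<bar> ^ 3 + \<bar>g \<omega>\<bar> ^ 3 + \<bar>h \<omega>\<bar> ^ 3) / 3"
  have im: "integrable M ?m" using int by simp
  show fgh: "integrable M (\<lambda>\<omega>. f \<omega> * g \<omega> * h \<omega>)"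
  proof (rule Bochner_Integration.integrable_bound[OF im])
    show "AE \<omega> in M. norm (f \<omega> * g \<omega> * h \<omega>) \<le> norm (?m \<omega>)"
      unfolding real_norm_def using order_trans[OF abs_prod3_le_mean_cubes abs_ge_self] by (intro AE_I2)
  qed measurable
  have "expectation (\<lambda>\<omega>. \<bar>f \<omega> * g \<omega> * h \<omega>\<bar>) \<le> expectation ?m"
    by (rule integral_mono[OF integrable_abs[OF fgh] im abs_prod3_le_mean_cubes])
  also have "expectation ?m = (expectation (\<lambda>\<omega>. \<bar>f \<omega>\<bar> ^ 3) + expectation (\<lambda>\<omega>. \<bar>g \<omega>\<bar> ^ 3) + expectation (\<lambda>\<omega>. \<bar>h \<omega>\<bar> ^ 3)) / 3"
    using int by simp
  finally have mean: "expectation (\<lambda>\<omega>. \<bar>f \<omega> * g \<omega> * h \<omega>\<bar>)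
      \<le> (expectation (\<lambda>\<omega>. \<bar>f \<omega>\<bar> ^ 3) + expectation (\<lambda>\<omega>. \<bar>g \<omega>\<bar> ^ 3) + expectation (\<lambda>\<omega>. \<bar>h \<omega>\<bar> ^ 3)) / 3" .
  show "expectation (\<lambda>\<omega>. \<bar>f \<omega> * g \<omega> * h \<omega>\<bar>) \<le> a"
    if "expectation (\<lambda>\<omega>. \<bar>f \<omega>\<bar> ^ 3) \<le> a" "expectation (\<lambda>\<omega>. \<bar>g \<omega>\<bar> ^ 3) \<le> a" "expectation (\<lambda>\<omega>. \<bar>h \<omega>\<bar> ^ 3) \<le> a"
    by (rule order_trans[OF mean]) (use that in simp)
qed

text \<open>The last two assumptions say that a third derivative without a bound has weight 0 in
  both sums. \<open>g1_zero\<close> fits coordinates with \<open>i \<notin> A i\<close>: these are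
  almost surely 0, and \<open>g\<close> will be made constant in them.\<close>

locale local_dependence = prob_space M + cubic_fun g g1 g2 c ok
  for M :: "'a measure" and g :: "real ^ 'n \<Rightarrow> real" and g1 g2 c ok +
  fixes X :: "'a \<Rightarrow> real ^ 'n" and A :: "'n \<Rightarrow> 'n set" and B :: "'n \<Rightarrow> 'n \<Rightarrow> 'n set"
  assumes X [measurable]: "X \<in> borel_measurable M"
    and third: "\<And>i. integrable M (\<lambda>\<omega>. \<bar>X \<omega> $ i\<bar> ^ 3)"
    and centred: "\<And>i. (\<integral>\<omega>. X \<omega> $ i \<partial>M) = 0"
    and indA: "\<And>i. indep_subvectors M X (- A i) {i}"
    and A_le_B: "\<And>i j. j \<in> A i \<Longrightarrow> A i \<subseteq> B i j"
    and indB: "\<And>i j. j \<in> A i \<Longrightarrow> indep_subvectors M X (- B i j) {i, j}"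
    and g1_zero: "\<And>i x. i \<notin> A i \<Longrightarrow> g1 i x = 0"
    and ok_A: "\<And>i j. j \<in> A i \<Longrightarrow> ok i j i" "\<And>i j. j \<in> A i \<Longrightarrow> ok i j j"
    and vanish: "\<And>i j k. j \<in> A i \<Longrightarrow> k \<in> B i j \<Longrightarrow> \<not> ok i j k \<Longrightarrow>
      AE \<omega> in M. X \<omega> $ i * X \<omega> $ j * X \<omega> $ k = 0"
    and uncorrelated: "\<And>i j k. j \<in> A i \<Longrightarrow> k \<in> B i j \<Longrightarrow> \<not> ok i j k \<Longrightarrow>
      (\<integral>\<omega>. X \<omega> $ i * X \<omega> $ j \<partial>M) = 0"
begin

definition \<sigma> :: "'n \<Rightarrow> 'n \<Rightarrow> real" where
  "\<sigma> i j = (\<integral>\<omega>. X \<omega> $ i * X \<omega> $ j \<partial>M)"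

text \<open>Almost surely \<open>X\<close> takes values in this set (see \<open>vanish\<close>), on which a derivative without a
  bound is always multiplied by \<open>0\<close>.\<close>

definition good :: "real ^ 'n \<Rightarrow> bool" where
  "good x \<longleftrightarrow> (\<forall>i. \<forall>j\<in>A i. \<forall>k\<in>B i j. \<not> ok i j k \<longrightarrow> x $ i * x $ j * x $ k = 0)"

lemma AE_good: "AE \<omega> in M. good (X \<omega>)"
proof -
  have "\<forall>i. \<forall>j\<in>A i. \<forall>k\<in>B i j. AE \<omega> in M. \<not> ok i j k \<longrightarrow> X \<omega> $ i * X \<omega> $ j * X \<omega> $ k = 0"
  proof (intro allI ballI)
    fix i j k assume "j \<in> A i" "k \<in> B i j"
    then show "AE \<omega> in M. \<not> ok i j k \<longrightarrow> X \<omega> $ i * X \<omega> $ j * X \<omega> $ k = 0"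
      using vanish[of j i k] by (cases "ok i j k") auto
  qed
  then show ?thesis
    unfolding good_def by (simp only: AE_all_countable AE_ball_countable[OF countable_finite[OF finite]])
qed

lemma integrable_X_prod3: "integrable M (\<lambda>\<omega>. X \<omega> $ i * X \<omega> $ j * X \<omega> $ k)"
  by (rule integrable_prod3) (simp_all add: third)

lemma integrable_X_mult: "integrable M (\<lambda>\<omega>. X \<omega> $ i * X \<omega> $ j)"
  using integrable_prod3[of "\<lambda>\<omega>. X \<omega> $ i" "\<lambda>\<omega>. X \<omega> $ j" "\<lambda>_. 1"] by (simp add: third)

lemma integrable_X: "integrable M (\<lambda>\<omega>. X \<omega> $ i)"
  using integrable_prod3[of "\<lambda>\<omega>. X \<omega> $ i" "\<lambda>_. 1" "\<lambda>_. 1"] by (simp add: third)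

text \<open>Independence supplies integrability as well, since \<open>H (msk R (X \<omega>))\<close>
  is only known to be integrable by itself. Any \<open>R\<close> inside the complement is allowed
  because the domination argument works on arbitrary sets of coordinates.\<close>

lemma integrable_indep1:
  assumes [measurable]: "H \<in> borel_measurable borel" and i: "integrable M (\<lambda>\<omega>. H (msk R (X \<omega>)))"
    and R: "R \<subseteq> - A i"
  shows "integrable M (\<lambda>\<omega>. X \<omega> $ i * H (msk R (X \<omega>)))"
    and "(\<integral>\<omega>. X \<omega> $ i * H (msk R (X \<omega>)) \<partial>M) = 0"
proof -
  have RR: "msk R (msk (- A i) x) = msk R x" for x :: "real ^ 'n"
    using R by (simp add: msk_msk inf.absorb1)
  have ind: "indep_var borel (\<lambda>\<omega>. H (msk R (X \<omega>))) borel (\<lambda>\<omega>. X \<omega> $ i)"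
    using indep_subvectors_msk[OF prob_space_axioms indA, of "\<lambda>x. H (msk R x)" "\<lambda>x. x $ i" i] by (simp add: RR)
  show "integrable M (\<lambda>\<omega>. X \<omega> $ i * H (msk R (X \<omega>)))"
    using indep_var_integrable[OF ind i integrable_X] by (simp add: mult.commute)
  show "(\<integral>\<omega>. X \<omega> $ i * H (msk R (X \<omega>)) \<partial>M) = 0"
    using indep_var_lebesgue_integral[OF ind i integrable_X] by (simp add: mult.commute centred)
qed

lemma integrable_indep2:
  assumes [measurable]: "H \<in> borel_measurable borel" and i: "integrable M (\<lambda>\<omega>. H (msk R (X \<omega>)))"
    and j: "j \<in> A i" and R: "R \<subseteq> - B i j"
  shows "integrable M (\<lambda>\<omega>. X \<omega> $ i * X \<omega> $ j * H (msk R (X \<omega>)))"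
    and "(\<integral>\<omega>. X \<omega> $ i * X \<omega> $ j * H (msk R (X \<omega>)) \<partial>M) = \<sigma> i j * (\<integral>\<omega>. H (msk R (X \<omega>)) \<partial>M)"
proof -
  have RR: "msk R (msk (- B i j) x) = msk R x" for x :: "real ^ 'n"
    using R by (simp add: msk_msk inf.absorb1)
  have ind: "indep_var borel (\<lambda>\<omega>. H (msk R (X \<omega>))) borel (\<lambda>\<omega>. X \<omega> $ i * X \<omega> $ j)"
    using indep_subvectors_msk[OF prob_space_axioms indB[OF j], of "\<lambda>x. H (msk R x)" "\<lambda>x. x $ i * x $ j"]
    by (simp add: RR)
  show "integrable M (\<lambda>\<omega>. X \<omega> $ i * X \<omega> $ j * H (msk R (X \<omega>)))"
    using indep_var_integrable[OF ind i integrable_X_mult] by (simp add: mult.commute)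
  show "(\<integral>\<omega>. X \<omega> $ i * X \<omega> $ j * H (msk R (X \<omega>)) \<partial>M) = \<sigma> i j * (\<integral>\<omega>. H (msk R (X \<omega>)) \<partial>M)"
    using indep_var_lebesgue_integral[OF ind i integrable_X_mult] by (simp add: mult.commute \<sigma>_def)
qed

lemma \<sigma>_zero: "j \<notin> A i \<Longrightarrow> \<sigma> i j = 0"
proof -
  assume j: "j \<notin> A i"
  have "integrable M (\<lambda>\<omega>. msk {j} (X \<omega>) $ j)" using integrable_X by simp
  from integrable_indep1(2)[OF _ this, of i] j show ?thesis by (simp add: \<sigma>_def)
qed

text \<open>The Taylor remainders of switching off first \<open>A i\<close> and then
  \<open>B i j\<close> are at most \<open>u\<close> squared times half of \<open>W1\<close> and
  \<open>|u|\<close> times \<open>W2\<close>; their means are the third moment sums of the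
  claim.\<close>

definition W1 :: "'n \<Rightarrow> real ^ 'n \<Rightarrow> real" where
  "W1 i x = (\<Sum>j\<in>A i. \<Sum>k\<in>A i. c i j k * \<bar>x $ i * x $ j * x $ k\<bar>)"

definition W2 :: "'n \<Rightarrow> 'n \<Rightarrow> real ^ 'n \<Rightarrow> real" where
  "W2 i j x = (\<Sum>k\<in>B i j. c i j k * \<bar>x $ i * x $ j * x $ k\<bar>)"

lemma W_nonneg: "0 \<le> W1 i x" "0 \<le> W2 i j x"
  unfolding W1_def W2_def by (intro sum_nonneg mult_nonneg_nonneg c_nonneg abs_ge_zero)+

lemma W_measurable [measurable]: "W1 i \<in> borel_measurable borel" "W2 i j \<in> borel_measurable borel"
  unfolding W1_def W2_def by measurable

lemma integrable_abs_prod_msk: "integrable M (\<lambda>\<omega>. \<bar>msk S (X \<omega>) $ i * msk S (X \<omega>) $ j * msk S (X \<omega>) $ k\<bar>)"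
proof (cases "i \<in> S \<and> j \<in> S \<and> k \<in> S")
  case True
  then show ?thesis using integrable_abs[OF integrable_X_prod3[of i j k]] by simp
next
  case False
  then have "(\<lambda>\<omega>. \<bar>msk S (X \<omega>) $ i * msk S (X \<omega>) $ j * msk S (X \<omega>) $ k\<bar>) = (\<lambda>_. 0)" by auto
  then show ?thesis by (simp only: integrable_zero)
qed

lemma integrable_W_msk: "integrable M (\<lambda>\<omega>. W1 i (msk S (X \<omega>)))" "integrable M (\<lambda>\<omega>. W2 i j (msk S (X \<omega>)))"
  unfolding W1_def W2_def
  by (intro Bochner_Integration.integrable_sum integrable_mult_right integrable_abs_prod_msk)+

lemma integrable_W: "integrable M (\<lambda>\<omega>. W1 i (X \<omega>))" "integrable M (\<lambda>\<omega>. W2 i j (X \<omega>))"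
  using integrable_W_msk(1)[where S=UNIV] integrable_W_msk(2)[where S=UNIV] by simp_all

text \<open>The factor \<open>x $ i\<close> stays inside because \<open>good\<close> speaks of
  triple products only: where \<open>x $ i\<close>, \<open>x $ j\<close> and \<open>x $ k\<close>
  are all nonzero, \<open>ok i j k\<close> follows, and elsewhere either the step is not taken or
  the whole term is 0.\<close>

lemma expansion1:
  assumes gd: "good x"
  shows "\<bar>x $ i * (g1 i (u *\<^sub>R x + a) - g1 i (u *\<^sub>R msk (- A i) x + a)
     - (\<Sum>j\<in>A i. u * x $ j * g2 i j (u *\<^sub>R msk (- A i) x + a)))\<bar> \<le> u\<^sup>2 * W1 i x / 2"
proof (cases "x $ i = 0")
  case False
  let ?b = "u *\<^sub>R msk (- A i) x + a"
  have eq: "u *\<^sub>R x + a = ?b + msk (A i) (u *\<^sub>R x)"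
    by (auto simp: vec_eq_iff)
  have "\<bar>g1 i (?b + msk (A i) (u *\<^sub>R x)) - g1 i ?b - (\<Sum>j\<in>A i. (u *\<^sub>R x) $ j * g2 i j ?b)\<bar>
       \<le> (\<Sum>j\<in>A i. \<Sum>k\<in>A i. c i j k * \<bar>(u *\<^sub>R x) $ j * (u *\<^sub>R x) $ k\<bar>) / 2"
  proof (rule stepwise_taylor)
    fix j k y t assume jk: "j \<in> A i" "k \<in> A i" "(u *\<^sub>R x) $ j * (u *\<^sub>R x) $ k \<noteq> 0"
    then have "x $ i * x $ j * x $ k \<noteq> 0" using False by simp
    then have "ok i j k" using gd jk A_le_B[OF jk(1)] unfolding good_def by blast
    then show "\<bar>g2 i j (y + t *\<^sub>R axis k 1) - g2 i j y\<bar> \<le> c i j k * \<bar>t\<bar>" by (rule lip)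
  qed (use d2 c_sym in auto)
  from mult_left_mono[OF this abs_ge_zero[of "x $ i"]]
  have "\<bar>x $ i * (g1 i (u *\<^sub>R x + a) - g1 i ?b - (\<Sum>j\<in>A i. u * x $ j * g2 i j ?b))\<bar>
     \<le> \<bar>x $ i\<bar> * ((\<Sum>j\<in>A i. \<Sum>k\<in>A i. c i j k * \<bar>(u *\<^sub>R x) $ j * (u *\<^sub>R x) $ k\<bar>) / 2)"
    unfolding eq by (simp add: abs_mult)
  also have "\<dots> = u\<^sup>2 * W1 i x / 2"
    unfolding W1_def sum_distrib_left sum_divide_distrib
    by (intro sum.cong refl) (simp add: abs_mult power2_eq_square mult_ac)
  finally show ?thesis .
qed (simp add: W_nonneg)

lemma expansion2:
  assumes gd: "good x" and j: "j \<in> A i"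
  shows "\<bar>x $ i * x $ j * (g2 i j (u *\<^sub>R msk (- A i) x + a) - g2 i j (u *\<^sub>R msk (- B i j) x + a))\<bar>
     \<le> \<bar>u\<bar> * W2 i j x"
proof (cases "x $ i * x $ j = 0")
  case False
  let ?b = "u *\<^sub>R msk (- B i j) x + a"
  have eq: "u *\<^sub>R msk (- A i) x + a = ?b + msk (B i j) (u *\<^sub>R msk (- A i) x)"
    using A_le_B[OF j] by (auto simp: vec_eq_iff)
  have "\<bar>g2 i j (?b + msk (B i j) (u *\<^sub>R msk (- A i) x)) - g2 i j ?b\<bar>
      \<le> (\<Sum>k\<in>B i j. c i j k * \<bar>(u *\<^sub>R msk (- A i) x) $ k\<bar>)"
  proof (rule stepwise_lipschitz)
    fix k y t assume k: "k \<in> B i j" "(u *\<^sub>R msk (- A i) x) $ k \<noteq> 0"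
    then have "x $ i * x $ j * x $ k \<noteq> 0" using False by (auto split: if_splits)
    then have "ok i j k" using gd j k unfolding good_def by blast
    then show "\<bar>g2 i j (y + t *\<^sub>R axis k 1) - g2 i j y\<bar> \<le> c i j k * \<bar>t\<bar>" by (rule lip)
  qed
  also have "\<dots> \<le> (\<Sum>k\<in>B i j. c i j k * (\<bar>u\<bar> * \<bar>x $ k\<bar>))"
    by (intro sum_mono mult_left_mono c_nonneg) (simp add: abs_mult)
  finally have "\<bar>x $ i * x $ j\<bar> * \<bar>g2 i j (u *\<^sub>R msk (- A i) x + a) - g2 i j ?b\<bar>
     \<le> \<bar>x $ i * x $ j\<bar> * (\<Sum>k\<in>B i j. c i j k * (\<bar>u\<bar> * \<bar>x $ k\<bar>))"
    unfolding eq by (intro mult_left_mono) auto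
  also have "\<dots> = \<bar>u\<bar> * W2 i j x"
    unfolding W2_def sum_distrib_left by (intro sum.cong refl) (simp add: abs_mult mult_ac)
  finally show ?thesis by (simp add: abs_mult)
next
  case True
  show ?thesis unfolding True using W_nonneg(2)[of i j x] by simp
qed


text \<open>Here no factor \<open>x $ i * x $ j\<close> is present, since the covariance is already
  an expectation. The Lipschitz bounds come from \<open>uncorrelated\<close> instead of
  \<open>good\<close>.\<close>

lemma expansion3:
  assumes j: "j \<in> A i" and nz: "\<sigma> i j \<noteq> 0"
  shows "\<bar>g2 i j (u *\<^sub>R x + a) - g2 i j (u *\<^sub>R msk (- B i j) x + a)\<bar> \<le> \<bar>u\<bar> * (\<Sum>k\<in>B i j. c i j k * \<bar>x $ k\<bar>)"
proof -
  let ?b = "u *\<^sub>R msk (- B i j) x + a"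
  have eq: "u *\<^sub>R x + a = ?b + msk (B i j) (u *\<^sub>R x)"
    by (auto simp: vec_eq_iff)
  have "\<bar>g2 i j (?b + msk (B i j) (u *\<^sub>R x)) - g2 i j ?b\<bar> \<le> (\<Sum>k\<in>B i j. c i j k * \<bar>(u *\<^sub>R x) $ k\<bar>)"
  proof (rule stepwise_lipschitz)
    fix k y t assume k: "k \<in> B i j"
    have "ok i j k" using uncorrelated[OF j k] nz unfolding \<sigma>_def by blast
    then show "\<bar>g2 i j (y + t *\<^sub>R axis k 1) - g2 i j y\<bar> \<le> c i j k * \<bar>t\<bar>" by (rule lip)
  qed
  also have "\<dots> = \<bar>u\<bar> * (\<Sum>k\<in>B i j. c i j k * \<bar>x $ k\<bar>)"
    unfolding sum_distrib_left by (intro sum.cong refl) (simp add: abs_mult mult_ac)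
  finally show ?thesis unfolding eq .
qed

text \<open>All values of \<open>g1\<close> and \<open>g2\<close> on the right are at points from
  which \<open>A i\<close> or \<open>B i j\<close> has been removed, hence independent of their
  prefactors; \<open>W1\<close> and \<open>W2\<close> are integrable by third moments alone.\<close>

lemma expansion_bound:
  assumes gd: "good x" and u: "\<bar>u\<bar> \<le> 1"
  shows "\<bar>x $ i * g1 i (u *\<^sub>R x + a)\<bar> \<le> \<bar>x $ i\<bar> * \<bar>g1 i (u *\<^sub>R msk (- A i) x + a)\<bar>
     + (\<Sum>j\<in>A i. \<bar>x $ i * x $ j\<bar> * \<bar>g2 i j (u *\<^sub>R msk (- B i j) x + a)\<bar> + W2 i j x) + W1 i x"
proof -
  let ?a = "u *\<^sub>R msk (- A i) x + a" and ?b = "\<lambda>j. u *\<^sub>R msk (- B i j) x + a"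
  have u2: "u\<^sup>2 \<le> 1" using u by (simp add: abs_square_le_1)
  have "\<bar>x $ i * x $ j * g2 i j ?a\<bar> \<le> \<bar>x $ i * x $ j\<bar> * \<bar>g2 i j (?b j)\<bar> + W2 i j x" if "j \<in> A i" for j
  proof -
    have "x $ i * x $ j * g2 i j ?a = x $ i * x $ j * g2 i j (?b j) + x $ i * x $ j * (g2 i j ?a - g2 i j (?b j))"
      by (simp add: algebra_simps)
    moreover have "\<bar>u\<bar> * W2 i j x \<le> 1 * W2 i j x" using u by (intro mult_right_mono W_nonneg)
    ultimately show ?thesis
      using expansion2[OF gd that, of u a] abs_triangle_ineq[of "x $ i * x $ j * g2 i j (?b j)"
          "x $ i * x $ j * (g2 i j ?a - g2 i j (?b j))"] by (simp add: abs_mult)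
  qed
  note g2b = this
  have "\<bar>x $ i * (\<Sum>j\<in>A i. u * x $ j * g2 i j ?a)\<bar> = \<bar>u\<bar> * \<bar>\<Sum>j\<in>A i. x $ i * x $ j * g2 i j ?a\<bar>"
    by (simp add: abs_mult[symmetric] sum_distrib_left mult_ac)
  also have "\<dots> \<le> 1 * \<bar>\<Sum>j\<in>A i. x $ i * x $ j * g2 i j ?a\<bar>" using u by (intro mult_right_mono) auto
  also have "\<dots> \<le> (\<Sum>j\<in>A i. \<bar>x $ i * x $ j * g2 i j ?a\<bar>)" using sum_abs by simp
  also have "\<dots> \<le> (\<Sum>j\<in>A i. \<bar>x $ i * x $ j\<bar> * \<bar>g2 i j (?b j)\<bar> + W2 i j x)"
    by (intro sum_mono g2b)
  finally have 2: "\<bar>x $ i * (\<Sum>j\<in>A i. u * x $ j * g2 i j ?a)\<bar>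
      \<le> (\<Sum>j\<in>A i. \<bar>x $ i * x $ j\<bar> * \<bar>g2 i j (?b j)\<bar> + W2 i j x)" .
  have "u\<^sup>2 * W1 i x / 2 \<le> 1 * W1 i x" using mult_right_mono[OF u2 W_nonneg(1)[of i x]] W_nonneg(1)[of i x] by simp
  then have 1: "\<bar>x $ i * (g1 i (u *\<^sub>R x + a) - g1 i ?a - (\<Sum>j\<in>A i. u * x $ j * g2 i j ?a))\<bar> \<le> W1 i x"
    using expansion1[OF gd, of i u a] by simp
  have eq: "x $ i * g1 i (u *\<^sub>R x + a) = x $ i * g1 i ?a + x $ i * (\<Sum>j\<in>A i. u * x $ j * g2 i j ?a)
     + x $ i * (g1 i (u *\<^sub>R x + a) - g1 i ?a - (\<Sum>j\<in>A i. u * x $ j * g2 i j ?a))"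
    by (simp add: algebra_simps)
  have 3: "\<bar>p + q + r\<bar> \<le> \<bar>p\<bar> + Y + Z" if "\<bar>q\<bar> \<le> Y" "\<bar>r\<bar> \<le> Z" for p q r Y Z :: real
    using that by linarith
  show ?thesis unfolding eq by (rule order_trans[OF 3[OF 2 1]]) (simp add: abs_mult)
qed

section \<open>Integrable dominating functions\<close>

lemma good_msk: "good x \<Longrightarrow> good (msk S x)"
  unfolding good_def by auto

text \<open>The polynomial factor \<open>Q a\<close> allows a later integration over a Gaussian shift \<open>a\<close>.\<close>

definition dominates :: "'n set \<Rightarrow> (real ^ 'n \<Rightarrow> real) \<Rightarrow> bool" where
  "dominates S G \<longleftrightarrow> G \<in> borel_measurable borel \<and> (\<forall>x. 0 \<le> G x) \<and> integrable M (\<lambda>\<omega>. G (msk S (X \<omega>))) \<and>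
     (\<forall>x u a. good x \<longrightarrow> \<bar>u\<bar> \<le> 1 \<longrightarrow> \<bar>g (u *\<^sub>R msk S x + a)\<bar> \<le> Q a * G (msk S x))"

lemma dominatesD:
  assumes "dominates S G"
  shows "G \<in> borel_measurable borel" "\<And>x. 0 \<le> G x" "integrable M (\<lambda>\<omega>. G (msk S (X \<omega>)))"
    "\<And>x u a. good x \<Longrightarrow> \<bar>u\<bar> \<le> 1 \<Longrightarrow> \<bar>g (u *\<^sub>R msk S x + a)\<bar> \<le> Q a * G (msk S x)"
  using assms unfolding dominates_def by auto

text \<open>A unit shift is absorbed into the argument \<open>a\<close>, one reason for demanding
  domination for all \<open>a\<close>.\<close>

lemma dominates_shift:
  assumes D: "dominates S G" and "good x" "\<bar>u\<bar> \<le> 1" "\<bar>t\<bar> \<le> 1"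
  shows "\<bar>g (u *\<^sub>R msk S x + a + t *\<^sub>R axis i 1)\<bar> \<le> 8 * (Q a * G (msk S x))"
proof -
  have "\<bar>g (u *\<^sub>R msk S x + (a + t *\<^sub>R axis i 1))\<bar> \<le> Q (a + t *\<^sub>R axis i 1) * G (msk S x)"
    by (rule dominatesD(4)[OF D]) fact+
  also have "\<dots> \<le> 8 * Q a * G (msk S x)"
    using assms dominatesD(2)[OF D] by (intro mult_right_mono Q_shift)
  finally show ?thesis by (simp add: add.assoc)
qed

lemma dominates_g1:
  assumes D: "dominates S G" and gd: "good x" and u: "\<bar>u\<bar> \<le> 1"
  shows "\<bar>g1 i (u *\<^sub>R msk S x + a)\<bar> \<le> Q a * (16 * G (msk S x) + c i i i)"
proof -
  let ?y = "u *\<^sub>R msk S x + a"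
  have "\<bar>g1 i ?y\<bar> \<le> 8 * (Q a * G (msk S x)) + 8 * (Q a * G (msk S x)) + c i i i"
    using g1_le_g[of i ?y] dominates_shift[OF D gd u, of 1 a i] dominates_shift[OF D gd u, of "-1" a i] by simp
  also have "c i i i \<le> Q a * c i i i" using mult_right_mono[OF Q_ge_1[of a] c_nonneg[of i i i]] by simp
  finally show ?thesis by (simp add: algebra_simps)
qed

text \<open>Unit shifts multiply \<open>Q\<close> by 8. Of the four values in the mixed difference
  one is shifted twice, two once and one not at all, and 81 = 64 + 8 + 8 + 1.\<close>

lemma dominates_g2:
  assumes D: "dominates S G" and gd: "good x" and u: "\<bar>u\<bar> \<le> 1" and j: "j \<in> A i"
  shows "\<bar>g2 i j (u *\<^sub>R msk S x + a)\<bar> \<le> Q a * (81 * G (msk S x) + (c i j i + c i j j))"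
proof -
  let ?y = "u *\<^sub>R msk S x + a" and ?G = "G (msk S x)"
  have "\<bar>g (?y + 1 *\<^sub>R axis i 1 + 1 *\<^sub>R axis j 1)\<bar> \<le> 8 * (Q (a + 1 *\<^sub>R axis i 1) * ?G)"
    using dominates_shift[OF D gd u, of 1 "a + 1 *\<^sub>R axis i 1" j] by (simp add: add.assoc)
  also have "\<dots> \<le> 8 * ((8 * Q a) * ?G)"
    by (intro mult_left_mono mult_right_mono Q_shift dominatesD(2)[OF D]) auto
  finally have "\<bar>g2 i j ?y\<bar> \<le> 64 * (Q a * ?G) + 8 * (Q a * ?G) + 8 * (Q a * ?G) + Q a * ?G + (c i j i + c i j j)"
    using g2_le_g[OF ok_A[OF j], of ?y] dominates_shift[OF D gd u, of 1 a i] dominates_shift[OF D gd u, of 1 a j]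
      dominatesD(4)[OF D gd u, of a] by linarith
  also have "c i j i + c i j j \<le> Q a * (c i j i + c i j j)"
    using mult_right_mono[OF Q_ge_1[of a], of "c i j i + c i j j"] c_nonneg[of i j i] c_nonneg[of i j j] by simp
  finally show ?thesis by (simp add: algebra_simps)
qed

lemma derivative_along_segment:
  "((\<lambda>s. g (s *\<^sub>R y + a)) has_real_derivative (\<Sum>i\<in>UNIV. y $ i * g1 i (s *\<^sub>R y + a))) (at s)"
  by (rule has_derivative_along_curve[OF d1 continuous_g1]) (auto intro!: derivative_eq_intros)

text \<open>The inductive step of the domination. A dominating function of \<open>g\<close> times
  |x_i| need not be integrable, so the product is expanded first. Then only dominating functions on
  \<open>S - A i\<close> and \<open>S - B i j\<close> are multiplied by x_i and x_i x_j, and these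
  are independent of them.\<close>

lemma dominated_product:
  assumes i: "i \<in> S" and GA: "\<exists>G. dominates (S - A i) G"
    and GB: "\<And>j. j \<in> A i \<Longrightarrow> \<exists>G. dominates (S - B i j) G"
  shows "\<exists>V. V \<in> borel_measurable borel \<and> (\<forall>x. 0 \<le> V x) \<and> integrable M (\<lambda>\<omega>. V (msk S (X \<omega>))) \<and>
     (\<forall>x u a. good x \<longrightarrow> \<bar>u\<bar> \<le> 1 \<longrightarrow> \<bar>msk S x $ i * g1 i (u *\<^sub>R msk S x + a)\<bar> \<le> Q a * V (msk S x))"
proof -
  from GA obtain GA where GA: "dominates (S - A i) GA" by blast
  have "\<forall>j. \<exists>G. j \<in> A i \<longrightarrow> dominates (S - B i j) G" using GB by blast
  from choice[OF this] obtain GB where GB: "\<And>j. j \<in> A i \<Longrightarrow> dominates (S - B i j) (GB j)" by blast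
  define HA where "HA z = 16 * GA z + c i i i" for z
  define HB where "HB j z = 81 * GB j z + (c i j i + c i j j)" for j z
  have HA [measurable]: "HA \<in> borel_measurable borel"
    unfolding HA_def using dominatesD(1)[OF GA] by measurable
  have HB: "HB j \<in> borel_measurable borel" if "j \<in> A i" for j
    unfolding HB_def using dominatesD(1)[OF GB[OF that]] by measurable
  have H_nonneg: "0 \<le> HA z" "j \<in> A i \<Longrightarrow> 0 \<le> HB j z" for j z
    using dominatesD(2)[OF GA] dominatesD(2)[OF GB] c_nonneg
    unfolding HA_def HB_def by (auto intro!: add_nonneg_nonneg)
  define U1 where "U1 y = \<bar>y $ i\<bar> * HA (msk (S - A i) y)" for y
  define U2 where "U2 j y = \<bar>y $ i * y $ j\<bar> * HB j (msk (S - B i j) y)" for j y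
  define V where "V y = U1 y + (\<Sum>j\<in>A i. U2 j y + W2 i j y) + W1 i y" for y
  show ?thesis
  proof (intro exI[of _ V] conjI allI impI)
    have "U1 \<in> borel_measurable borel" unfolding U1_def by measurable
    moreover have "U2 j \<in> borel_measurable borel" if "j \<in> A i" for j
      unfolding U2_def using HB[OF that] by measurable
    ultimately show "V \<in> borel_measurable borel"
      unfolding V_def by (intro borel_measurable_add borel_measurable_sum W_measurable) auto
    show "0 \<le> V x" for x
      unfolding V_def U1_def U2_def
      by (intro add_nonneg_nonneg sum_nonneg mult_nonneg_nonneg abs_ge_zero H_nonneg W_nonneg) auto
    have mm: "msk (S - R) (msk S (X \<omega>)) = msk (S - R) (X \<omega>)" for R \<omega>
      by (simp add: msk_msk inf.absorb1)
    have "integrable M (\<lambda>\<omega>. U1 (msk S (X \<omega>)))"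
    proof -
      let ?R = "S - A i"
      have "integrable M (\<lambda>\<omega>. HA (msk ?R (X \<omega>)))"
        using dominatesD(3)[OF GA] unfolding HA_def
        by (intro Bochner_Integration.integrable_add integrable_mult_right integrable_const)
      from integrable_abs[OF integrable_indep1(1)[OF HA this, of i]]
      have "integrable M (\<lambda>\<omega>. \<bar>X \<omega> $ i * HA (msk ?R (X \<omega>))\<bar>)" by auto
      moreover have "\<bar>X \<omega> $ i * HA (msk ?R (X \<omega>))\<bar> = U1 (msk S (X \<omega>))" for \<omega>
        using i H_nonneg(1) by (simp add: U1_def mm abs_mult)
      ultimately show ?thesis by simp
    qed
    moreover have "integrable M (\<lambda>\<omega>. U2 j (msk S (X \<omega>)))" if j: "j \<in> A i" for j
    proof (cases "j \<in> S")
      case True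
      let ?R = "S - B i j"
      have "integrable M (\<lambda>\<omega>. HB j (msk ?R (X \<omega>)))"
        using dominatesD(3)[OF GB[OF j]] unfolding HB_def
        by (intro Bochner_Integration.integrable_add integrable_mult_right integrable_const)
      from integrable_abs[OF integrable_indep2(1)[OF HB[OF j] this j]]
      have "integrable M (\<lambda>\<omega>. \<bar>X \<omega> $ i * X \<omega> $ j * HB j (msk ?R (X \<omega>))\<bar>)" by auto
      moreover have "\<bar>X \<omega> $ i * X \<omega> $ j * HB j (msk ?R (X \<omega>))\<bar> = U2 j (msk S (X \<omega>))" for \<omega>
        using i True H_nonneg(2)[OF j] by (simp add: U2_def mm abs_mult)
      ultimately show ?thesis by simp
    qed (simp add: U2_def)
    ultimately show "integrable M (\<lambda>\<omega>. V (msk S (X \<omega>)))"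
      unfolding V_def
      by (intro Bochner_Integration.integrable_add Bochner_Integration.integrable_sum integrable_W_msk) auto
    fix x u a assume x: "good x" and u: "\<bar>u :: real\<bar> \<le> 1"
    define y where "y = msk S x"
    have y: "good y" "msk S y = y" using x by (simp_all add: y_def good_msk msk_msk)
    have m: "msk (- R) y = msk (S - R) y" for R
      using y(2) by (metis Diff_eq inf_commute msk_msk)
    have "\<bar>y $ i\<bar> * \<bar>g1 i (u *\<^sub>R msk (- A i) y + a)\<bar> \<le> \<bar>y $ i\<bar> * (Q a * HA (msk (S - A i) y))"
      unfolding m HA_def by (intro mult_left_mono dominates_g1 GA y u) auto
    then have 1: "\<bar>y $ i\<bar> * \<bar>g1 i (u *\<^sub>R msk (- A i) y + a)\<bar> \<le> Q a * U1 y"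
      by (simp add: U1_def mult_ac)
    have W: "W1 i y \<le> Q a * W1 i y" "W2 i j y \<le> Q a * W2 i j y" for j
      using mult_right_mono[OF Q_ge_1 W_nonneg(1)] mult_right_mono[OF Q_ge_1 W_nonneg(2)] by (metis mult_1)+
    have 2: "(\<Sum>j\<in>A i. \<bar>y $ i * y $ j\<bar> * \<bar>g2 i j (u *\<^sub>R msk (- B i j) y + a)\<bar> + W2 i j y)
        \<le> (\<Sum>j\<in>A i. Q a * (U2 j y + W2 i j y))"
    proof (rule sum_mono)
      fix j assume j: "j \<in> A i"
      have "\<bar>y $ i * y $ j\<bar> * \<bar>g2 i j (u *\<^sub>R msk (- B i j) y + a)\<bar>
        \<le> \<bar>y $ i * y $ j\<bar> * (Q a * HB j (msk (S - B i j) y))"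
        unfolding m HB_def by (intro mult_left_mono dominates_g2 GB j y u) auto
      then have "\<bar>y $ i * y $ j\<bar> * \<bar>g2 i j (u *\<^sub>R msk (- B i j) y + a)\<bar> \<le> Q a * U2 j y"
        by (simp add: U2_def mult_ac)
      then show "\<bar>y $ i * y $ j\<bar> * \<bar>g2 i j (u *\<^sub>R msk (- B i j) y + a)\<bar> + W2 i j y
          \<le> Q a * (U2 j y + W2 i j y)"
        unfolding distrib_left using W(2)[of j] by linarith
    qed
    show "\<bar>msk S x $ i * g1 i (u *\<^sub>R msk S x + a)\<bar> \<le> Q a * V (msk S x)"
      unfolding y_def[symmetric] V_def distrib_left sum_distrib_left
      using expansion_bound[OF y(1) u, of i a] 1 2 W(1) by (simp only: distrib_left)
  qed
qed

text \<open>Induction on \<open>S\<close>: the increment of \<open>g\<close> along a segment consists of terms \<open>x\<^sub>i g\<^sub>i\<close>, and switching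
  off \<open>A\<^sub>i\<close> and \<open>B\<^sub>i\<^sub>j\<close> leaves functions of strictly fewer coordinates that are independent of their
  prefactors.\<close>

lemma ex_dominating: "\<exists>G. dominates S G"
proof -
  have "finite S" by simp
  then show ?thesis
  proof (induction S rule: finite_psubset_induct)
    case (psubset S)
    obtain K where K: "K \<ge> 0" "\<And>x. \<bar>g x\<bar> \<le> K * Q x" using polynomial_growth by blast
    \<comment> \<open>Indices with \<open>i \<notin> A i\<close> contribute nothing by
      \<open>g1_zero\<close>. For the others, removing \<open>A i\<close> or a \<open>B i j\<close>
      containing it removes \<open>i\<close>, so the sets shrink strictly.\<close>
    define T where "T = {i \<in> S. i \<in> A i}"
    have "\<forall>i. \<exists>V. i \<in> T \<longrightarrow> V \<in> borel_measurable borel \<and> (\<forall>x. 0 \<le> V x) \<and> integrable M (\<lambda>\<omega>. V (msk S (X \<omega>))) \<and>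
     (\<forall>x u a. good x \<longrightarrow> \<bar>u\<bar> \<le> 1 \<longrightarrow> \<bar>msk S x $ i * g1 i (u *\<^sub>R msk S x + a)\<bar> \<le> Q a * V (msk S x))"
    proof
      fix i
      show "\<exists>V. i \<in> T \<longrightarrow> V \<in> borel_measurable borel \<and> (\<forall>x. 0 \<le> V x) \<and> integrable M (\<lambda>\<omega>. V (msk S (X \<omega>))) \<and>
        (\<forall>x u a. good x \<longrightarrow> \<bar>u\<bar> \<le> 1 \<longrightarrow> \<bar>msk S x $ i * g1 i (u *\<^sub>R msk S x + a)\<bar> \<le> Q a * V (msk S x))"
      proof (cases "i \<in> T")
        case True
        then have "i \<in> S" "S - A i \<subset> S" "\<And>j. j \<in> A i \<Longrightarrow> S - B i j \<subset> S"
          using A_le_B[of _ i] by (auto simp: T_def)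
        from dominated_product[OF this(1) psubset.IH[OF this(2)] psubset.IH[OF this(3)]]
        show ?thesis by blast
      qed simp
    qed
    from choice[OF this] obtain V where V: "\<And>i. i \<in> T \<Longrightarrow> V i \<in> borel_measurable borel" "\<And>i x. i \<in> T \<Longrightarrow> 0 \<le> V i x"
      "\<And>i. i \<in> T \<Longrightarrow> integrable M (\<lambda>\<omega>. V i (msk S (X \<omega>)))"
      "\<And>i x u a. i \<in> T \<Longrightarrow> good x \<Longrightarrow> \<bar>u\<bar> \<le> 1 \<Longrightarrow> \<bar>msk S x $ i * g1 i (u *\<^sub>R msk S x + a)\<bar> \<le> Q a * V i (msk S x)"
      by blast
    define G where "G y = K + (\<Sum>i\<in>T. V i y)" for y
    have "dominates S G"
      unfolding dominates_def
    proof (intro conjI allI impI)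
      show "G \<in> borel_measurable borel"
        unfolding G_def by (intro borel_measurable_add borel_measurable_sum borel_measurable_const V)
      show "0 \<le> G x" for x
        unfolding G_def by (intro add_nonneg_nonneg sum_nonneg K V)
      show "integrable M (\<lambda>\<omega>. G (msk S (X \<omega>)))"
        unfolding G_def
        by (intro Bochner_Integration.integrable_add Bochner_Integration.integrable_sum integrable_const V)
      fix x u a assume x: "good x" and u: "\<bar>u :: real\<bar> \<le> 1"
      let ?y = "msk S x"
      \<comment> \<open>Mean value theorem on the segment that starts at \<open>a\<close>. The
        intermediate parameter only rescales \<open>u\<close> within [-1, 1], which the uniformity
        of the bounds in \<open>u\<close> absorbs.\<close>
      define f where "f s = g (s *\<^sub>R (u *\<^sub>R ?y) + a)" for s
      obtain s where s: "0 < s" "s < 1"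
        "f 1 - f 0 = (1 - 0) * (\<Sum>i\<in>UNIV. (u *\<^sub>R ?y) $ i * g1 i (s *\<^sub>R (u *\<^sub>R ?y) + a))"
        using MVT2[of 0 1 f "\<lambda>s. \<Sum>i\<in>UNIV. (u *\<^sub>R ?y) $ i * g1 i (s *\<^sub>R (u *\<^sub>R ?y) + a)"]
          derivative_along_segment[of "u *\<^sub>R ?y" a] unfolding f_def by auto
      have su: "\<bar>s * u\<bar> \<le> 1" using s u mult_mono[of "\<bar>s\<bar>" 1 "\<bar>u\<bar>" 1] by (simp add: abs_mult)
      have "f 1 - f 0 = u * (\<Sum>i\<in>UNIV. ?y $ i * g1 i ((s * u) *\<^sub>R ?y + a))"
        using s(3) by (simp add: sum_distrib_left mult.assoc del: msk_nth)
      also have "(\<Sum>i\<in>UNIV. ?y $ i * g1 i ((s * u) *\<^sub>R ?y + a)) = (\<Sum>i\<in>T. ?y $ i * g1 i ((s * u) *\<^sub>R ?y + a))"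
        by (rule sum.mono_neutral_right) (auto simp: T_def g1_zero)
      finally have "\<bar>f 1 - f 0\<bar> = \<bar>u\<bar> * \<bar>\<Sum>i\<in>T. ?y $ i * g1 i ((s * u) *\<^sub>R ?y + a)\<bar>"
        by (simp only: abs_mult)
      also have "\<dots> \<le> 1 * \<bar>\<Sum>i\<in>T. ?y $ i * g1 i ((s * u) *\<^sub>R ?y + a)\<bar>"
        using u by (intro mult_right_mono) auto
      also have "\<dots> \<le> (\<Sum>i\<in>T. \<bar>?y $ i * g1 i ((s * u) *\<^sub>R ?y + a)\<bar>)"
        unfolding mult_1 by (rule sum_abs)
      also have "\<dots> \<le> (\<Sum>i\<in>T. Q a * V i ?y)"
        by (intro sum_mono V x su)
      finally have "\<bar>f 1\<bar> \<le> K * Q a + (\<Sum>i\<in>T. Q a * V i ?y)"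
        using K(2)[of a] by (simp add: f_def)
      then show "\<bar>g (u *\<^sub>R ?y + a)\<bar> \<le> Q a * G ?y"
        unfolding G_def f_def by (simp only: distrib_left[of "Q a" K] sum_distrib_left mult.commute[of "Q a" K]) simp
    qed
    then show ?case by (rule exI[of _ G])
  qed
qed

section \<open>The expansion in expectation, for a fixed shift\<close>

lemma g1_measurable [measurable]: "g1 i \<in> borel_measurable borel"
  by (rule borel_measurable_continuous_onI[OF continuous_g1])

lemma g_measurable [measurable]: "g \<in> borel_measurable borel"
  by (rule borel_measurable_continuous_onI[OF continuous_g])

lemma g2_measurable: "j \<in> A i \<Longrightarrow> g2 i j \<in> borel_measurable borel"
  by (rule borel_measurable_continuous_onI[OF continuous_g2]) (rule ok_A, assumption)+

lemma integrable_derivatives: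
  assumes u: "\<bar>u\<bar> \<le> 1"
  shows "integrable M (\<lambda>\<omega>. g1 i (u *\<^sub>R msk R (X \<omega>) + a))"
    and "j \<in> A i \<Longrightarrow> integrable M (\<lambda>\<omega>. g2 i j (u *\<^sub>R msk R (X \<omega>) + a))"
proof -
  obtain G where G: "dominates R G" using ex_dominating by blast
  show "integrable M (\<lambda>\<omega>. g1 i (u *\<^sub>R msk R (X \<omega>) + a))"
  proof (rule Bochner_Integration.integrable_bound)
    show "integrable M (\<lambda>\<omega>. Q a * (16 * G (msk R (X \<omega>)) + c i i i))"
      using dominatesD(3)[OF G] by simp
    show "AE \<omega> in M. norm (g1 i (u *\<^sub>R msk R (X \<omega>) + a)) \<le> norm (Q a * (16 * G (msk R (X \<omega>)) + c i i i))"
      using AE_good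
    proof eventually_elim
      case (elim \<omega>)
      then show ?case using order_trans[OF dominates_g1[OF G elim u] abs_ge_self] by simp
    qed
  qed measurable
  show "integrable M (\<lambda>\<omega>. g2 i j (u *\<^sub>R msk R (X \<omega>) + a))" if j: "j \<in> A i"
  proof (rule Bochner_Integration.integrable_bound)
    note [measurable] = g2_measurable[OF j]
    show "(\<lambda>\<omega>. g2 i j (u *\<^sub>R msk R (X \<omega>) + a)) \<in> borel_measurable M" by measurable
    show "integrable M (\<lambda>\<omega>. Q a * (81 * G (msk R (X \<omega>)) + (c i j i + c i j j)))"
      using dominatesD(3)[OF G] by simp
    show "AE \<omega> in M. norm (g2 i j (u *\<^sub>R msk R (X \<omega>) + a)) \<le> norm (Q a * (81 * G (msk R (X \<omega>)) + (c i j i + c i j j)))"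
      using AE_good
    proof eventually_elim
      case (elim \<omega>)
      then show ?case using order_trans[OF dominates_g2[OF G elim u j] abs_ge_self] by simp
    qed
  qed
qed

text \<open>The coefficient 1/2 of the sum over \<open>A i\<close> is that of the second-order
  Taylor remainder of \<open>g1\<close>; the sum over \<open>B i j\<close> comes from Lipschitz
  steps of \<open>g2\<close> and carries the coefficient 1.\<close>

definition \<Lambda> :: real where
  "\<Lambda> = (\<Sum>i\<in>UNIV. \<Sum>j\<in>A i. \<Sum>k\<in>B i j.
        (\<bar>\<sigma> i j\<bar> * (\<integral>\<omega>. \<bar>X \<omega> $ k\<bar> \<partial>M) + (\<integral>\<omega>. \<bar>X \<omega> $ i * X \<omega> $ j * X \<omega> $ k\<bar> \<partial>M)) * c i j k)
     + (\<Sum>i\<in>UNIV. \<Sum>j\<in>A i. \<Sum>k\<in>A i. (\<integral>\<omega>. \<bar>X \<omega> $ i * X \<omega> $ j * X \<omega> $ k\<bar> \<partial>M) * c i j k) / 2"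

lemma abs_integral_le:
  fixes f h :: "'a \<Rightarrow> real"
  assumes [measurable]: "f \<in> borel_measurable M" and h: "integrable M h" and le: "AE \<omega> in M. \<bar>f \<omega>\<bar> \<le> h \<omega>"
  shows "integrable M f" and "\<bar>\<integral>\<omega>. f \<omega> \<partial>M\<bar> \<le> (\<integral>\<omega>. h \<omega> \<partial>M)"
proof -
  show f: "integrable M f"
    by (rule Bochner_Integration.integrable_bound[OF h]) (use le in \<open>auto elim!: eventually_mono\<close>)
  have "\<bar>\<integral>\<omega>. f \<omega> \<partial>M\<bar> \<le> (\<integral>\<omega>. \<bar>f \<omega>\<bar> \<partial>M)" by (rule integral_abs_bound)
  also have "\<dots> \<le> (\<integral>\<omega>. h \<omega> \<partial>M)" by (rule integral_mono_AE[OF integrable_abs[OF f] h le])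
  finally show "\<bar>\<integral>\<omega>. f \<omega> \<partial>M\<bar> \<le> (\<integral>\<omega>. h \<omega> \<partial>M)" .
qed

text \<open>Switched off on \<open>A i\<close>, the zeroth-order term has mean 0; the first-order
  terms, switched off on \<open>B i j\<close>, have mean \<sigma>_ij times that of
  \<open>g2\<close>, whose argument must then be moved back to the full vector. Every error is of
  order \<open>u\<close> squared: \<open>r1\<close> directly, the other two as \<open>u\<close>
  times a Lipschitz step of size \<open>u\<close>.\<close>

lemma stein_coordinate:
  assumes u: "0 \<le> u" "u \<le> 1"
  shows "integrable M (\<lambda>\<omega>. X \<omega> $ i * g1 i (u *\<^sub>R X \<omega> + a))"
    and "\<bar>(\<integral>\<omega>. X \<omega> $ i * g1 i (u *\<^sub>R X \<omega> + a) \<partial>M)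
        - u * (\<Sum>j\<in>A i. \<sigma> i j * (\<integral>\<omega>. g2 i j (u *\<^sub>R X \<omega> + a) \<partial>M))\<bar>
      \<le> u\<^sup>2 * ((\<integral>\<omega>. W1 i (X \<omega>) \<partial>M) / 2
        + (\<Sum>j\<in>A i. (\<integral>\<omega>. W2 i j (X \<omega>) \<partial>M) + \<bar>\<sigma> i j\<bar> * (\<Sum>k\<in>B i j. c i j k * (\<integral>\<omega>. \<bar>X \<omega> $ k\<bar> \<partial>M))))"
proof -
  have ua: "\<bar>u\<bar> \<le> 1" using u by simp
  define yA where "yA \<omega> = u *\<^sub>R msk (- A i) (X \<omega>) + a" for \<omega>
  define yB where "yB j \<omega> = u *\<^sub>R msk (- B i j) (X \<omega>) + a" for j \<omega>
  define y where "y \<omega> = u *\<^sub>R X \<omega> + a" for \<omega>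
  have [measurable]: "yA \<in> borel_measurable M" "yB j \<in> borel_measurable M" "y \<in> borel_measurable M" for j
    unfolding yA_def yB_def y_def by measurable
  have i2: "integrable M (\<lambda>\<omega>. g2 i j (yB j \<omega>))" "integrable M (\<lambda>\<omega>. g2 i j (y \<omega>))" if "j \<in> A i" for j
    using integrable_derivatives(2)[OF ua that, of "- B i j" a] integrable_derivatives(2)[OF ua that, of UNIV a]
    unfolding yB_def y_def by simp_all
  define r1 where "r1 \<omega> = X \<omega> $ i * (g1 i (y \<omega>) - g1 i (yA \<omega>) - (\<Sum>j\<in>A i. u * X \<omega> $ j * g2 i j (yA \<omega>)))" for \<omega>
  define r2 where "r2 j \<omega> = X \<omega> $ i * X \<omega> $ j * (g2 i j (yA \<omega>) - g2 i j (yB j \<omega>))" for j \<omega>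
  have r1m: "r1 \<in> borel_measurable M"
  proof -
    have "(\<lambda>\<omega>. \<Sum>j\<in>A i. u * X \<omega> $ j * g2 i j (yA \<omega>)) \<in> borel_measurable M"
    proof (rule borel_measurable_sum)
      fix j assume "j \<in> A i"
      note [measurable] = g2_measurable[OF this]
      show "(\<lambda>\<omega>. u * X \<omega> $ j * g2 i j (yA \<omega>)) \<in> borel_measurable M" by measurable
    qed
    then show ?thesis unfolding r1_def by measurable
  qed
  have r1b: "AE \<omega> in M. \<bar>r1 \<omega>\<bar> \<le> u\<^sup>2 * W1 i (X \<omega>) / 2"
    using AE_good unfolding r1_def y_def yA_def by eventually_elim (rule expansion1)
  have r1i: "integrable M (\<lambda>\<omega>. u\<^sup>2 * W1 i (X \<omega>) / 2)" using integrable_W by simp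
  note r1 = abs_integral_le[OF r1m r1i r1b]
  have r2: "integrable M (r2 j)" "\<bar>\<integral>\<omega>. r2 j \<omega> \<partial>M\<bar> \<le> (\<integral>\<omega>. u * W2 i j (X \<omega>) \<partial>M)" if j: "j \<in> A i" for j
  proof -
    note [measurable] = g2_measurable[OF j]
    have m: "r2 j \<in> borel_measurable M" unfolding r2_def by measurable
    have b: "AE \<omega> in M. \<bar>r2 j \<omega>\<bar> \<le> u * W2 i j (X \<omega>)"
      using AE_good
    proof eventually_elim
      case (elim \<omega>)
      from expansion2[OF elim j, of u a] show ?case unfolding r2_def yA_def yB_def using u(1) by simp
    qed
    have h: "integrable M (\<lambda>\<omega>. u * W2 i j (X \<omega>))" using integrable_W by simp
    show "integrable M (r2 j)" "\<bar>\<integral>\<omega>. r2 j \<omega> \<partial>M\<bar> \<le> (\<integral>\<omega>. u * W2 i j (X \<omega>) \<partial>M)"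
      by (rule abs_integral_le[OF m h b])+
  qed
  have B: "integrable M (\<lambda>\<omega>. X \<omega> $ i * X \<omega> $ j * g2 i j (yB j \<omega>))"
    "(\<integral>\<omega>. X \<omega> $ i * X \<omega> $ j * g2 i j (yB j \<omega>) \<partial>M) = \<sigma> i j * (\<integral>\<omega>. g2 i j (yB j \<omega>) \<partial>M)" if j: "j \<in> A i" for j
  proof -
    have m: "(\<lambda>z. g2 i j (u *\<^sub>R z + a)) \<in> borel_measurable borel"
      using g2_measurable[OF j] by measurable
    from integrable_indep2[OF m _ j, of "- B i j"] i2(1)[OF j]
    show "integrable M (\<lambda>\<omega>. X \<omega> $ i * X \<omega> $ j * g2 i j (yB j \<omega>))"
      "(\<integral>\<omega>. X \<omega> $ i * X \<omega> $ j * g2 i j (yB j \<omega>) \<partial>M) = \<sigma> i j * (\<integral>\<omega>. g2 i j (yB j \<omega>) \<partial>M)"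
      unfolding yB_def by simp_all
  qed
  have A0: "integrable M (\<lambda>\<omega>. X \<omega> $ i * g1 i (yA \<omega>))" "(\<integral>\<omega>. X \<omega> $ i * g1 i (yA \<omega>) \<partial>M) = 0"
  proof -
    have m: "(\<lambda>z. g1 i (u *\<^sub>R z + a)) \<in> borel_measurable borel" by measurable
    from integrable_indep1[OF m, of "- A i" i] integrable_derivatives(1)[OF ua, of i "- A i" a]
    show "integrable M (\<lambda>\<omega>. X \<omega> $ i * g1 i (yA \<omega>))" "(\<integral>\<omega>. X \<omega> $ i * g1 i (yA \<omega>) \<partial>M) = 0"
      unfolding yA_def by simp_all
  qed
  have decomp: "X \<omega> $ i * g1 i (y \<omega>) = r1 \<omega> + X \<omega> $ i * g1 i (yA \<omega>)
      + (\<Sum>j\<in>A i. u * (r2 j \<omega> + X \<omega> $ i * X \<omega> $ j * g2 i j (yB j \<omega>)))" for \<omega>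
  proof -
    have "u * (r2 j \<omega> + X \<omega> $ i * X \<omega> $ j * g2 i j (yB j \<omega>)) = X \<omega> $ i * (u * X \<omega> $ j * g2 i j (yA \<omega>))" for j
      unfolding r2_def by (simp add: algebra_simps)
    then have "(\<Sum>j\<in>A i. u * (r2 j \<omega> + X \<omega> $ i * X \<omega> $ j * g2 i j (yB j \<omega>)))
        = X \<omega> $ i * (\<Sum>j\<in>A i. u * X \<omega> $ j * g2 i j (yA \<omega>))"
      by (simp only: sum_distrib_left)
    then show ?thesis unfolding r1_def by (simp only: right_diff_distrib)
  qed
  have isum: "integrable M (\<lambda>\<omega>. \<Sum>j\<in>A i. u * (r2 j \<omega> + X \<omega> $ i * X \<omega> $ j * g2 i j (yB j \<omega>)))"
    by (intro Bochner_Integration.integrable_sum integrable_mult_right Bochner_Integration.integrable_add r2 B)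
  show "integrable M (\<lambda>\<omega>. X \<omega> $ i * g1 i (u *\<^sub>R X \<omega> + a))"
    unfolding y_def[symmetric] decomp
    by (intro Bochner_Integration.integrable_add r1 A0 isum)
  have E: "(\<integral>\<omega>. X \<omega> $ i * g1 i (y \<omega>) \<partial>M) = (\<integral>\<omega>. r1 \<omega> \<partial>M)
      + (\<Sum>j\<in>A i. u * ((\<integral>\<omega>. r2 j \<omega> \<partial>M) + \<sigma> i j * (\<integral>\<omega>. g2 i j (yB j \<omega>) \<partial>M)))"
  proof -
    have "(\<integral>\<omega>. (\<Sum>j\<in>A i. u * (r2 j \<omega> + X \<omega> $ i * X \<omega> $ j * g2 i j (yB j \<omega>))) \<partial>M)
        = (\<Sum>j\<in>A i. u * ((\<integral>\<omega>. r2 j \<omega> \<partial>M) + \<sigma> i j * (\<integral>\<omega>. g2 i j (yB j \<omega>) \<partial>M)))"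
      using r2(1) B by (subst Bochner_Integration.integral_sum) auto
    then show ?thesis unfolding decomp
      by (simp only: Bochner_Integration.integral_add[OF Bochner_Integration.integrable_add[OF r1(1) A0(1)] isum]
          Bochner_Integration.integral_add[OF r1(1) A0(1)] A0(2) add_0_right)
  qed
  \<comment> \<open>Moving the argument of \<open>g2\<close> back to the full vector is what
    produces the terms |\<sigma>_ij| E|X_k|.\<close>
  have 3: "\<bar>\<sigma> i j * ((\<integral>\<omega>. g2 i j (yB j \<omega>) \<partial>M) - (\<integral>\<omega>. g2 i j (y \<omega>) \<partial>M))\<bar>
      \<le> u * (\<bar>\<sigma> i j\<bar> * (\<Sum>k\<in>B i j. c i j k * (\<integral>\<omega>. \<bar>X \<omega> $ k\<bar> \<partial>M)))" if j: "j \<in> A i" for j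
  proof (cases "\<sigma> i j = 0")
    case False
    have intk: "integrable M (\<lambda>\<omega>. c i j k * \<bar>X \<omega> $ k\<bar>)" for k
      by (intro integrable_mult_right integrable_abs integrable_X)
    have "\<bar>\<integral>\<omega>. g2 i j (yB j \<omega>) - g2 i j (y \<omega>) \<partial>M\<bar> \<le> (\<integral>\<omega>. u * (\<Sum>k\<in>B i j. c i j k * \<bar>X \<omega> $ k\<bar>) \<partial>M)"
    proof (rule abs_integral_le)
      show "AE \<omega> in M. \<bar>g2 i j (yB j \<omega>) - g2 i j (y \<omega>)\<bar> \<le> u * (\<Sum>k\<in>B i j. c i j k * \<bar>X \<omega> $ k\<bar>)"
        using expansion3[OF j False, of u _ a] u(1)
        by (intro AE_I2) (simp add: yB_def y_def abs_minus_commute)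
      show "integrable M (\<lambda>\<omega>. u * (\<Sum>k\<in>B i j. c i j k * \<bar>X \<omega> $ k\<bar>))"
        by (intro integrable_mult_right Bochner_Integration.integrable_sum intk)
    qed (use i2[OF j] in auto)
    also have "(\<integral>\<omega>. u * (\<Sum>k\<in>B i j. c i j k * \<bar>X \<omega> $ k\<bar>) \<partial>M)
        = u * (\<Sum>k\<in>B i j. c i j k * (\<integral>\<omega>. \<bar>X \<omega> $ k\<bar> \<partial>M))"
      using Bochner_Integration.integral_sum[of "B i j" M "\<lambda>k \<omega>. c i j k * \<bar>X \<omega> $ k\<bar>", OF intk] by simp
    also have "(\<integral>\<omega>. g2 i j (yB j \<omega>) - g2 i j (y \<omega>) \<partial>M) = (\<integral>\<omega>. g2 i j (yB j \<omega>) \<partial>M) - (\<integral>\<omega>. g2 i j (y \<omega>) \<partial>M)"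
      by (rule Bochner_Integration.integral_diff[OF i2[OF j]])
    finally show ?thesis by (simp add: abs_mult mult.left_commute[of u] mult_left_mono)
  qed simp
  have summand: "\<bar>u * ((\<integral>\<omega>. r2 j \<omega> \<partial>M) + \<sigma> i j * (\<integral>\<omega>. g2 i j (yB j \<omega>) \<partial>M))
       - u * (\<sigma> i j * (\<integral>\<omega>. g2 i j (y \<omega>) \<partial>M))\<bar>
     \<le> u\<^sup>2 * ((\<integral>\<omega>. W2 i j (X \<omega>) \<partial>M) + \<bar>\<sigma> i j\<bar> * (\<Sum>k\<in>B i j. c i j k * (\<integral>\<omega>. \<bar>X \<omega> $ k\<bar> \<partial>M)))"
    if j: "j \<in> A i" for j
  proof -
    let ?S = "\<bar>\<sigma> i j\<bar> * (\<Sum>k\<in>B i j. c i j k * (\<integral>\<omega>. \<bar>X \<omega> $ k\<bar> \<partial>M))"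
    let ?D = "\<sigma> i j * ((\<integral>\<omega>. g2 i j (yB j \<omega>) \<partial>M) - (\<integral>\<omega>. g2 i j (y \<omega>) \<partial>M))"
    have "\<bar>(\<integral>\<omega>. r2 j \<omega> \<partial>M) + ?D\<bar> \<le> u * (\<integral>\<omega>. W2 i j (X \<omega>) \<partial>M) + u * ?S"
      using r2(2)[OF j] 3[OF j] abs_triangle_ineq[of "\<integral>\<omega>. r2 j \<omega> \<partial>M" ?D] by simp
    note le = mult_left_mono[OF this u(1)]
    have "u * ((\<integral>\<omega>. r2 j \<omega> \<partial>M) + \<sigma> i j * (\<integral>\<omega>. g2 i j (yB j \<omega>) \<partial>M)) - u * (\<sigma> i j * (\<integral>\<omega>. g2 i j (y \<omega>) \<partial>M))
       = u * ((\<integral>\<omega>. r2 j \<omega> \<partial>M) + ?D)"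
      by (simp add: algebra_simps)
    also have "\<bar>\<dots>\<bar> = u * \<bar>(\<integral>\<omega>. r2 j \<omega> \<partial>M) + ?D\<bar>"
      by (simp only: abs_mult abs_of_nonneg[OF u(1)])
    also have "\<dots> \<le> u * (u * (\<integral>\<omega>. W2 i j (X \<omega>) \<partial>M) + u * ?S)" by (rule le)
    also have "\<dots> = u\<^sup>2 * ((\<integral>\<omega>. W2 i j (X \<omega>) \<partial>M) + ?S)"
      by (simp only: power2_eq_square distrib_left mult.assoc)
    finally show ?thesis .
  qed
  have r1': "\<bar>\<integral>\<omega>. r1 \<omega> \<partial>M\<bar> \<le> u\<^sup>2 * (\<integral>\<omega>. W1 i (X \<omega>) \<partial>M) / 2"
    using r1(2) by simp
  have factor: "u\<^sup>2 * w / 2 + (\<Sum>j\<in>A i. u\<^sup>2 * t j) = u\<^sup>2 * (w / 2 + (\<Sum>j\<in>A i. t j))" for w t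
    by (simp add: distrib_left sum_distrib_left)
  define v where "v j = u * ((\<integral>\<omega>. r2 j \<omega> \<partial>M) + \<sigma> i j * (\<integral>\<omega>. g2 i j (yB j \<omega>) \<partial>M))
       - u * (\<sigma> i j * (\<integral>\<omega>. g2 i j (y \<omega>) \<partial>M))" for j
  have eq: "(\<integral>\<omega>. X \<omega> $ i * g1 i (y \<omega>) \<partial>M) - u * (\<Sum>j\<in>A i. \<sigma> i j * (\<integral>\<omega>. g2 i j (y \<omega>) \<partial>M))
     = (\<integral>\<omega>. r1 \<omega> \<partial>M) + (\<Sum>j\<in>A i. v j)"
    unfolding E v_def by (simp add: sum_subtractf sum_distrib_left)
  have "\<bar>(\<integral>\<omega>. r1 \<omega> \<partial>M) + (\<Sum>j\<in>A i. v j)\<bar> \<le> \<bar>\<integral>\<omega>. r1 \<omega> \<partial>M\<bar> + (\<Sum>j\<in>A i. \<bar>v j\<bar>)"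
    by (rule order_trans[OF abs_triangle_ineq add_left_mono[OF sum_abs]])
  also have "\<dots> \<le> u\<^sup>2 * (\<integral>\<omega>. W1 i (X \<omega>) \<partial>M) / 2
     + (\<Sum>j\<in>A i. u\<^sup>2 * ((\<integral>\<omega>. W2 i j (X \<omega>) \<partial>M) + \<bar>\<sigma> i j\<bar> * (\<Sum>k\<in>B i j. c i j k * (\<integral>\<omega>. \<bar>X \<omega> $ k\<bar> \<partial>M))))"
    by (intro add_mono[OF r1' sum_mono]) (unfold v_def, rule summand)
  finally have "\<bar>(\<integral>\<omega>. r1 \<omega> \<partial>M) + (\<Sum>j\<in>A i. v j)\<bar> \<le> u\<^sup>2 * ((\<integral>\<omega>. W1 i (X \<omega>) \<partial>M) / 2
        + (\<Sum>j\<in>A i. (\<integral>\<omega>. W2 i j (X \<omega>) \<partial>M) + \<bar>\<sigma> i j\<bar> * (\<Sum>k\<in>B i j. c i j k * (\<integral>\<omega>. \<bar>X \<omega> $ k\<bar> \<partial>M))))"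
    unfolding factor .
  then show "\<bar>(\<integral>\<omega>. X \<omega> $ i * g1 i (u *\<^sub>R X \<omega> + a) \<partial>M)
        - u * (\<Sum>j\<in>A i. \<sigma> i j * (\<integral>\<omega>. g2 i j (u *\<^sub>R X \<omega> + a) \<partial>M))\<bar>
      \<le> u\<^sup>2 * ((\<integral>\<omega>. W1 i (X \<omega>) \<partial>M) / 2
        + (\<Sum>j\<in>A i. (\<integral>\<omega>. W2 i j (X \<omega>) \<partial>M) + \<bar>\<sigma> i j\<bar> * (\<Sum>k\<in>B i j. c i j k * (\<integral>\<omega>. \<bar>X \<omega> $ k\<bar> \<partial>M))))"
    unfolding eq[symmetric] y_def .
qed

lemma integral_W:
  "(\<integral>\<omega>. W1 i (X \<omega>) \<partial>M) = (\<Sum>j\<in>A i. \<Sum>k\<in>A i. (\<integral>\<omega>. \<bar>X \<omega> $ i * X \<omega> $ j * X \<omega> $ k\<bar> \<partial>M) * c i j k)"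
  "(\<integral>\<omega>. W2 i j (X \<omega>) \<partial>M) = (\<Sum>k\<in>B i j. (\<integral>\<omega>. \<bar>X \<omega> $ i * X \<omega> $ j * X \<omega> $ k\<bar> \<partial>M) * c i j k)"
proof -
  have i: "integrable M (\<lambda>\<omega>. c i j k * \<bar>X \<omega> $ i * X \<omega> $ j * X \<omega> $ k\<bar>)" for j k
    by (intro integrable_mult_right integrable_abs integrable_X_prod3)
  have "(\<integral>\<omega>. W1 i (X \<omega>) \<partial>M) = (\<Sum>j\<in>A i. \<Sum>k\<in>A i. (\<integral>\<omega>. c i j k * \<bar>X \<omega> $ i * X \<omega> $ j * X \<omega> $ k\<bar> \<partial>M))"
    unfolding W1_def
    by (subst Bochner_Integration.integral_sum, intro Bochner_Integration.integrable_sum i,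
        intro sum.cong refl Bochner_Integration.integral_sum i)
  then show "(\<integral>\<omega>. W1 i (X \<omega>) \<partial>M) = (\<Sum>j\<in>A i. \<Sum>k\<in>A i. (\<integral>\<omega>. \<bar>X \<omega> $ i * X \<omega> $ j * X \<omega> $ k\<bar> \<partial>M) * c i j k)"
    by (simp add: mult.commute)
  have "(\<integral>\<omega>. W2 i j (X \<omega>) \<partial>M) = (\<Sum>k\<in>B i j. (\<integral>\<omega>. c i j k * \<bar>X \<omega> $ i * X \<omega> $ j * X \<omega> $ k\<bar> \<partial>M))"
    unfolding W2_def by (rule Bochner_Integration.integral_sum[OF i])
  then show "(\<integral>\<omega>. W2 i j (X \<omega>) \<partial>M) = (\<Sum>k\<in>B i j. (\<integral>\<omega>. \<bar>X \<omega> $ i * X \<omega> $ j * X \<omega> $ k\<bar> \<partial>M) * c i j k)"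
    by (simp add: mult.commute)
qed

lemma stein_bound:
  assumes u: "0 \<le> u" "u \<le> 1"
  shows "\<bar>\<Sum>i\<in>UNIV. (\<integral>\<omega>. X \<omega> $ i * g1 i (u *\<^sub>R X \<omega> + a) \<partial>M)
        - u * (\<Sum>j\<in>A i. \<sigma> i j * (\<integral>\<omega>. g2 i j (u *\<^sub>R X \<omega> + a) \<partial>M))\<bar> \<le> u\<^sup>2 * \<Lambda>"
proof -
  have "\<Lambda> = (\<Sum>i\<in>UNIV. (\<integral>\<omega>. W1 i (X \<omega>) \<partial>M) / 2
        + (\<Sum>j\<in>A i. (\<integral>\<omega>. W2 i j (X \<omega>) \<partial>M) + \<bar>\<sigma> i j\<bar> * (\<Sum>k\<in>B i j. c i j k * (\<integral>\<omega>. \<bar>X \<omega> $ k\<bar> \<partial>M))))"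
    unfolding integral_W \<Lambda>_def
    by (simp add: sum.distrib sum_distrib_left sum_divide_distrib algebra_simps)
  then have eq: "u\<^sup>2 * \<Lambda> = (\<Sum>i\<in>UNIV. u\<^sup>2 * ((\<integral>\<omega>. W1 i (X \<omega>) \<partial>M) / 2
        + (\<Sum>j\<in>A i. (\<integral>\<omega>. W2 i j (X \<omega>) \<partial>M) + \<bar>\<sigma> i j\<bar> * (\<Sum>k\<in>B i j. c i j k * (\<integral>\<omega>. \<bar>X \<omega> $ k\<bar> \<partial>M)))))"
    by (simp only: sum_distrib_left)
  show ?thesis unfolding eq
    by (rule order_trans[OF sum_abs]) (intro sum_mono stein_coordinate u)
qed

end

section \<open>Interpolation between the two laws\<close>

locale normal_comparison = local_dependence M g g1 g2 c ok X A B + N: centred_gaussian P S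
  for M :: "'a measure" and g :: "real ^ 'n \<Rightarrow> real" and g1 g2 c ok
    and X :: "'a \<Rightarrow> real ^ 'n" and A B and P :: "(real ^ 'n) measure" and S +
  assumes S_eq: "\<And>i j. S $ i $ j = \<sigma> i j"
begin

sublocale pair: pair_prob_space M P ..

lemma AE_good_fst: "AE p in M \<Otimes>\<^sub>M P. good (X (fst p))"
proof -
  have [measurable]: "Measurable.pred borel good"
    unfolding good_def by (intro pred_intros_countable pred_intros_finite finite pred_intros_logic) measurable
  show ?thesis
  proof (rule pair.AE_pair_measure)
    show "{p \<in> space (M \<Otimes>\<^sub>M P). good (X (fst p))} \<in> sets (M \<Otimes>\<^sub>M P)" by measurable
    show "AE x in M. AE y in P. good (X (fst (x, y)))" using AE_good by eventually_elim simp
  qed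
qed

lemma Q_measurable [measurable]: "Q \<in> borel_measurable borel"
  unfolding Q_def by measurable

lemma integrable_Q: "integrable P Q" "integrable P (\<lambda>z. \<bar>z $ i\<bar> * Q z)"
proof -
  let ?m = "3 * CARD('n)"
  have b: "\<bar>Q z\<bar> \<le> 1 * (1 + norm z) ^ ?m" for z :: "real ^ 'n"
    using Q_le_norm[of z] Q_nonneg[of z] by simp
  show "integrable P Q"
    by (rule N.integrable_poly_bound[OF _ b]) measurable
  have "\<bar>z $ i\<bar> * Q z \<le> (1 + norm z) * (1 + norm z) ^ ?m" for z :: "real ^ 'n"
    using component_le_norm_cart[of z i] by (intro mult_mono Q_le_norm Q_nonneg) auto
  then have "\<bar>\<bar>z $ i\<bar> * Q z\<bar> \<le> 1 * (1 + norm z) ^ Suc ?m" for z :: "real ^ 'n"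
    by (simp add: abs_mult Q_nonneg)
  then show "integrable P (\<lambda>z. \<bar>z $ i\<bar> * Q z)"
    by (intro N.integrable_poly_bound[where K=1 and k="Suc ?m"]) measurable
qed

lemma Q_scaleR_le: "\<bar>r\<bar> \<le> 1 \<Longrightarrow> Q (r *\<^sub>R z) \<le> Q z"
  by (intro Q_mono) (simp add: abs_mult mult_left_le_one_le)

lemma poly_shift:
  fixes f :: "real ^ 'n \<Rightarrow> real"
  assumes b: "\<bar>f (b + r *\<^sub>R z)\<bar> \<le> K * Q (b + r *\<^sub>R z)" and K: "0 \<le> K" and r: "\<bar>r\<bar> \<le> 1"
  shows "\<bar>f (b + r *\<^sub>R z)\<bar> \<le> (K * (1 + norm b) ^ (3 * CARD('n))) * (1 + norm (z :: real ^ 'n)) ^ (3 * CARD('n))"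
proof -
  have "norm (r *\<^sub>R z) \<le> norm z" using r by (simp add: mult_left_le_one_le)
  then have "1 + norm (b + r *\<^sub>R z) \<le> 1 + norm b + norm z"
    using norm_triangle_ineq[of b "r *\<^sub>R z"] by linarith
  also have "\<dots> \<le> (1 + norm b) * (1 + norm z)" by (simp add: algebra_simps)
  finally have "(1 + norm (b + r *\<^sub>R z)) ^ (3 * CARD('n)) \<le> ((1 + norm b) * (1 + norm z)) ^ (3 * CARD('n))"
    by (intro power_mono) auto
  then have "Q (b + r *\<^sub>R z) \<le> (1 + norm b) ^ (3 * CARD('n)) * (1 + norm z) ^ (3 * CARD('n))"
    using Q_le_norm[of "b + r *\<^sub>R z"] unfolding power_mult_distrib by linarith
  from mult_left_mono[OF this K] b show ?thesis by (simp only: mult.assoc)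
qed

text \<open>For \<open>S = {}\<close> the masked vector is 0, and domination becomes a deterministic
  growth bound in the shift \<open>a\<close>.\<close>

lemma global_growth:
  "\<exists>K\<ge>0. \<forall>y. \<bar>g1 i y\<bar> \<le> K * Q y \<and> (\<forall>j\<in>A i. \<bar>g2 i j y\<bar> \<le> K * Q y)"
proof -
  obtain G where G: "dominates {} G" using ex_dominating by blast
  have good0: "good 0" by (simp add: good_def)
  define K where "K = (16 * G 0 + c i i i) + (\<Sum>j\<in>A i. 81 * G 0 + (c i j i + c i j j))"
  have nn: "0 \<le> 81 * G 0 + (c i j i + c i j j)" "0 \<le> 16 * G 0 + c i i i" for j
    using dominatesD(2)[OF G] c_nonneg by (auto intro!: add_nonneg_nonneg)
  show ?thesis
  proof (intro exI[of _ K] conjI allI ballI)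
    show "0 \<le> K" unfolding K_def by (intro add_nonneg_nonneg sum_nonneg nn)
    fix y
    have "\<bar>g1 i y\<bar> \<le> Q y * (16 * G 0 + c i i i)"
      using dominates_g1[OF G good0, of 0 i y] by simp
    also have "\<dots> \<le> Q y * K"
      unfolding K_def by (intro mult_left_mono Q_nonneg) (simp add: sum_nonneg nn)
    finally show "\<bar>g1 i y\<bar> \<le> K * Q y" by (simp add: mult.commute)
    fix j assume j: "j \<in> A i"
    have "\<bar>g2 i j y\<bar> \<le> Q y * (81 * G 0 + (c i j i + c i j j))"
      using dominates_g2[OF G good0 _ j, of 0 y] by simp
    also have "\<dots> \<le> Q y * K"
    proof (intro mult_left_mono Q_nonneg)
      have "81 * G 0 + (c i j i + c i j j) \<le> (\<Sum>j\<in>A i. 81 * G 0 + (c i j i + c i j j))"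
        by (rule member_le_sum[OF j, where f="\<lambda>j. 81 * G 0 + (c i j i + c i j j)"]) (simp_all add: nn)
      then show "81 * G 0 + (c i j i + c i j j) \<le> K" unfolding K_def using nn(2) by linarith
    qed
    finally show "\<bar>g2 i j y\<bar> \<le> K * Q y" by (simp add: mult.commute)
  qed
qed

text \<open>For fixed \<open>b\<close> this is the Gaussian formula for a shifted and scaled
  \<open>g1 i\<close>. It involves only \<open>j\<close> with \<sigma>_ij \<noteq> 0; these lie in
  \<open>A i\<close>, where \<open>g2 i j\<close> is continuous and of polynomial growth.\<close>

lemma gaussian_integration_by_parts:
  assumes r: "\<bar>r\<bar> \<le> 1"
  shows "(\<integral>z. z $ i * g1 i (b + r *\<^sub>R z) \<partial>P) = r * (\<Sum>j\<in>A i. \<sigma> i j * (\<integral>z. g2 i j (b + r *\<^sub>R z) \<partial>P))"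
proof -
  obtain K where K: "K \<ge> 0" "\<And>y. \<bar>g1 i y\<bar> \<le> K * Q y" "\<And>y j. j \<in> A i \<Longrightarrow> \<bar>g2 i j y\<bar> \<le> K * Q y"
    using global_growth by blast
  let ?m = "3 * CARD('n)"
  let ?K = "K * (1 + norm b) ^ ?m"
  have SA: "j \<in> A i" if "S $ i $ j \<noteq> 0" for j using that \<sigma>_zero unfolding S_eq by blast
  have "(\<integral>z. z $ i * g1 i (b + r *\<^sub>R z) \<partial>P)
      = (\<Sum>j | S $ i $ j \<noteq> 0. S $ i $ j * (\<integral>z. r * g2 i j (b + r *\<^sub>R z) \<partial>P))"
  proof (rule N.integration_by_parts)
    show "continuous_on UNIV (\<lambda>z. g1 i (b + r *\<^sub>R z))"
      by (rule continuous_on_compose2[OF continuous_g1]) (auto intro!: continuous_intros)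
    show "\<bar>g1 i (b + r *\<^sub>R z)\<bar> \<le> ?K * (1 + norm z) ^ ?m" for z
      by (rule poly_shift[where f="g1 i", OF K(2) K(1) r])
    fix j assume j: "S $ i $ j \<noteq> 0"
    show "((\<lambda>t. g1 i (b + r *\<^sub>R (z + t *\<^sub>R axis j 1))) has_real_derivative
        r * g2 i j (b + r *\<^sub>R (z + t *\<^sub>R axis j 1))) (at t)" for z t
    proof -
      have "((\<lambda>t. g1 i ((b + r *\<^sub>R z) + (r * t) *\<^sub>R axis j 1)) has_real_derivative
        g2 i j ((b + r *\<^sub>R z) + (r * t) *\<^sub>R axis j 1) * r) (at t)"
        by (rule DERIV_chain2[OF d2]) (auto intro!: derivative_eq_intros)
      then show ?thesis by (simp add: algebra_simps)
    qed
    show "continuous_on UNIV (\<lambda>z. r * g2 i j (b + r *\<^sub>R z))"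
      by (intro continuous_intros continuous_on_compose2[OF continuous_g2[OF ok_A[OF SA[OF j]]]]) auto
    fix z
    have "\<bar>r * g2 i j (b + r *\<^sub>R z)\<bar> \<le> 1 * \<bar>g2 i j (b + r *\<^sub>R z)\<bar>"
      unfolding abs_mult using r by (intro mult_right_mono) auto
    also have "\<dots> \<le> ?K * (1 + norm z) ^ ?m"
      using poly_shift[where f="g2 i j", OF K(3)[OF SA[OF j]] K(1) r] by simp
    finally show "\<bar>r * g2 i j (b + r *\<^sub>R z)\<bar> \<le> ?K * (1 + norm z) ^ ?m" .
  qed
  also have "\<dots> = (\<Sum>j\<in>A i. S $ i $ j * (\<integral>z. r * g2 i j (b + r *\<^sub>R z) \<partial>P))"
    by (rule sum.mono_neutral_left) (use SA in auto)
  finally show ?thesis unfolding S_eq by (simp add: sum_distrib_left mult.left_commute)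
qed

lemma integrable_pair_bound:
  fixes f :: "'a \<times> (real ^ 'n) \<Rightarrow> real" and q V :: "real ^ 'n \<Rightarrow> real"
  assumes m: "f \<in> borel_measurable (M \<Otimes>\<^sub>M P)"
    and V: "integrable M (\<lambda>\<omega>. V (X \<omega>))" and q: "integrable P q"
    and b: "\<And>\<omega> z. good (X \<omega>) \<Longrightarrow> \<bar>f (\<omega>, z)\<bar> \<le> q z * V (X \<omega>)"
  shows "integrable (M \<Otimes>\<^sub>M P) f"
proof (rule Bochner_Integration.integrable_bound)
  show "integrable (M \<Otimes>\<^sub>M P) (\<lambda>p. V (X (fst p)) * q (snd p))"
    by (rule integrable_product_pair[OF prob_space_axioms N.prob V q])
  show "AE p in M \<Otimes>\<^sub>M P. norm (f p) \<le> norm (V (X (fst p)) * q (snd p))"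
    using AE_good_fst
  proof eventually_elim
    case (elim p)
    from b[OF elim, of "snd p"] show ?case by (simp add: mult.commute)
  qed
qed (rule m)

text \<open>The squared coefficients add up to 1, so the covariance is the same for all \<theta>. In
  this parametrisation the path is differentiable at both ends, unlike one with weights sqrt t and
  sqrt (1 - t).\<close>

definition interpolant :: "real \<Rightarrow> 'a \<times> (real ^ 'n) \<Rightarrow> real ^ 'n" where
  "interpolant \<theta> p = sin \<theta> *\<^sub>R X (fst p) + cos \<theta> *\<^sub>R snd p"

lemma interpolant_measurable [measurable]: "interpolant \<theta> \<in> borel_measurable (M \<Otimes>\<^sub>M P)"
  unfolding interpolant_def by measurable

text \<open>One dominating function serves all \<theta>: sin \<theta> takes the role of the scale
  \<open>u\<close>, and \<open>cos \<theta> *\<^sub>R z\<close> that of the shift \<open>a\<close>,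
  whose \<open>Q\<close> is at most \<open>Q z\<close>.\<close>

lemma dominated_path:
  obtains G where "\<And>x. 0 \<le> G x" "integrable M (\<lambda>\<omega>. G (X \<omega>))"
    "\<And>\<theta> \<omega> z. good (X \<omega>) \<Longrightarrow> \<bar>g (interpolant \<theta> (\<omega>, z))\<bar> \<le> Q z * G (X \<omega>)"
    "\<And>i \<theta> \<omega> z. good (X \<omega>) \<Longrightarrow> \<bar>g1 i (interpolant \<theta> (\<omega>, z))\<bar> \<le> Q z * (16 * G (X \<omega>) + c i i i)"
    "\<And>i j \<theta> \<omega> z. good (X \<omega>) \<Longrightarrow> j \<in> A i \<Longrightarrow>
      \<bar>g2 i j (interpolant \<theta> (\<omega>, z))\<bar> \<le> Q z * (81 * G (X \<omega>) + (c i j i + c i j j))"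
proof -
  obtain G where G: "dominates UNIV G" using ex_dominating by blast
  show thesis
  proof (rule that[of G])
    show G0: "0 \<le> G x" for x by (rule dominatesD(2)[OF G])
    show "integrable M (\<lambda>\<omega>. G (X \<omega>))" using dominatesD(3)[OF G] by simp
    have s: "\<bar>sin \<theta>\<bar> \<le> 1" and q: "Q (cos \<theta> *\<^sub>R z) \<le> Q z" for \<theta> :: real and z :: "real ^ 'n"
      by (auto intro!: Q_scaleR_le)
    fix \<theta> \<omega> and z :: "real ^ 'n" assume gd: "good (X \<omega>)"
    show "\<bar>g (interpolant \<theta> (\<omega>, z))\<bar> \<le> Q z * G (X \<omega>)"
      using dominatesD(4)[OF G gd s, of \<theta> "cos \<theta> *\<^sub>R z"] mult_right_mono[OF q[of \<theta> z] G0, of "X \<omega>"]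
      by (simp add: interpolant_def)
    show "\<bar>g1 i (interpolant \<theta> (\<omega>, z))\<bar> \<le> Q z * (16 * G (X \<omega>) + c i i i)" for i
      using dominates_g1[OF G gd s, of i \<theta> "cos \<theta> *\<^sub>R z"] G0[of "X \<omega>"] c_nonneg[of i i i]
        mult_right_mono[OF q[of \<theta> z], of "16 * G (X \<omega>) + c i i i"]
      by (simp add: interpolant_def)
    show "\<bar>g2 i j (interpolant \<theta> (\<omega>, z))\<bar> \<le> Q z * (81 * G (X \<omega>) + (c i j i + c i j j))" if j: "j \<in> A i" for i j
      using dominates_g2[OF G gd s j, of \<theta> "cos \<theta> *\<^sub>R z"] G0[of "X \<omega>"] c_nonneg[of i j i] c_nonneg[of i j j]
        mult_right_mono[OF q[of \<theta> z], of "81 * G (X \<omega>) + (c i j i + c i j j)"]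
      by (simp add: interpolant_def)
  qed
qed

text \<open>Bounding \<open>g1\<close> alone and multiplying by |X_i| could destroy integrability,
  so the product gets its own dominating function.\<close>

lemma dominated_path_product:
  obtains V where "\<And>x. 0 \<le> V x" "integrable M (\<lambda>\<omega>. V (X \<omega>))"
    "\<And>\<theta> \<omega> z. good (X \<omega>) \<Longrightarrow> \<bar>X \<omega> $ i * g1 i (interpolant \<theta> (\<omega>, z))\<bar> \<le> Q z * V (X \<omega>)"
proof -
  have "\<exists>V. V \<in> borel_measurable borel \<and> (\<forall>x. 0 \<le> V x) \<and> integrable M (\<lambda>\<omega>. V (msk UNIV (X \<omega>))) \<and>
     (\<forall>x u a. good x \<longrightarrow> \<bar>u\<bar> \<le> 1 \<longrightarrow> \<bar>msk UNIV x $ i * g1 i (u *\<^sub>R msk UNIV x + a)\<bar> \<le> Q a * V (msk UNIV x))"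
    by (rule dominated_product) (simp_all add: ex_dominating)
  from this[unfolded msk_UNIV] obtain V where V: "\<And>x. 0 \<le> V x" "integrable M (\<lambda>\<omega>. V (X \<omega>))"
    "\<And>x u a. good x \<Longrightarrow> \<bar>u\<bar> \<le> 1 \<Longrightarrow> \<bar>x $ i * g1 i (u *\<^sub>R x + a)\<bar> \<le> Q a * V x"
    by blast
  show thesis
  proof (rule that[OF V(1,2)])
    fix \<theta> \<omega> and z :: "real ^ 'n" assume gd: "good (X \<omega>)"
    have "Q (cos \<theta> *\<^sub>R z) \<le> Q z" by (rule Q_scaleR_le) simp
    from mult_right_mono[OF this V(1)[of "X \<omega>"]] V(3)[OF gd, of "sin \<theta>" "cos \<theta> *\<^sub>R z"]
    show "\<bar>X \<omega> $ i * g1 i (interpolant \<theta> (\<omega>, z))\<bar> \<le> Q z * V (X \<omega>)" by (simp add: interpolant_def)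
  qed
qed

definition \<phi> :: "real \<Rightarrow> real" where
  "\<phi> \<theta> = (\<integral>p. g (interpolant \<theta> p) \<partial>(M \<Otimes>\<^sub>M P))"

lemma integrable_path:
  shows "integrable (M \<Otimes>\<^sub>M P) (\<lambda>p. g (interpolant \<theta> p))"
    and "integrable (M \<Otimes>\<^sub>M P) (\<lambda>p. X (fst p) $ i * g1 i (interpolant \<theta> p))"
    and "integrable (M \<Otimes>\<^sub>M P) (\<lambda>p. snd p $ i * g1 i (interpolant \<theta> p))"
    and "j \<in> A i \<Longrightarrow> integrable (M \<Otimes>\<^sub>M P) (\<lambda>p. g2 i j (interpolant \<theta> p))"
proof -
  obtain G where G: "\<And>x. 0 \<le> G x" "integrable M (\<lambda>\<omega>. G (X \<omega>))"
    "\<And>\<theta> \<omega> z. good (X \<omega>) \<Longrightarrow> \<bar>g (interpolant \<theta> (\<omega>, z))\<bar> \<le> Q z * G (X \<omega>)"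
    "\<And>i \<theta> \<omega> z. good (X \<omega>) \<Longrightarrow> \<bar>g1 i (interpolant \<theta> (\<omega>, z))\<bar> \<le> Q z * (16 * G (X \<omega>) + c i i i)"
    "\<And>i j \<theta> \<omega> z. good (X \<omega>) \<Longrightarrow> j \<in> A i \<Longrightarrow>
      \<bar>g2 i j (interpolant \<theta> (\<omega>, z))\<bar> \<le> Q z * (81 * G (X \<omega>) + (c i j i + c i j j))"
    using dominated_path by blast
  show "integrable (M \<Otimes>\<^sub>M P) (\<lambda>p. g (interpolant \<theta> p))"
    by (rule integrable_pair_bound[OF _ G(2) integrable_Q(1) G(3)]) measurable
  show "integrable (M \<Otimes>\<^sub>M P) (\<lambda>p. snd p $ i * g1 i (interpolant \<theta> p))"
  proof (rule integrable_pair_bound[OF _ _ integrable_Q(2)[of i], where V="\<lambda>x. 16 * G x + c i i i"])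
    show "\<bar>snd (\<omega>, z) $ i * g1 i (interpolant \<theta> (\<omega>, z))\<bar> \<le> \<bar>z $ i\<bar> * Q z * (16 * G (X \<omega>) + c i i i)" if "good (X \<omega>)" for \<omega> z
      using mult_left_mono[OF G(4)[OF that, of i \<theta> z] abs_ge_zero[of "z $ i"]] by (simp add: abs_mult mult.assoc)
  qed (use G(2) in simp_all)
  show "integrable (M \<Otimes>\<^sub>M P) (\<lambda>p. g2 i j (interpolant \<theta> p))" if j: "j \<in> A i"
  proof (rule integrable_pair_bound[OF _ _ integrable_Q(1), where V="\<lambda>x. 81 * G x + (c i j i + c i j j)"])
    note [measurable] = g2_measurable[OF j]
    show "(\<lambda>p. g2 i j (interpolant \<theta> p)) \<in> borel_measurable (M \<Otimes>\<^sub>M P)" by measurable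
  qed (use G(2) G(5)[OF _ j] in simp_all)
  obtain V where V: "\<And>x. 0 \<le> V x" "integrable M (\<lambda>\<omega>. V (X \<omega>))"
    "\<And>\<theta> \<omega> z. good (X \<omega>) \<Longrightarrow> \<bar>X \<omega> $ i * g1 i (interpolant \<theta> (\<omega>, z))\<bar> \<le> Q z * V (X \<omega>)"
    by (rule dominated_path_product[of i]) blast
  show "integrable (M \<Otimes>\<^sub>M P) (\<lambda>p. X (fst p) $ i * g1 i (interpolant \<theta> p))"
    by (rule integrable_pair_bound[OF _ V(2) integrable_Q(1)]) (use V(3) in simp_all)
qed

lemma \<phi>_derivative:
  "(\<phi> has_real_derivative (\<integral>p. (\<Sum>i\<in>UNIV. (cos \<theta> * X (fst p) $ i - sin \<theta> * snd p $ i) * g1 i (interpolant \<theta> p)) \<partial>(M \<Otimes>\<^sub>M P))) (at \<theta>)"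
  unfolding \<phi>_def[abs_def]
proof -
  obtain G where G: "\<And>x. 0 \<le> G x" "integrable M (\<lambda>\<omega>. G (X \<omega>))"
    "\<And>\<theta> \<omega> z. good (X \<omega>) \<Longrightarrow> \<bar>g (interpolant \<theta> (\<omega>, z))\<bar> \<le> Q z * G (X \<omega>)"
    "\<And>i \<theta> \<omega> z. good (X \<omega>) \<Longrightarrow> \<bar>g1 i (interpolant \<theta> (\<omega>, z))\<bar> \<le> Q z * (16 * G (X \<omega>) + c i i i)"
    "\<And>i j \<theta> \<omega> z. good (X \<omega>) \<Longrightarrow> j \<in> A i \<Longrightarrow>
      \<bar>g2 i j (interpolant \<theta> (\<omega>, z))\<bar> \<le> Q z * (81 * G (X \<omega>) + (c i j i + c i j j))"
    by (rule dominated_path) blast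
  have "\<forall>i. \<exists>V. integrable M (\<lambda>\<omega>. V (X \<omega>)) \<and>
    (\<forall>\<theta> \<omega> z. good (X \<omega>) \<longrightarrow> \<bar>X \<omega> $ i * g1 i (interpolant \<theta> (\<omega>, z))\<bar> \<le> Q z * V (X \<omega>))"
  proof
    fix i
    show "\<exists>V. integrable M (\<lambda>\<omega>. V (X \<omega>)) \<and>
      (\<forall>\<theta> \<omega> z. good (X \<omega>) \<longrightarrow> \<bar>X \<omega> $ i * g1 i (interpolant \<theta> (\<omega>, z))\<bar> \<le> Q z * V (X \<omega>))"
      by (rule dominated_path_product[of i]) blast
  qed
  from choice[OF this] obtain V where V: "\<And>i. integrable M (\<lambda>\<omega>. V i (X \<omega>))"
    "\<And>i \<theta> \<omega> z. good (X \<omega>) \<Longrightarrow> \<bar>X \<omega> $ i * g1 i (interpolant \<theta> (\<omega>, z))\<bar> \<le> Q z * V i (X \<omega>)" by blast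
  let ?F' = "\<lambda>\<theta> p. \<Sum>i\<in>UNIV. (cos \<theta> * X (fst p) $ i - sin \<theta> * snd p $ i) * g1 i (interpolant \<theta> p)"
  let ?w = "\<lambda>p. \<Sum>i\<in>UNIV. V i (X (fst p)) * Q (snd p)
      + (16 * G (X (fst p)) + c i i i) * (\<bar>snd p $ i\<bar> * Q (snd p))"
  show "((\<lambda>\<theta>. \<integral>p. g (interpolant \<theta> p) \<partial>(M \<Otimes>\<^sub>M P)) has_real_derivative (\<integral>p. ?F' \<theta> p \<partial>(M \<Otimes>\<^sub>M P))) (at \<theta>)"
  proof (rule has_real_derivative_integral[where w="?w"])
    show "integrable (M \<Otimes>\<^sub>M P) (\<lambda>p. g (interpolant t p))" for t by (rule integrable_path)
    show "AE p in M \<Otimes>\<^sub>M P. \<forall>t. ((\<lambda>t. g (interpolant t p)) has_real_derivative ?F' t p) (at t)"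
    proof (intro AE_I2 allI)
      fix p t
      show "((\<lambda>t. g (interpolant t p)) has_real_derivative ?F' t p) (at t)"
        by (rule has_derivative_along_curve[OF d1 continuous_g1])
          (auto simp: interpolant_def intro!: derivative_eq_intros)
    qed
    show "integrable (M \<Otimes>\<^sub>M P) ?w"
      using integrable_product_pair(1)[OF prob_space_axioms N.prob V(1) integrable_Q(1)]
        integrable_product_pair(1)[OF prob_space_axioms N.prob _ integrable_Q(2), of "\<lambda>\<omega>. 16 * G (X \<omega>) + c i i i" i for i]
        G(2)
      by (intro Bochner_Integration.integrable_sum Bochner_Integration.integrable_add) auto
    show "?F' \<theta> \<in> borel_measurable (M \<Otimes>\<^sub>M P)" by measurable
    show "AE p in M \<Otimes>\<^sub>M P. \<forall>t. \<bar>?F' t p\<bar> \<le> ?w p"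
      using AE_good_fst
    proof eventually_elim
      case (elim p)
      show ?case
      proof
        fix t
        have "\<bar>(cos t * X (fst p) $ i - sin t * snd p $ i) * g1 i (interpolant t p)\<bar>
           \<le> V i (X (fst p)) * Q (snd p) + (16 * G (X (fst p)) + c i i i) * (\<bar>snd p $ i\<bar> * Q (snd p))" for i
        proof -
          let ?a = "X (fst p) $ i * g1 i (interpolant t p)" and ?b = "snd p $ i * g1 i (interpolant t p)"
          have "\<bar>(cos t * X (fst p) $ i - sin t * snd p $ i) * g1 i (interpolant t p)\<bar> = \<bar>cos t * ?a - sin t * ?b\<bar>"
            by (simp add: algebra_simps)
          also have "\<dots> \<le> \<bar>cos t\<bar> * \<bar>?a\<bar> + \<bar>sin t\<bar> * \<bar>?b\<bar>"
            using abs_triangle_ineq4[of "cos t * ?a" "sin t * ?b"] by (simp only: abs_mult)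
          also have "\<dots> \<le> 1 * \<bar>?a\<bar> + 1 * \<bar>?b\<bar>" by (intro add_mono mult_right_mono) auto
          also have "\<bar>?a\<bar> \<le> V i (X (fst p)) * Q (snd p)"
            using V(2)[OF elim, of i t "snd p"] by (simp add: mult.commute)
          also have "\<bar>?b\<bar> \<le> (16 * G (X (fst p)) + c i i i) * (\<bar>snd p $ i\<bar> * Q (snd p))"
            using mult_left_mono[OF G(4)[OF elim, of i t "snd p"] abs_ge_zero[of "snd p $ i"]]
            by (simp add: abs_mult mult_ac)
          finally show ?thesis by simp
        qed
        then show "\<bar>?F' t p\<bar> \<le> ?w p" by (intro order_trans[OF sum_abs] sum_mono)
      qed
    qed
  qed
qed

text \<open>Fubini is used in both orders: integrating over the Gaussian variable first allows
  integration by parts at fixed \<open>X\<close>, integrating over \<open>X\<close> first allows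
  \<open>stein_bound\<close> with \<open>u = sin \<theta>\<close> at a fixed shift
  \<open>cos \<theta> *\<^sub>R z\<close>.\<close>

lemma \<phi>_derivative_bound:
  assumes \<theta>: "0 \<le> \<theta>" "\<theta> \<le> pi / 2"
  shows "\<bar>\<integral>p. (\<Sum>i\<in>UNIV. (cos \<theta> * X (fst p) $ i - sin \<theta> * snd p $ i) * g1 i (interpolant \<theta> p)) \<partial>(M \<Otimes>\<^sub>M P)\<bar>
     \<le> cos \<theta> * (sin \<theta>)\<^sup>2 * \<Lambda>"
proof -
  let ?R = "M \<Otimes>\<^sub>M P" and ?s = "sin \<theta>" and ?c = "cos \<theta>"
  have sc: "0 \<le> ?s" "?s \<le> 1" "0 \<le> ?c" using \<theta> by (auto intro!: sin_ge_zero cos_ge_zero)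
  note I = integrable_path
  have z: "(\<integral>p. snd p $ i * g1 i (interpolant \<theta> p) \<partial>?R) = ?c * (\<Sum>j\<in>A i. \<sigma> i j * (\<integral>p. g2 i j (interpolant \<theta> p) \<partial>?R))" for i
  proof -
    have "(\<integral>p. snd p $ i * g1 i (interpolant \<theta> p) \<partial>?R) = (\<integral>\<omega>. \<integral>z. z $ i * g1 i (?s *\<^sub>R X \<omega> + ?c *\<^sub>R z) \<partial>P \<partial>M)"
      using pair.integral_fst'[OF I(3)] by (simp add: interpolant_def)
    also have "\<dots> = (\<integral>\<omega>. ?c * (\<Sum>j\<in>A i. \<sigma> i j * (\<integral>z. g2 i j (?s *\<^sub>R X \<omega> + ?c *\<^sub>R z) \<partial>P)) \<partial>M)"
      by (intro Bochner_Integration.integral_cong refl gaussian_integration_by_parts) simp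
    also have "\<dots> = ?c * (\<Sum>j\<in>A i. \<sigma> i j * (\<integral>\<omega>. \<integral>z. g2 i j (?s *\<^sub>R X \<omega> + ?c *\<^sub>R z) \<partial>P \<partial>M))"
    proof -
      have i2: "integrable M (\<lambda>\<omega>. \<sigma> i j * (\<integral>z. g2 i j (?s *\<^sub>R X \<omega> + ?c *\<^sub>R z) \<partial>P))" if "j \<in> A i" for j
        using pair.integrable_fst'[OF I(4)[OF that]] by (simp add: interpolant_def)
      show ?thesis
        by (simp only: integral_mult_right_zero Bochner_Integration.integral_sum[OF i2])
    qed
    also have "\<dots> = ?c * (\<Sum>j\<in>A i. \<sigma> i j * (\<integral>p. g2 i j (interpolant \<theta> p) \<partial>?R))"
      using pair.integral_fst'[OF I(4)] by (simp add: interpolant_def)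
    finally show ?thesis .
  qed
  define \<Psi> where "\<Psi> z = (\<Sum>i\<in>UNIV. (\<integral>\<omega>. X \<omega> $ i * g1 i (?s *\<^sub>R X \<omega> + ?c *\<^sub>R z) \<partial>M)
        - ?s * (\<Sum>j\<in>A i. \<sigma> i j * (\<integral>\<omega>. g2 i j (?s *\<^sub>R X \<omega> + ?c *\<^sub>R z) \<partial>M)))" for z
  have iX: "integrable P (\<lambda>z. \<integral>\<omega>. X \<omega> $ i * g1 i (?s *\<^sub>R X \<omega> + ?c *\<^sub>R z) \<partial>M)"
    "(\<integral>z. \<integral>\<omega>. X \<omega> $ i * g1 i (?s *\<^sub>R X \<omega> + ?c *\<^sub>R z) \<partial>M \<partial>P) = (\<integral>p. X (fst p) $ i * g1 i (interpolant \<theta> p) \<partial>?R)" for i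
    using pair.integrable_snd[of "\<lambda>x y. X x $ i * g1 i (interpolant \<theta> (x, y))"]
      pair.integral_snd[of "\<lambda>x y. X x $ i * g1 i (interpolant \<theta> (x, y))"] I(2)[of i \<theta>]
    by (simp_all add: interpolant_def case_prod_beta')
  have i2: "integrable P (\<lambda>z. \<integral>\<omega>. g2 i j (?s *\<^sub>R X \<omega> + ?c *\<^sub>R z) \<partial>M)"
    "(\<integral>z. \<integral>\<omega>. g2 i j (?s *\<^sub>R X \<omega> + ?c *\<^sub>R z) \<partial>M \<partial>P) = (\<integral>p. g2 i j (interpolant \<theta> p) \<partial>?R)" if "j \<in> A i" for i j
    using pair.integrable_snd[of "\<lambda>x y. g2 i j (interpolant \<theta> (x, y))"]
      pair.integral_snd[of "\<lambda>x y. g2 i j (interpolant \<theta> (x, y))"] I(4)[OF that, of \<theta>]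
    by (simp_all add: interpolant_def case_prod_beta')
  have i2s: "integrable P (\<lambda>z. ?s * (\<Sum>j\<in>A i. \<sigma> i j * (\<integral>\<omega>. g2 i j (?s *\<^sub>R X \<omega> + ?c *\<^sub>R z) \<partial>M)))" for i
    by (intro integrable_mult_right Bochner_Integration.integrable_sum i2)
  have Psi: "(\<Sum>i\<in>UNIV. (\<integral>p. X (fst p) $ i * g1 i (interpolant \<theta> p) \<partial>?R)
      - ?s * (\<Sum>j\<in>A i. \<sigma> i j * (\<integral>p. g2 i j (interpolant \<theta> p) \<partial>?R))) = (\<integral>z. \<Psi> z \<partial>P)"
  proof -
    have "(\<integral>z. (\<Sum>j\<in>A i. \<sigma> i j * (\<integral>\<omega>. g2 i j (?s *\<^sub>R X \<omega> + ?c *\<^sub>R z) \<partial>M)) \<partial>P)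
        = (\<Sum>j\<in>A i. \<sigma> i j * (\<integral>p. g2 i j (interpolant \<theta> p) \<partial>?R))" for i
      using i2 by (subst Bochner_Integration.integral_sum) auto
    then have "(\<integral>z. (\<integral>\<omega>. X \<omega> $ i * g1 i (?s *\<^sub>R X \<omega> + ?c *\<^sub>R z) \<partial>M)
        - ?s * (\<Sum>j\<in>A i. \<sigma> i j * (\<integral>\<omega>. g2 i j (?s *\<^sub>R X \<omega> + ?c *\<^sub>R z) \<partial>M)) \<partial>P)
      = (\<integral>p. X (fst p) $ i * g1 i (interpolant \<theta> p) \<partial>?R) - ?s * (\<Sum>j\<in>A i. \<sigma> i j * (\<integral>p. g2 i j (interpolant \<theta> p) \<partial>?R))" for i
      by (subst Bochner_Integration.integral_diff[OF iX(1) i2s]) (simp only: iX(2) integral_mult_right_zero)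
    then show ?thesis
      unfolding \<Psi>_def
      by (subst Bochner_Integration.integral_sum[OF Bochner_Integration.integrable_diff[OF iX(1) i2s]]) simp
  qed
  define x where "x i = (\<integral>p. X (fst p) $ i * g1 i (interpolant \<theta> p) \<partial>?R)" for i
  define y where "y i = (\<Sum>j\<in>A i. \<sigma> i j * (\<integral>p. g2 i j (interpolant \<theta> p) \<partial>?R))" for i
  have split: "(?c * X (fst p) $ i - ?s * snd p $ i) * g1 i (interpolant \<theta> p)
      = ?c * (X (fst p) $ i * g1 i (interpolant \<theta> p)) - ?s * (snd p $ i * g1 i (interpolant \<theta> p))" for p i
    by (simp add: algebra_simps)
  have "(\<integral>p. (?c * X (fst p) $ i - ?s * snd p $ i) * g1 i (interpolant \<theta> p) \<partial>?R) = ?c * (x i - ?s * y i)" for i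
    unfolding split
    by (subst Bochner_Integration.integral_diff)
      (simp_all add: I(2,3) z x_def[symmetric] y_def[symmetric] algebra_simps)
  moreover have "integrable ?R (\<lambda>p. (?c * X (fst p) $ i - ?s * snd p $ i) * g1 i (interpolant \<theta> p))" for i
    unfolding split by (intro Bochner_Integration.integrable_diff integrable_mult_right I(2,3))
  ultimately have "(\<integral>p. (\<Sum>i\<in>UNIV. (?c * X (fst p) $ i - ?s * snd p $ i) * g1 i (interpolant \<theta> p)) \<partial>?R)
      = ?c * (\<Sum>i\<in>UNIV. x i - ?s * y i)"
    by (simp add: Bochner_Integration.integral_sum sum_distrib_left)
  then have eq: "(\<integral>p. (\<Sum>i\<in>UNIV. (?c * X (fst p) $ i - ?s * snd p $ i) * g1 i (interpolant \<theta> p)) \<partial>?R)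
      = ?c * (\<integral>z. \<Psi> z \<partial>P)"
    using Psi unfolding x_def y_def by simp
  have iPsi: "integrable P \<Psi>"
    unfolding \<Psi>_def[abs_def] by (intro Bochner_Integration.integrable_sum Bochner_Integration.integrable_diff iX i2s)
  have "\<bar>\<integral>z. \<Psi> z \<partial>P\<bar> \<le> (\<integral>z. \<bar>\<Psi> z\<bar> \<partial>P)" by (rule integral_abs_bound)
  also have "\<dots> \<le> (\<integral>z. ?s\<^sup>2 * \<Lambda> \<partial>P)"
    using stein_bound[OF sc(1,2)] by (intro integral_mono integrable_abs iPsi N.integrable_const) (simp add: \<Psi>_def)
  also have "\<dots> = ?s\<^sup>2 * \<Lambda>" using N.prob_space by simp
  finally have "?c * \<bar>\<integral>z. \<Psi> z \<partial>P\<bar> \<le> ?c * (?s\<^sup>2 * \<Lambda>)" by (rule mult_left_mono[OF _ sc(3)])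
  then show ?thesis unfolding eq abs_mult using sc(3) by (simp add: mult.assoc)
qed

theorem normal_comparison:
  shows "integrable M (\<lambda>\<omega>. g (X \<omega>))" and "integrable P g"
    and "\<bar>(\<integral>\<omega>. g (X \<omega>) \<partial>M) - (\<integral>z. g z \<partial>P)\<bar> \<le> \<Lambda> / 3"
proof -
  have one: "integrable M (\<lambda>_. 1::real)" "integrable P (\<lambda>_. 1::real)" by simp_all
  obtain K where K: "K \<ge> 0" "\<And>x. \<bar>g x\<bar> \<le> K * Q x" using polynomial_growth by blast
  show gP: "integrable P g"
  proof (rule Bochner_Integration.integrable_bound)
    show "integrable P (\<lambda>z. K * Q z)" by (intro integrable_mult_right integrable_Q)
    show "AE z in P. norm (g z) \<le> norm (K * Q z)"
      using order_trans[OF K(2) abs_ge_self] by (intro AE_I2) simp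
  qed measurable
  obtain G where G: "dominates UNIV G" using ex_dominating by blast
  show gX: "integrable M (\<lambda>\<omega>. g (X \<omega>))"
  proof (rule abs_integral_le)
    show "integrable M (\<lambda>\<omega>. Q (0 :: real ^ 'n) * G (X \<omega>))" using dominatesD(3)[OF G] by simp
    show "AE \<omega> in M. \<bar>g (X \<omega>)\<bar> \<le> Q (0 :: real ^ 'n) * G (X \<omega>)"
      using AE_good
    proof eventually_elim
      case (elim \<omega>)
      from dominatesD(4)[OF G elim, of 1 0] show ?case by simp
    qed
  qed measurable
  have \<phi>0: "\<phi> 0 = (\<integral>z. g z \<partial>P)"
    unfolding \<phi>_def interpolant_def
    using integrable_product_pair(2)[OF prob_space_axioms N.prob one(1) gP] prob_space by simp
  have \<phi>1: "\<phi> (pi / 2) = (\<integral>\<omega>. g (X \<omega>) \<partial>M)"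
    unfolding \<phi>_def interpolant_def
    using integrable_product_pair(2)[OF prob_space_axioms N.prob gX one(2)] N.prob_space by simp
  let ?D = "\<lambda>\<theta>. \<integral>p. (\<Sum>i\<in>UNIV. (cos \<theta> * X (fst p) $ i - sin \<theta> * snd p $ i) * g1 i (interpolant \<theta> p)) \<partial>(M \<Otimes>\<^sub>M P)"
  \<comment> \<open>\<open>sin \<theta> ^ 3 / 3\<close> is a primitive of cos \<theta> sin^2
    \<theta>. Monotonicity for \<open>e = 1\<close> and \<open>e = -1\<close> replaces integrating
    the derivative of \<open>\<phi>\<close>, whose continuity is not established.\<close>
  have d: "((\<lambda>\<theta>. e * \<phi> \<theta> - \<Lambda> * sin \<theta> ^ 3 / 3) has_real_derivative e * ?D \<theta> - cos \<theta> * (sin \<theta>)\<^sup>2 * \<Lambda>) (at \<theta>)" for e \<theta>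
    by (rule derivative_eq_intros \<phi>_derivative refl | simp add: power2_eq_square algebra_simps)+
  have "e * \<phi> (pi / 2) - \<Lambda> * sin (pi / 2) ^ 3 / 3 \<le> e * \<phi> 0 - \<Lambda> * sin 0 ^ 3 / 3" if e: "\<bar>e\<bar> = 1" for e
  proof (rule DERIV_nonpos_imp_nonincreasing[of 0 "pi / 2"])
    fix \<theta> :: real assume \<theta>: "0 \<le> \<theta>" "\<theta> \<le> pi / 2"
    have "e * ?D \<theta> \<le> \<bar>e\<bar> * \<bar>?D \<theta>\<bar>" by (simp only: abs_mult[symmetric] abs_ge_self)
    also have "\<dots> \<le> cos \<theta> * (sin \<theta>)\<^sup>2 * \<Lambda>" using \<phi>_derivative_bound[OF \<theta>] e by simp
    finally have "e * ?D \<theta> - cos \<theta> * (sin \<theta>)\<^sup>2 * \<Lambda> \<le> 0" by simp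
    then show "\<exists>y. ((\<lambda>\<theta>. e * \<phi> \<theta> - \<Lambda> * sin \<theta> ^ 3 / 3) has_real_derivative y) (at \<theta>) \<and> y \<le> 0"
      using d by blast
  qed simp
  note key = this
  have "\<phi> (pi / 2) - \<phi> 0 \<le> \<Lambda> / 3" using key[of 1] by simp
  moreover have "\<phi> 0 - \<phi> (pi / 2) \<le> \<Lambda> / 3" using key[of "-1"] by simp
  ultimately show "\<bar>(\<integral>\<omega>. g (X \<omega>) \<partial>M) - (\<integral>z. g z \<partial>P)\<bar> \<le> \<Lambda> / 3"
    unfolding \<phi>0 \<phi>1 by linarith
qed

end

section \<open>The bound\<close>

lemma partial_diff_has_derivative:
  assumes "partial_diff i f"
  shows "((\<lambda>t. f (x + t *\<^sub>R axis i 1)) has_real_derivative pd i f (x + t *\<^sub>R axis i 1)) (at t)"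
proof -
  have "((\<lambda>s. f ((x + t *\<^sub>R axis i 1) + s *\<^sub>R axis i 1)) has_real_derivative pd i f (x + t *\<^sub>R axis i 1)) (at 0)"
    using assms unfolding partial_diff_def pd_def by (simp add: field_differentiable_derivI)
  then show ?thesis
    using DERIV_shift[of "\<lambda>t. f (x + t *\<^sub>R axis i 1)" _ 0 t] by (simp add: scaleR_add_left ac_simps)
qed

text \<open>Differentiability along the axes gives separate continuity, hence measurability, even
  though \<open>h\<close> may be discontinuous as a function of all coordinates.\<close>

lemma borel_measurable_partial_diff:
  assumes "\<And>i. partial_diff i f"
  shows "f \<in> borel_measurable borel"
proof (rule borel_measurable_separately_continuous)
  show "continuous_on UNIV (\<lambda>t. f (x + t *\<^sub>R axis i 1))" for x i
    using partial_diff_has_derivative[OF assms] by (meson DERIV_isCont continuous_at_imp_continuous_on)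
qed

lemma pd3_swap:
  assumes "thrice_partially_diff h"
  shows "pd3 h i j k = pd3 h j i k" and "pd3 h i j k = pd3 h i k j"
proof -
  have "pd j (pd i h) = pd i (pd j h)" "pd k (pd j (pd i h)) = pd j (pd k (pd i h))"
    using assms unfolding thrice_partially_diff_def by blast+
  then show "pd3 h i j k = pd3 h j i k" "pd3 h i j k = pd3 h i k j"
    by (simp_all add: pd3_def)
qed

lemma abs_le_supnorm: "supnorm f < \<infinity> \<Longrightarrow> \<bar>f x\<bar> \<le> enn2real (supnorm f)"
proof -
  assume fin: "supnorm f < \<infinity>"
  have "ennreal \<bar>f x\<bar> \<le> supnorm f" unfolding supnorm_def by (rule SUP_upper) simp
  then have "enn2real (ennreal \<bar>f x\<bar>) \<le> enn2real (supnorm f)"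
    using fin by (intro enn2real_mono) (simp_all add: less_top)
  then show ?thesis by simp
qed

text \<open>Composition with \<open>msk T\<close> makes all derivatives in directions outside
  \<open>T\<close> vanish, so a triple leaving \<open>T\<close> counts as bounded whatever
  \<open>h\<close> does there.\<close>

lemma cubic_fun_msk:
  fixes h :: "real ^ 'n \<Rightarrow> real" and T :: "'n set"
  assumes h: "thrice_partially_diff h"
    and diag: "\<And>i. i \<in> T \<Longrightarrow> supnorm (pd3 h i i i) < \<infinity>"
  shows "cubic_fun (\<lambda>x. h (msk T x)) (\<lambda>i x. if i \<in> T then pd i h (msk T x) else 0)
    (\<lambda>i j x. if i \<in> T \<and> j \<in> T then pd j (pd i h) (msk T x) else 0)
    (\<lambda>i j k. enn2real (supnorm (pd3 h i j k)))
    (\<lambda>i j k. i \<in> T \<and> j \<in> T \<and> k \<in> T \<longrightarrow> supnorm (pd3 h i j k) < \<infinity>)"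
proof
  have in_T: "msk T (x + t *\<^sub>R axis l 1) = msk T x + t *\<^sub>R axis l 1" if "l \<in> T" for x t l
    using that by (auto simp: vec_eq_iff axis_def)
  have notin_T: "msk T (x + t *\<^sub>R axis l 1) = msk T x" if "l \<notin> T" for x t l
    using that by (auto simp: vec_eq_iff axis_def)
  have h1: "partial_diff i h" and h2: "partial_diff j (pd i h)" and h3: "partial_diff k (pd j (pd i h))" for i j k
    using h unfolding thrice_partially_diff_def by blast+
  fix i j k :: 'n and x :: "real ^ 'n" and t :: real
  show "((\<lambda>t. h (msk T (x + t *\<^sub>R axis i 1))) has_real_derivative
      (if i \<in> T then pd i h (msk T (x + t *\<^sub>R axis i 1)) else 0)) (at t)"
    using partial_diff_has_derivative[OF h1, of "msk T x" i t] by (simp add: in_T notin_T)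
  show "((\<lambda>t. if i \<in> T then pd i h (msk T (x + t *\<^sub>R axis j 1)) else 0) has_real_derivative
      (if i \<in> T \<and> j \<in> T then pd j (pd i h) (msk T (x + t *\<^sub>R axis j 1)) else 0)) (at t)"
    using partial_diff_has_derivative[OF h2, of i "msk T x" j t] 
    by (cases "i \<in> T"; cases "j \<in> T") (simp_all add: in_T notin_T)
  show "\<bar>(if i \<in> T \<and> j \<in> T then pd j (pd i h) (msk T (x + t *\<^sub>R axis k 1)) else 0)
      - (if i \<in> T \<and> j \<in> T then pd j (pd i h) (msk T x) else 0)\<bar> \<le> enn2real (supnorm (pd3 h i j k)) * \<bar>t\<bar>"
    if ok: "i \<in> T \<and> j \<in> T \<and> k \<in> T \<longrightarrow> supnorm (pd3 h i j k) < \<infinity>"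
  proof (cases "i \<in> T \<and> j \<in> T \<and> k \<in> T")
    case True
    have "norm (pd j (pd i h) (msk T x + t *\<^sub>R axis k 1) - pd j (pd i h) (msk T x + 0 *\<^sub>R axis k 1))
       \<le> enn2real (supnorm (pd3 h i j k)) * norm (t - 0)"
    proof (rule field_differentiable_bound[where S=UNIV and f="\<lambda>t. pd j (pd i h) (msk T x + t *\<^sub>R axis k 1)"])
      show "((\<lambda>t. pd j (pd i h) (msk T x + t *\<^sub>R axis k 1)) has_real_derivative
          pd3 h i j k (msk T x + t *\<^sub>R axis k 1)) (at t within UNIV)" for t
        unfolding pd3_def by (rule partial_diff_has_derivative[OF h3])
      show "norm (pd3 h i j k (msk T x + t *\<^sub>R axis k 1)) \<le> enn2real (supnorm (pd3 h i j k))" for t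
        using abs_le_supnorm ok True by simp
    qed auto
    then show ?thesis using True by (simp add: in_T)
  next
    case False
    then show ?thesis by (cases "k \<in> T") (auto simp: notin_T)
  qed
  show "0 \<le> enn2real (supnorm (pd3 h i j k))" by simp
  show "enn2real (supnorm (pd3 h i j k)) = enn2real (supnorm (pd3 h i k j))"
    by (simp add: pd3_swap(2)[OF h, of i j k])
  show "i \<in> T \<and> i \<in> T \<and> i \<in> T \<longrightarrow> supnorm (pd3 h i i i) < \<infinity>" using diag by blast
qed

text \<open>A coordinate outside \<open>T\<close> vanishes almost surely, in \<open>X\<close> as well as in the Gaussian vector, so
  \<open>h\<close> may be replaced by \<open>h \<circ> msk T\<close>. The derivatives of \<open>h\<close> in that direction are not controlled by
  the bound.\<close>

lemma normal_approximation_finite: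
  fixes M :: "'a measure" and X :: "'a \<Rightarrow> real ^ 'n" and P :: "(real ^ 'n) measure" and S :: "real ^ 'n ^ 'n"
    and A :: "'n \<Rightarrow> 'n set" and B :: "'n \<Rightarrow> 'n \<Rightarrow> 'n set" and h :: "real ^ 'n \<Rightarrow> real"
  assumes M: "prob_space M" and X: "X \<in> borel_measurable M"
    and third: "\<And>i. integrable M (\<lambda>\<omega>. \<bar>X \<omega> $ i\<bar> ^ 3)"
    and centred: "\<And>i. (\<integral>\<omega>. X \<omega> $ i \<partial>M) = 0"
    and S: "\<And>i j. S $ i $ j = (\<integral>\<omega>. X \<omega> $ i * X \<omega> $ j \<partial>M)"
    and indA: "\<And>i. indep_subvectors M X (- A i) {i}"
    and A_le_B: "\<And>i j. j \<in> A i \<Longrightarrow> A i \<subseteq> B i j"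
    and indB: "\<And>i j. j \<in> A i \<Longrightarrow> indep_subvectors M X (- B i j) {i, j}"
    and mvn: "is_MVN0 P S" and h: "thrice_partially_diff h"
    and fin: "\<And>i j k. j \<in> A i \<Longrightarrow> k \<in> B i j \<Longrightarrow>
      0 < \<bar>S $ i $ j\<bar> * (\<integral>\<omega>. \<bar>X \<omega> $ k\<bar> \<partial>M) + (\<integral>\<omega>. \<bar>X \<omega> $ i * X \<omega> $ j * X \<omega> $ k\<bar> \<partial>M) \<Longrightarrow>
      supnorm (pd3 h i j k) < \<infinity>"
  defines "c \<equiv> \<lambda>i j k. enn2real (supnorm (pd3 h i j k))"
  shows "integrable M (\<lambda>\<omega>. h (X \<omega>))" and "integrable P h"
    and "\<bar>(\<integral>\<omega>. h (X \<omega>) \<partial>M) - (\<integral>z. h z \<partial>P)\<bar>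
      \<le> (\<Sum>i\<in>UNIV. \<Sum>j\<in>A i. \<Sum>k\<in>B i j.
          (\<bar>S $ i $ j\<bar> * (\<integral>\<omega>. \<bar>X \<omega> $ k\<bar> \<partial>M) + (\<integral>\<omega>. \<bar>X \<omega> $ i * X \<omega> $ j * X \<omega> $ k\<bar> \<partial>M)) * c i j k) / 3
        + (\<Sum>i\<in>UNIV. \<Sum>j\<in>A i. \<Sum>k\<in>A i. (\<integral>\<omega>. \<bar>X \<omega> $ i * X \<omega> $ j * X \<omega> $ k\<bar> \<partial>M) * c i j k) / 6"
proof -
  interpret prob_space M by fact
  note [measurable] = X
  define T where "T = {i. \<not> (AE \<omega> in M. X \<omega> $ i = 0)}"
  define ok where "ok i j k \<longleftrightarrow> (i \<in> T \<and> j \<in> T \<and> k \<in> T \<longrightarrow> supnorm (pd3 h i j k) < \<infinity>)" for i j k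
  have int2: "integrable M (\<lambda>\<omega>. X \<omega> $ i * X \<omega> $ i)" for i
    using integrable_prod3[of "\<lambda>\<omega>. X \<omega> $ i" "\<lambda>\<omega>. X \<omega> $ i" "\<lambda>_. 1"] by (simp add: third)
  have int1: "integrable M (\<lambda>\<omega>. X \<omega> $ i)" for i
    using integrable_prod3[of "\<lambda>\<omega>. X \<omega> $ i" "\<lambda>_. 1" "\<lambda>_. 1"] by (simp add: third)
  have int3: "integrable M (\<lambda>\<omega>. \<bar>X \<omega> $ i * X \<omega> $ j * X \<omega> $ k\<bar>)" for i j k
    by (intro integrable_abs integrable_prod3) (simp_all add: third)
  have abs_pos: "0 < (\<integral>\<omega>. \<bar>X \<omega> $ i\<bar> \<partial>M)" if "i \<in> T" for i
  proof -
    have "(\<integral>\<omega>. \<bar>X \<omega> $ i\<bar> \<partial>M) \<noteq> 0"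
      using that integral_nonneg_eq_0_iff_AE[OF integrable_abs[OF int1[of i]]] by (auto simp: T_def)
    moreover have "0 \<le> (\<integral>\<omega>. \<bar>X \<omega> $ i\<bar> \<partial>M)" by (intro integral_nonneg_AE) auto
    ultimately show ?thesis by linarith
  qed
  have S_pos: "0 < S $ i $ i" if "i \<in> T" for i
  proof -
    have "S $ i $ i \<noteq> 0"
      using that integral_nonneg_eq_0_iff_AE[OF int2[of i]] by (auto simp: T_def S)
    moreover have "0 \<le> S $ i $ i" unfolding S by (intro integral_nonneg_AE) auto
    ultimately show ?thesis by linarith
  qed
  have nonneg: "0 \<le> (\<integral>\<omega>. \<bar>X \<omega> $ i * X \<omega> $ j * X \<omega> $ k\<bar> \<partial>M)" "0 \<le> (\<integral>\<omega>. \<bar>X \<omega> $ i\<bar> \<partial>M)" for i j k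
    by (intro integral_nonneg_AE AE_I2 abs_ge_zero)+
  have indep: "indep_var borel (\<lambda>\<omega>. f (X \<omega> $ j)) borel (\<lambda>\<omega>. f (X \<omega> $ i))"
    if j: "j \<notin> A i" and f: "f \<in> borel_measurable borel" for i j and f :: "real \<Rightarrow> real"
  proof -
    have "(\<lambda>x::real^'n. f (x $ l)) \<in> borel_measurable borel" for l
      by (rule measurable_compose[OF vec_nth_measurable f])
    from indep_subvectors_msk[OF M indA this this, of i j i] j show ?thesis by simp
  qed
  \<comment> \<open>Otherwise X_i would be independent of itself and, being centred, have variance
    0.\<close>
  have self: "i \<in> A i" if "i \<in> T" for i
  proof (rule ccontr)
    assume "i \<notin> A i"
    from indep_var_lebesgue_integral[OF indep[OF this, of "\<lambda>x. x"] int1 int1]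
    have "S $ i $ i = 0" by (simp add: S centred)
    with S_pos[OF that] show False by simp
  qed
  have weight: "0 < \<bar>S $ i $ i\<bar> * (\<integral>\<omega>. \<bar>X \<omega> $ j\<bar> \<partial>M) + (\<integral>\<omega>. \<bar>X \<omega> $ i * X \<omega> $ i * X \<omega> $ j\<bar> \<partial>M)"
    if "i \<in> T" "j \<in> T" for i j
    using S_pos[OF that(1)] abs_pos[OF that(2)] nonneg(1)[of i i j] by (intro add_pos_nonneg) auto
  have fin_iij: "supnorm (pd3 h i i j) < \<infinity>" if "i \<in> T" "j \<in> T" "j \<in> A i" for i j
    using that self[OF that(1)] A_le_B[OF self[OF that(1)]] by (intro fin weight) auto
  have ok_iji: "ok i j i" if "j \<in> A i" for i j
    using fin_iij[of i j] that pd3_swap(2)[OF h, of i j i] by (auto simp: ok_def)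
  have ok_ijj: "ok i j j" if j: "j \<in> A i" for i j
    unfolding ok_def
  proof (intro impI)
    assume T: "i \<in> T \<and> j \<in> T \<and> j \<in> T"
    show "supnorm (pd3 h i j j) < \<infinity>"
    proof (cases "i \<in> A j")
      case True
      have "pd3 h i j j = pd3 h j j i"
        using pd3_swap(1)[OF h, of i j j] pd3_swap(2)[OF h, of j i j] by simp
      then show ?thesis using fin_iij[of j i] T True by simp
    next
      \<comment> \<open>\<open>i \<notin> A j\<close> makes X_i and X_j independent. With absolute
        values the mean of |X_i| |X_j| factorises into two positive numbers, so X_i X_j X_j cannot
        vanish almost surely.\<close>
      case False
      have "(\<integral>\<omega>. \<bar>X \<omega> $ i * X \<omega> $ j * X \<omega> $ j\<bar> \<partial>M) \<noteq> 0"
      proof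
        assume 0: "(\<integral>\<omega>. \<bar>X \<omega> $ i * X \<omega> $ j * X \<omega> $ j\<bar> \<partial>M) = 0"
        note ind = indep_var_lebesgue_integral[OF indep[OF False, of "\<lambda>x. \<bar>x\<bar>"]]
        have "AE \<omega> in M. \<bar>X \<omega> $ i * X \<omega> $ j * X \<omega> $ j\<bar> = 0"
          using 0 by (subst integral_nonneg_eq_0_iff_AE[OF int3, symmetric]) auto
        then have "AE \<omega> in M. \<bar>X \<omega> $ i\<bar> * \<bar>X \<omega> $ j\<bar> = 0" by (rule eventually_mono) auto
        then have "(\<integral>\<omega>. \<bar>X \<omega> $ i\<bar> * \<bar>X \<omega> $ j\<bar> \<partial>M) = 0" by (rule integral_eq_zero_AE)
        then show False using ind int1 abs_pos[of i] abs_pos[of j] T by (simp add: integrable_abs)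
      qed
      then have pos: "0 < (\<integral>\<omega>. \<bar>X \<omega> $ i * X \<omega> $ j * X \<omega> $ j\<bar> \<partial>M)"
        using nonneg(1)[of i j j] by linarith
      have "0 < \<bar>S $ i $ j\<bar> * (\<integral>\<omega>. \<bar>X \<omega> $ j\<bar> \<partial>M) + (\<integral>\<omega>. \<bar>X \<omega> $ i * X \<omega> $ j * X \<omega> $ j\<bar> \<partial>M)"
        by (intro add_nonneg_pos mult_nonneg_nonneg abs_ge_zero nonneg pos)
      then show ?thesis using j A_le_B[OF j] by (intro fin) auto
    qed
  qed
  \<comment> \<open>A triple without a bound has weight 0 by \<open>fin\<close>; both summands of
    the weight are nonnegative, so each of them vanishes.\<close>
  have bad: "i \<in> T \<and> j \<in> T \<and> k \<in> T \<and> \<bar>S $ i $ j\<bar> * (\<integral>\<omega>. \<bar>X \<omega> $ k\<bar> \<partial>M) = 0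
      \<and> (\<integral>\<omega>. \<bar>X \<omega> $ i * X \<omega> $ j * X \<omega> $ k\<bar> \<partial>M) = 0"
    if "j \<in> A i" "k \<in> B i j" "\<not> ok i j k" for i j k
  proof -
    have "\<not> 0 < \<bar>S $ i $ j\<bar> * (\<integral>\<omega>. \<bar>X \<omega> $ k\<bar> \<partial>M) + (\<integral>\<omega>. \<bar>X \<omega> $ i * X \<omega> $ j * X \<omega> $ k\<bar> \<partial>M)"
      using fin[OF that(1,2)] that(3) by (auto simp: ok_def)
    moreover have "0 \<le> \<bar>S $ i $ j\<bar> * (\<integral>\<omega>. \<bar>X \<omega> $ k\<bar> \<partial>M)"
      using nonneg by (intro mult_nonneg_nonneg) auto
    ultimately show ?thesis using that(3) nonneg(1)[of i j k] unfolding ok_def by linarith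
  qed
  let ?g1 = "\<lambda>i x. if i \<in> T then pd i h (msk T x) else 0"
  let ?g2 = "\<lambda>i j x. if i \<in> T \<and> j \<in> T then pd j (pd i h) (msk T x) else 0"
  define g where "g x = h (msk T x)" for x
  interpret cubic_fun g ?g1 ?g2 c ok
    unfolding c_def ok_def[abs_def] g_def[abs_def]
    by (rule cubic_fun_msk[OF h]) (rule fin_iij, assumption, assumption, rule self)
  interpret L: normal_comparison M g ?g1 ?g2 c ok X A B P S
  proof -
    have loc: "local_dependence M g ?g1 ?g2 c ok X A B"
    proof
      fix i j k and x :: "real ^ 'n"
      show "(if i \<in> T then pd i h (msk T x) else 0) = 0" if "i \<notin> A i" using self that by auto
      assume jk: "j \<in> A i" "k \<in> B i j" "\<not> ok i j k"
      note b = bad[OF jk]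
      have "AE \<omega> in M. \<bar>X \<omega> $ i * X \<omega> $ j * X \<omega> $ k\<bar> = 0"
        using b by (subst integral_nonneg_eq_0_iff_AE[OF int3, symmetric]) auto
      then show "AE \<omega> in M. X \<omega> $ i * X \<omega> $ j * X \<omega> $ k = 0" by (rule eventually_mono) simp
      show "(\<integral>\<omega>. X \<omega> $ i * X \<omega> $ j \<partial>M) = 0"
        using b abs_pos[of k] unfolding S[symmetric] by auto
    qed (use X third centred indA A_le_B indB ok_iji ok_ijj in auto)
    interpret local_dependence M g ?g1 ?g2 c ok X A B by (rule loc)
    interpret G: centred_gaussian P S by (rule centred_gaussian.intro[OF mvn])
    show "normal_comparison M g ?g1 ?g2 c ok X A B P S"
      by unfold_locales (simp add: S \<sigma>_def)
  qed
  have [measurable]: "h \<in> borel_measurable borel"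
    using h unfolding thrice_partially_diff_def by (intro borel_measurable_partial_diff) blast
  have eqX: "AE \<omega> in M. g (X \<omega>) = h (X \<omega>)"
  proof -
    have "AE \<omega> in M. \<forall>i. i \<notin> T \<longrightarrow> X \<omega> $ i = 0"
      unfolding AE_all_countable by (auto simp: T_def)
    then show ?thesis
    proof eventually_elim
      case (elim \<omega>)
      then have "msk T (X \<omega>) = X \<omega>" by (auto simp: vec_eq_iff)
      then show ?case by (simp add: g_def)
    qed
  qed
  have eqZ: "AE z in P. g z = h z"
  proof -
    have "AE z in P. i \<notin> T \<longrightarrow> z $ i = 0" for i
    proof (cases "i \<in> T")
      case False
      then have "AE \<omega> in M. X \<omega> $ i * X \<omega> $ i = 0" by (auto simp: T_def)
      then have "S $ i $ i = 0" unfolding S by (rule integral_eq_zero_AE)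
      from L.N.var_zero[OF this] show ?thesis by auto
    qed simp
    then have "AE z in P. \<forall>i. i \<notin> T \<longrightarrow> z $ i = 0"
      unfolding AE_all_countable by blast
    then show ?thesis
    proof eventually_elim
      case (elim z)
      then have "msk T z = z" by (auto simp: vec_eq_iff)
      then show ?case by (simp add: g_def)
    qed
  qed
  have gm: "g \<in> borel_measurable borel" by (rule L.g_measurable)
  note [measurable] = gm
  show iX: "integrable M (\<lambda>\<omega>. h (X \<omega>))"
    using L.normal_comparison(1) by (subst integrable_cong_AE[OF _ _ eqX, symmetric]) simp_all
  show iZ: "integrable P h"
    using L.normal_comparison(2) by (subst integrable_cong_AE[OF _ _ eqZ, symmetric]) simp_all
  have E: "(\<integral>\<omega>. g (X \<omega>) \<partial>M) = (\<integral>\<omega>. h (X \<omega>) \<partial>M)" "(\<integral>z. g z \<partial>P) = (\<integral>z. h z \<partial>P)"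
    by (rule integral_cong_AE[OF _ _ eqX]; measurable) (rule integral_cong_AE[OF _ _ eqZ]; measurable)
  have "L.\<sigma> i j = S $ i $ j" for i j unfolding L.\<sigma>_def S ..
  then show "\<bar>(\<integral>\<omega>. h (X \<omega>) \<partial>M) - (\<integral>z. h z \<partial>P)\<bar>
      \<le> (\<Sum>i\<in>UNIV. \<Sum>j\<in>A i. \<Sum>k\<in>B i j.
          (\<bar>S $ i $ j\<bar> * (\<integral>\<omega>. \<bar>X \<omega> $ k\<bar> \<partial>M) + (\<integral>\<omega>. \<bar>X \<omega> $ i * X \<omega> $ j * X \<omega> $ k\<bar> \<partial>M)) * c i j k) / 3
        + (\<Sum>i\<in>UNIV. \<Sum>j\<in>A i. \<Sum>k\<in>A i. (\<integral>\<omega>. \<bar>X \<omega> $ i * X \<omega> $ j * X \<omega> $ k\<bar> \<partial>M) * c i j k) / 6"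
    using L.normal_comparison(3) unfolding L.\<Lambda>_def E by (simp add: add_divide_distrib)
qed

section \<open>Uniform bounds for derivatives and moments\<close>

lemma supnorm_pd3_le_seminorm3:
  fixes h :: "real ^ ('n::{finite,linorder}) \<Rightarrow> real"
  assumes "thrice_partially_diff h"
  shows "supnorm (pd3 h i j k) \<le> seminorm3 h"
proof -
  have sorted: "supnorm (pd3 h i j k) \<le> seminorm3 h" if "i \<le> j" "j \<le> k" for i j k
    unfolding seminorm3_def using that by (intro SUP_upper2[of "(i, j, k)"]) auto
  note swap = pd3_swap[OF assms]
  have 1: "pd3 h i j k = pd3 h j i k" "pd3 h i j k = pd3 h i k j" "pd3 h i j k = pd3 h j k i"
    "pd3 h i j k = pd3 h k i j" "pd3 h i j k = pd3 h k j i"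
    using swap(1)[of i j k] swap(2)[of i j k] swap(2)[of j i k] swap(1)[of i k j] swap(1)[of j k i] by simp_all
  consider "i \<le> j" "j \<le> k" | "i \<le> k" "k \<le> j" | "j \<le> i" "i \<le> k" | "j \<le> k" "k \<le> i" | "k \<le> i" "i \<le> j" | "k \<le> j" "j \<le> i"
    by (meson linear)
  then show ?thesis
    by cases (use sorted 1 in metis)+
qed

context prob_space
begin

text \<open>The constant factor \<open>t\<close> plays the role of a third variable, which avoids Hoelder's inequality.\<close>

lemma expectation_moments_le:
  fixes f g :: "'a \<Rightarrow> real"
  assumes m: "f \<in> borel_measurable M" "g \<in> borel_measurable M"
    and int: "integrable M (\<lambda>\<omega>. \<bar>f \<omega>\<bar> ^ 3)" "integrable M (\<lambda>\<omega>. \<bar>g \<omega>\<bar> ^ 3)"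
    and le: "expectation (\<lambda>\<omega>. \<bar>f \<omega>\<bar> ^ 3) \<le> t ^ 3" "expectation (\<lambda>\<omega>. \<bar>g \<omega>\<bar> ^ 3) \<le> t ^ 3" and t: "0 \<le> t"
  shows "expectation (\<lambda>\<omega>. \<bar>f \<omega>\<bar>) \<le> t" and "expectation (\<lambda>\<omega>. \<bar>f \<omega> * g \<omega>\<bar>) \<le> t\<^sup>2"
proof -
  have tt: "expectation (\<lambda>\<omega>. \<bar>t\<bar> ^ 3) \<le> t ^ 3" using t by (simp add: prob_space)
  note E = expectation_prod3_le[OF m(1) _ _ int(1) _ _ le(1)]
  have 1: "expectation (\<lambda>\<omega>. \<bar>f \<omega> * t * t\<bar>) \<le> t ^ 3"
    by (rule E) (use tt in simp_all)
  have 2: "expectation (\<lambda>\<omega>. \<bar>f \<omega> * g \<omega> * t\<bar>) \<le> t ^ 3"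
    by (rule E) (use tt m int le in simp_all)
  \<comment> \<open>For \<open>t = 0\<close> the constant factor cannot be cancelled; then the third
    moment is 0 and \<open>f\<close> vanishes almost surely.\<close>
  have zero: "expectation (\<lambda>\<omega>. \<bar>f \<omega>\<bar>) = 0 \<and> expectation (\<lambda>\<omega>. \<bar>f \<omega> * g \<omega>\<bar>) = 0" if "t = 0"
  proof -
    have "expectation (\<lambda>\<omega>. \<bar>f \<omega>\<bar> ^ 3) = 0"
      using le(1) that by (intro antisym integral_nonneg_AE) auto
    then have "AE \<omega> in M. \<bar>f \<omega>\<bar> ^ 3 = 0"
      by (subst integral_nonneg_eq_0_iff_AE[OF int(1), symmetric]) auto
    then have "AE \<omega> in M. \<bar>f \<omega>\<bar> = 0" "AE \<omega> in M. \<bar>f \<omega> * g \<omega>\<bar> = 0"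
      by (auto elim: eventually_mono)
    from this[THEN integral_eq_zero_AE] show ?thesis by blast
  qed
  show "expectation (\<lambda>\<omega>. \<bar>f \<omega>\<bar>) \<le> t"
  proof (cases "t = 0")
    case False
    have "t\<^sup>2 * expectation (\<lambda>\<omega>. \<bar>f \<omega>\<bar>) \<le> t\<^sup>2 * t"
      using 1 t by (simp add: abs_mult power3_eq_cube power2_eq_square mult_ac)
    then show ?thesis using False t by (simp add: mult_le_cancel_left)
  qed (use zero in simp)
  show "expectation (\<lambda>\<omega>. \<bar>f \<omega> * g \<omega>\<bar>) \<le> t\<^sup>2"
  proof (cases "t = 0")
    case False
    have "t * expectation (\<lambda>\<omega>. \<bar>f \<omega> * g \<omega>\<bar>) \<le> t * t\<^sup>2"
      using 2 t by (simp add: abs_mult power3_eq_cube power2_eq_square mult_ac)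
    then show ?thesis using False t by (simp add: mult_le_cancel_left)
  qed (use zero in simp)
qed

end

lemma ennreal_sum_const_bound:
  fixes f :: "'i \<Rightarrow> 'j \<Rightarrow> 'k \<Rightarrow> ennreal" and r :: ennreal
  assumes "finite I" "\<And>i. i \<in> I \<Longrightarrow> finite (J i)" "\<And>i j. i \<in> I \<Longrightarrow> j \<in> J i \<Longrightarrow> finite (K i j)"
    and f: "\<And>i j k. f i j k \<le> r"
    and e: "\<And>i. i \<in> I \<Longrightarrow> (\<Sum>j\<in>J i. card (K i j)) \<le> e"
  shows "(\<Sum>i\<in>I. \<Sum>j\<in>J i. \<Sum>k\<in>K i j. f i j k) \<le> ennreal (real (card I) * real e) * r"
proof -
  have "(\<Sum>i\<in>I. \<Sum>j\<in>J i. \<Sum>k\<in>K i j. f i j k) \<le> (\<Sum>i\<in>I. \<Sum>j\<in>J i. \<Sum>k\<in>K i j. r)"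
    by (intro sum_mono f)
  also have "\<dots> = (\<Sum>i\<in>I. of_nat (\<Sum>j\<in>J i. card (K i j)) * r)"
    by (simp add: sum_distrib_right)
  also have "\<dots> \<le> (\<Sum>i\<in>I. of_nat e * r)"
    by (intro sum_mono mult_right_mono of_nat_mono e) auto
  also have "\<dots> = ennreal (real (card I) * real e) * r"
    by (simp add: ennreal_of_nat_eq_real_of_nat ennreal_mult' mult.assoc)
  finally show ?thesis .
qed

text \<open>Links the sums with values in [0, \<infinity>] to the real estimate, where
  \<open>enn2real\<close> sends an infinite supremum to 0. For weight 0 both sides are 0 even then,
  by the convention 0 \<cdot> \<infinity> = 0.\<close>

lemma ennreal_weight_supnorm:
  assumes "0 \<le> w" and "0 < w \<Longrightarrow> supnorm f < \<infinity>"
  shows "ennreal w * supnorm f = ennreal (w * enn2real (supnorm f))"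
proof (cases "w = 0")
  case False
  then have "ennreal (enn2real (supnorm f)) = supnorm f"
    using assms by (intro ennreal_enn2real) (simp add: less_top)
  then show ?thesis using assms(1) by (simp add: ennreal_mult)
qed simp

theorem theorem3p4:
  fixes M :: "'a measure" and N :: "'b measure"
    and X :: "'a \<Rightarrow> real ^ ('n::{finite,linorder})" and Z :: "'b \<Rightarrow> real ^ ('n::_)"
    and \<tau> :: "'n \<Rightarrow> real" and \<tau>_bar :: real and \<Sigma> :: "real ^ ('n::_) ^ ('n::_)"
    and A :: "'n \<Rightarrow> 'n set" and B :: "'n \<Rightarrow> 'n \<Rightarrow> 'n set" and \<eta> :: nat
    and h :: "real ^ ('n::_) \<Rightarrow> real"
  assumes "prob_space M" and "X \<in> borel_measurable M"
    and "\<And>i. integrable M (\<lambda>\<omega>. \<bar>X \<omega> $ i\<bar> ^ 3)"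
    and "\<And>i. (\<integral>\<omega>. X \<omega> $ i \<partial>M) = 0"
    and "\<And>i. \<tau> i = root 3 (\<integral>\<omega>. \<bar>X \<omega> $ i\<bar> ^ 3 \<partial>M)"
    and "\<tau>_bar = (SUP i. \<tau> i)"
    and "\<Sigma> = covariance_matrix M X"
    and "\<And>i. indep_subvectors M X (- A i) {i}"
    and "\<And>i j. j \<in> A i \<Longrightarrow> A i \<subseteq> B i j"
    and "\<And>i j. j \<in> A i \<Longrightarrow> indep_subvectors M X (- B i j) {i, j}"
    and "\<eta> = (SUP i. \<Sum>j\<in>A i. card (B i j))"
    and "prob_space N" and "Z \<in> borel_measurable N"
    and "is_MVN0 (distr N borel Z) \<Sigma>"
    and "thrice_partially_diff h"
  shows "let bound =
           ennreal (1 / 3) * (\<Sum>i\<in>UNIV. \<Sum>j\<in>A i. \<Sum>k\<in>B i j.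
             ennreal (\<bar>\<Sigma> $ i $ j\<bar> * (\<integral>\<omega>. \<bar>X \<omega> $ k\<bar> \<partial>M)
                      + (\<integral>\<omega>. \<bar>X \<omega> $ i * X \<omega> $ j * X \<omega> $ k\<bar> \<partial>M)) * supnorm (pd3 h i j k))
           + ennreal (1 / 6) * (\<Sum>i\<in>UNIV. \<Sum>j\<in>A i. \<Sum>k\<in>A i.
             ennreal (\<integral>\<omega>. \<bar>X \<omega> $ i * X \<omega> $ j * X \<omega> $ k\<bar> \<partial>M) * supnorm (pd3 h i j k))
         in (bound < \<infinity> \<longrightarrow> integrable M (\<lambda>\<omega>. h (X \<omega>)) \<and> integrable N (\<lambda>\<omega>. h (Z \<omega>))) \<and>
            ennreal \<bar>(\<integral>\<omega>. h (X \<omega>) \<partial>M) - (\<integral>\<omega>. h (Z \<omega>) \<partial>N)\<bar> \<le> bound \<and>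
            bound \<le> ennreal (5 / 6 * \<tau>_bar ^ 3 * real CARD('n) * real \<eta>) * seminorm3 h"
proof -
  interpret prob_space M by fact
  note [measurable] = \<open>X \<in> borel_measurable M\<close> \<open>Z \<in> borel_measurable N\<close>
  note third = assms(3) and centred = assms(4) and A_le_B = assms(9) and h = assms(15)
  have S: "\<Sigma> $ i $ j = (\<integral>\<omega>. X \<omega> $ i * X \<omega> $ j \<partial>M)" for i j
    unfolding assms(7) covariance_matrix_def by (simp add: centred)
  define v where "v i j k = (\<integral>\<omega>. \<bar>X \<omega> $ i * X \<omega> $ j * X \<omega> $ k\<bar> \<partial>M)" for i j k
  define w where "w i j k = \<bar>\<Sigma> $ i $ j\<bar> * (\<integral>\<omega>. \<bar>X \<omega> $ k\<bar> \<partial>M) + v i j k" for i j k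
  define s where "s i j k = supnorm (pd3 h i j k)" for i j k
  define sum3 where "sum3 C f = (\<Sum>i\<in>UNIV. \<Sum>j\<in>A i. \<Sum>k\<in>C i j. f i j k)"
    for C :: "'n \<Rightarrow> 'n \<Rightarrow> 'n set" and f :: "'n \<Rightarrow> 'n \<Rightarrow> 'n \<Rightarrow> ennreal"
  define bound where "bound = ennreal (1 / 3) * sum3 B (\<lambda>i j k. ennreal (w i j k) * s i j k)
    + ennreal (1 / 6) * sum3 (\<lambda>i j. A i) (\<lambda>i j k. ennreal (v i j k) * s i j k)"
  have v0: "0 \<le> v i j k" for i j k unfolding v_def by (intro integral_nonneg_AE) auto
  have e0: "0 \<le> (\<integral>\<omega>. \<bar>X \<omega> $ k\<bar> \<partial>M)" for k by (intro integral_nonneg_AE) auto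
  have vw: "v i j k \<le> w i j k" for i j k unfolding w_def using e0 by simp
  have w0: "0 \<le> w i j k" for i j k using v0 vw order_trans by blast
  \<comment> \<open>Finiteness of the bound forces every supremum with positive weight to be finite,
    which is what the real-valued estimate assumes.\<close>
  have finite_bound: "integrable M (\<lambda>\<omega>. h (X \<omega>)) \<and> integrable N (\<lambda>\<omega>. h (Z \<omega>)) \<and>
      ennreal \<bar>(\<integral>\<omega>. h (X \<omega>) \<partial>M) - (\<integral>\<omega>. h (Z \<omega>) \<partial>N)\<bar> \<le> bound" if "bound < \<infinity>"
  proof -
    have "sum3 B (\<lambda>i j k. ennreal (w i j k) * s i j k) < top"
      using that unfolding bound_def by (auto simp: ennreal_mult_less_top)
    then have "ennreal (w i j k) * s i j k < top" if "j \<in> A i" "k \<in> B i j" for i j k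
      using that unfolding sum3_def by simp
    then have fin: "s i j k < \<infinity>" if "j \<in> A i" "k \<in> B i j" "0 < w i j k" for i j k
      using that by (fastforce simp: ennreal_mult_less_top)
    have hm: "h \<in> borel_measurable borel"
      using h unfolding thrice_partially_diff_def by (intro borel_measurable_partial_diff) blast
    note main = normal_approximation_finite[OF assms(1-4) S assms(8-10,14) h fin[unfolded s_def w_def v_def]]
    let ?c = "\<lambda>i j k. enn2real (s i j k)"
    let ?W = "\<Sum>i\<in>UNIV. \<Sum>j\<in>A i. \<Sum>k\<in>B i j. w i j k * ?c i j k"
    let ?V = "\<Sum>i\<in>UNIV. \<Sum>j\<in>A i. \<Sum>k\<in>A i. v i j k * ?c i j k"
    have iX: "integrable M (\<lambda>\<omega>. h (X \<omega>))" by (rule main(1))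
    have iP: "integrable (distr N borel Z) h" by (rule main(2))
    have approx: "\<bar>(\<integral>\<omega>. h (X \<omega>) \<partial>M) - (\<integral>z. h z \<partial>distr N borel Z)\<bar> \<le> ?W / 3 + ?V / 6"
      unfolding w_def v_def s_def by (rule main(3))
    have iZ: "integrable N (\<lambda>\<omega>. h (Z \<omega>))"
      using iP by (subst (asm) integrable_distr_eq) (simp_all add: hm)
    have EZ: "(\<integral>z. h z \<partial>distr N borel Z) = (\<integral>\<omega>. h (Z \<omega>) \<partial>N)"
      by (rule integral_distr) (simp_all add: hm)
    have W0: "0 \<le> ?W" "0 \<le> ?V" by (intro sum_nonneg mult_nonneg_nonneg w0 v0 enn2real_nonneg)+
    have "sum3 B (\<lambda>i j k. ennreal (w i j k) * s i j k)
        = (\<Sum>i\<in>UNIV. \<Sum>j\<in>A i. \<Sum>k\<in>B i j. ennreal (w i j k * ?c i j k))"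
      unfolding sum3_def s_def
      by (intro sum.cong refl ennreal_weight_supnorm w0 fin[unfolded s_def])
    also have "\<dots> = ennreal ?W" by (simp add: w0 sum_nonneg)
    finally have 1: "sum3 B (\<lambda>i j k. ennreal (w i j k) * s i j k) = ennreal ?W" .
    have "sum3 (\<lambda>i j. A i) (\<lambda>i j k. ennreal (v i j k) * s i j k)
        = (\<Sum>i\<in>UNIV. \<Sum>j\<in>A i. \<Sum>k\<in>A i. ennreal (v i j k * ?c i j k))"
      unfolding sum3_def s_def
    proof (intro sum.cong refl ennreal_weight_supnorm v0)
      \<comment> \<open>The second sum inherits finiteness from the first: \<open>A i\<close> lies
        in \<open>B i j\<close>, and \<open>v\<close> is at most \<open>w\<close>.\<close>
      fix i j k assume "j \<in> A i" "k \<in> A i" "0 < v i j k"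
      then show "supnorm (pd3 h i j k) < \<infinity>"
        using fin[of j i k] A_le_B[of j i] vw[of i j k] unfolding s_def by auto
    qed
    also have "\<dots> = ennreal ?V" by (simp add: v0 sum_nonneg)
    finally have 2: "sum3 (\<lambda>i j. A i) (\<lambda>i j k. ennreal (v i j k) * s i j k) = ennreal ?V" .
    have "bound = ennreal (1 / 3) * ennreal ?W + ennreal (1 / 6) * ennreal ?V"
      unfolding bound_def 1 2 ..
    also have "\<dots> = ennreal (?W / 3 + ?V / 6)"
      using W0 by (simp add: ennreal_mult[symmetric] ennreal_plus[symmetric] del: ennreal_plus)
    finally have "bound = ennreal (?W / 3 + ?V / 6)" .
    then show ?thesis
      using approx iX iZ unfolding EZ by (auto intro: ennreal_leI)
  qed
  have root: "0 \<le> \<tau> i" "(\<integral>\<omega>. \<bar>X \<omega> $ i\<bar> ^ 3 \<partial>M) = \<tau> i ^ 3" for i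
  proof -
    have "0 \<le> (\<integral>\<omega>. \<bar>X \<omega> $ i\<bar> ^ 3 \<partial>M)" by (intro integral_nonneg_AE) auto
    then show "0 \<le> \<tau> i" "(\<integral>\<omega>. \<bar>X \<omega> $ i\<bar> ^ 3 \<partial>M) = \<tau> i ^ 3"
      unfolding assms(5) by simp_all
  qed
  have \<tau>_le: "\<tau> i \<le> \<tau>_bar" for i
    unfolding assms(6) by (intro cSUP_upper bdd_above_finite) auto
  have \<tau>0: "0 \<le> \<tau>_bar" using root(1) \<tau>_le order_trans by blast
  have third_le: "(\<integral>\<omega>. \<bar>X \<omega> $ i\<bar> ^ 3 \<partial>M) \<le> \<tau>_bar ^ 3" for i
    unfolding root(2) by (intro power_mono \<tau>_le root(1))
  have v_le: "v i j k \<le> \<tau>_bar ^ 3" for i j k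
    unfolding v_def by (rule expectation_prod3_le) (simp_all add: third third_le)
  have moments: "(\<integral>\<omega>. \<bar>X \<omega> $ i\<bar> \<partial>M) \<le> \<tau>_bar" "(\<integral>\<omega>. \<bar>X \<omega> $ i * X \<omega> $ j\<bar> \<partial>M) \<le> \<tau>_bar\<^sup>2" for i j
    by (rule expectation_moments_le[OF _ _ third third third_le third_le \<tau>0]; simp)+
  \<comment> \<open>Each of the two summands of \<open>w\<close> is at most the cube of
    \<open>\<tau>_bar\<close>.\<close>
  have w_le: "w i j k \<le> 2 * \<tau>_bar ^ 3" for i j k
  proof -
    have "\<bar>\<Sigma> $ i $ j\<bar> \<le> \<tau>_bar\<^sup>2"
      unfolding S using moments(2)[of i j] integral_abs_bound[of M "\<lambda>\<omega>. X \<omega> $ i * X \<omega> $ j"] by linarith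
    then have "\<bar>\<Sigma> $ i $ j\<bar> * (\<integral>\<omega>. \<bar>X \<omega> $ k\<bar> \<partial>M) \<le> \<tau>_bar\<^sup>2 * \<tau>_bar"
      using moments(1) e0 by (intro mult_mono) auto
    then show ?thesis unfolding w_def using v_le[of i j k] by (simp add: power3_eq_cube power2_eq_square)
  qed
  have \<eta>_ge: "(\<Sum>j\<in>A i. card (B i j)) \<le> \<eta>" for i
    unfolding assms(11) by (intro cSUP_upper bdd_above_finite) auto
  \<comment> \<open>Since \<open>A i\<close> is contained in \<open>B i j\<close>, the second sum
    has no more terms than the first.\<close>
  have \<eta>_ge': "(\<Sum>j\<in>A i. card (A i)) \<le> \<eta>" for i
    using \<eta>_ge[of i] sum_mono[of "A i" "\<lambda>j. card (A i)" "\<lambda>j. card (B i j)"] A_le_B[of _ i]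
    by (meson card_mono finite order_trans)
  define r where "r = seminorm3 h"
  have s_le: "s i j k \<le> r" for i j k
    unfolding s_def r_def by (rule supnorm_pd3_le_seminorm3[OF h])
  let ?n = "real CARD('n)"
  have nn: "0 \<le> \<tau>_bar ^ 3" "0 \<le> ?n * real \<eta>" using \<tau>0 by simp_all
  have "sum3 B (\<lambda>i j k. ennreal (w i j k) * s i j k) \<le> ennreal (?n * real \<eta>) * (ennreal (2 * \<tau>_bar ^ 3) * r)"
    unfolding sum3_def
    by (rule ennreal_sum_const_bound) (auto intro!: mult_mono ennreal_leI w_le s_le \<eta>_ge)
  moreover have "sum3 (\<lambda>i j. A i) (\<lambda>i j k. ennreal (v i j k) * s i j k) \<le> ennreal (?n * real \<eta>) * (ennreal (\<tau>_bar ^ 3) * r)"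
    unfolding sum3_def
    by (rule ennreal_sum_const_bound) (auto intro!: mult_mono ennreal_leI v_le s_le simp del: sum_constant intro: \<eta>_ge')
  ultimately have "bound \<le> ennreal (1 / 3) * (ennreal (?n * real \<eta>) * (ennreal (2 * \<tau>_bar ^ 3) * r))
      + ennreal (1 / 6) * (ennreal (?n * real \<eta>) * (ennreal (\<tau>_bar ^ 3) * r))"
    unfolding bound_def by (intro add_mono mult_left_mono) auto
  also have "\<dots> = ennreal (1 / 3 * (?n * real \<eta>) * (2 * \<tau>_bar ^ 3)) * r
      + ennreal (1 / 6 * (?n * real \<eta>) * \<tau>_bar ^ 3) * r"
    using nn by (simp only: ennreal_mult mult.assoc mult_nonneg_nonneg zero_le_divide_1_iff zero_le_numeral)
  also have "\<dots> = ennreal (1 / 3 * (?n * real \<eta>) * (2 * \<tau>_bar ^ 3) + 1 / 6 * (?n * real \<eta>) * \<tau>_bar ^ 3) * r"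
    using nn by (subst ennreal_plus) (simp_all add: distrib_right)
  \<comment> \<open>The constant is 5/6 = 2/3 + 1/6, with the factor 2 in 2/3 coming from
    \<open>w_le\<close>.\<close>
  also have "1 / 3 * (?n * real \<eta>) * (2 * \<tau>_bar ^ 3) + 1 / 6 * (?n * real \<eta>) * \<tau>_bar ^ 3
      = 5 / 6 * \<tau>_bar ^ 3 * ?n * real \<eta>"
    by simp
  finally have second: "bound \<le> ennreal (5 / 6 * \<tau>_bar ^ 3 * ?n * real \<eta>) * seminorm3 h"
    unfolding r_def .
  have "ennreal \<bar>(\<integral>\<omega>. h (X \<omega>) \<partial>M) - (\<integral>\<omega>. h (Z \<omega>) \<partial>N)\<bar> \<le> bound"
  proof (cases "bound < \<infinity>")
    case False
    then have "bound = \<infinity>" by (simp flip: less_top)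
    then show ?thesis by simp
  qed (use finite_bound in blast)
  with finite_bound second show ?thesis
    unfolding Let_def bound_def sum3_def s_def w_def v_def by blast
qed

end
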